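(* Let $\Delta$ be an irreducible, $2$-spherical, locally finite, thick twin building of type $(W,S)$ with $|S|\geq 3$, and let $J\subseteq S$ be nonempty. Then no automorphism $\theta$ of $\Delta$ maps every $S\setminus J$-residue of $\Delta$ to an opposite residue.
   Context: $(W,S)$ is a Coxeter system with $S$ finite and $W$ irreducible; $\ell$ denotes length, $W_J$ the subgroup generated by $J$. A twin building of type $(W,S)$ consists of two buildings $\Delta^+,\Delta^-$ of type $(W,S)$ (with $W$-distance $\delta$) and a codistance $\delta^*$ on pairs of chambers in different halves such that for $C\in\Delta^\epsilon$, $D\in\Delta^{-\epsilon}$, $w=\delta^*(C,D)$: (Tw1) $\delta^*(D,C)=w^{-1}$; (Tw2) if $\delta(D,E)=s\in S$ and $\ell(sw)=\ell(w)-1$ then $\delta^*(C,E)=sw$; (Tw3) for each $s\in S$ there is $E$ with $\delta(D,E)=s$ and $\delta^*(C,E)=sw$. A $J$-residue of $\Delta^\epsilon$ is a set $\{D\in\Delta^\epsilon:\delta(C,D)\in W_J\}$; panels are $\{s\}$-residues. Chambers in different halves are opposite if $\delta^*(C,D)=1$; residues $P,Q$ in different halves are opposite if every chamber of $P$ is opposite some chamber of $Q$. An automorphism is a bijection of the chamber set preserving adjacency ($\delta(C,D)\in S$) and opposition; it need not preserve types. Thick: every panel has at least $3$ chambers; locally finite: every panel is finite; $2$-spherical: $W_{\{s,t\}}$ is finite for all $s,t\in S$. *)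

theory Defs
  imports "HOL-Algebra.Multiplicative_Group" "HOL-Algebra.Generated_Groups"
begin

section \<open>Coxeter systems\<close>

definition word_eval :: "('w, 'm) monoid_scheme \<Rightarrow> 'w list \<Rightarrow> 'w" where
  "word_eval W ws = foldr (mult W) ws (one W)"

text \<open>
  The congruence on words over \<open>S\<close> generated by the relations \<open>(s t)\<^bsup>m(s,t)\<^esup> = 1\<close>, where
  \<open>m(s,t)\<close> is the order of \<open>s t\<close> in \<open>W\<close>. If \<open>s t\<close> has infinite order then \<open>group.ord\<close> is
  \<open>0\<close> and the relation is the trivial one. The relations for \<open>s = t\<close> are \<open>s s = 1\<close>, so no
  formal inverses of letters are needed.
\<close>
inductive coxeter_cong :: "('w, 'm) monoid_scheme \<Rightarrow> 'w set \<Rightarrow> 'w list \<Rightarrow> 'w list \<Rightarrow> bool"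
  for W S where
  relator: "\<lbrakk>u \<in> lists S; v \<in> lists S; s \<in> S; t \<in> S\<rbrakk> \<Longrightarrow>
      coxeter_cong W S (u @ concat (replicate (group.ord W (s \<otimes>\<^bsub>W\<^esub> t)) [s, t]) @ v) (u @ v)"
| refl: "u \<in> lists S \<Longrightarrow> coxeter_cong W S u u"
| sym: "coxeter_cong W S u v \<Longrightarrow> coxeter_cong W S v u"
| trans: "\<lbrakk>coxeter_cong W S u v; coxeter_cong W S v x\<rbrakk> \<Longrightarrow> coxeter_cong W S u x"

text \<open>
  \<open>W\<close> is presented by the generators \<open>S\<close>, all of order 2, and the relations
  \<open>(s t)\<^bsup>m(s,t)\<^esup> = 1\<close>.
\<close>
locale coxeter_system = group W for W (structure) +
  fixes S :: "'a set"
  assumes S_subset: "S \<subseteq> carrier W"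
    and generated: "generate W S = carrier W"
    and involutions: "s \<in> S \<Longrightarrow> ord s = 2"
    and presentation: "\<lbrakk>u \<in> lists S; v \<in> lists S; word_eval W u = word_eval W v\<rbrakk> \<Longrightarrow>
      coxeter_cong W S u v"

definition cox_length :: "('w, 'm) monoid_scheme \<Rightarrow> 'w set \<Rightarrow> 'w \<Rightarrow> nat" where
  "cox_length W S w = (LEAST n. \<exists>ws \<in> lists S. length ws = n \<and> word_eval W ws = w)"

definition coxeter_diagram :: "('w, 'm) monoid_scheme \<Rightarrow> 'w set \<Rightarrow> ('w \<times> 'w) set" where
  "coxeter_diagram W S =
     {(s, t). s \<in> S \<and> t \<in> S \<and> s \<noteq> t \<and> group.ord W (s \<otimes>\<^bsub>W\<^esub> t) \<noteq> 2}"

definition irreducible_type :: "('w, 'm) monoid_scheme \<Rightarrow> 'w set \<Rightarrow> bool" where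
  "irreducible_type W S \<longleftrightarrow> S \<noteq> {} \<and> (\<forall>s \<in> S. \<forall>t \<in> S. (s, t) \<in> (coxeter_diagram W S)\<^sup>*)"

definition two_spherical :: "('w, 'm) monoid_scheme \<Rightarrow> 'w set \<Rightarrow> bool" where
  "two_spherical W S \<longleftrightarrow> (\<forall>s \<in> S. \<forall>t \<in> S. finite (generate W {s, t}))"

section \<open>Buildings and twin buildings\<close>

locale building = coxeter_system W S for W (structure) and S +
  fixes \<C> :: "'c set" and \<delta> :: "'c \<Rightarrow> 'c \<Rightarrow> 'a"
  assumes nonempty: "\<C> \<noteq> {}"
    and dist_closed: "\<lbrakk>C \<in> \<C>; D \<in> \<C>\<rbrakk> \<Longrightarrow> \<delta> C D \<in> carrier W"
    and WD1: "\<lbrakk>C \<in> \<C>; D \<in> \<C>\<rbrakk> \<Longrightarrow> \<delta> C D = \<one> \<longleftrightarrow> C = D"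
    and WD2: "\<lbrakk>C \<in> \<C>; D \<in> \<C>; C' \<in> \<C>; s \<in> S; \<delta> C' C = s\<rbrakk> \<Longrightarrow>
      \<delta> C' D \<in> {s \<otimes> \<delta> C D, \<delta> C D} \<and>
      (cox_length W S (s \<otimes> \<delta> C D) = cox_length W S (\<delta> C D) + 1 \<longrightarrow>
        \<delta> C' D = s \<otimes> \<delta> C D)"
    and WD3: "\<lbrakk>C \<in> \<C>; D \<in> \<C>; s \<in> S\<rbrakk> \<Longrightarrow>
      \<exists>C' \<in> \<C>. \<delta> C' C = s \<and> \<delta> C' D = s \<otimes> \<delta> C D"

text \<open>
  The two halves are \<open>\<Delta> True\<close> and \<open>\<Delta> False\<close>. They are disjoint sets of chambers, and
  \<open>\<delta>\<close> is only meaningful within a half and \<open>\<delta>s\<close> (the codistance) between different halves.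
  The convention of \<open>Tw2\<close> and \<open>Tw3\<close> is that moving the second chamber acts on the codistance
  from the left.
\<close>
locale twin_building = coxeter_system W S for W (structure) and S +
  fixes \<Delta> :: "bool \<Rightarrow> 'c set"
    and \<delta> :: "'c \<Rightarrow> 'c \<Rightarrow> 'a"
    and \<delta>s :: "'c \<Rightarrow> 'c \<Rightarrow> 'a"
  assumes half_building: "building W S (\<Delta> \<epsilon>) \<delta>"
    and disjoint_halves: "\<Delta> True \<inter> \<Delta> False = {}"
    and codist_closed: "\<lbrakk>C \<in> \<Delta> \<epsilon>; D \<in> \<Delta> (\<not> \<epsilon>)\<rbrakk> \<Longrightarrow> \<delta>s C D \<in> carrier W"
    and Tw1: "\<lbrakk>C \<in> \<Delta> \<epsilon>; D \<in> \<Delta> (\<not> \<epsilon>)\<rbrakk> \<Longrightarrow> \<delta>s D C = inv (\<delta>s C D)"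
    and Tw2: "\<lbrakk>C \<in> \<Delta> \<epsilon>; D \<in> \<Delta> (\<not> \<epsilon>); E \<in> \<Delta> (\<not> \<epsilon>); s \<in> S; \<delta> D E = s;
      int (cox_length W S (s \<otimes> \<delta>s C D)) = int (cox_length W S (\<delta>s C D)) - 1\<rbrakk> \<Longrightarrow>
      \<delta>s C E = s \<otimes> \<delta>s C D"
    and Tw3: "\<lbrakk>C \<in> \<Delta> \<epsilon>; D \<in> \<Delta> (\<not> \<epsilon>); s \<in> S\<rbrakk> \<Longrightarrow>
      \<exists>E \<in> \<Delta> (\<not> \<epsilon>). \<delta> D E = s \<and> \<delta>s C E = s \<otimes> \<delta>s C D"

definition residue_in ::
  "('w, 'm) monoid_scheme \<Rightarrow> 'c set \<Rightarrow> ('c \<Rightarrow> 'c \<Rightarrow> 'w) \<Rightarrow> 'w set \<Rightarrow> 'c set \<Rightarrow> bool" where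
  "residue_in W \<C> \<delta> J R \<longleftrightarrow> (\<exists>C \<in> \<C>. R = {D \<in> \<C>. \<delta> C D \<in> generate W J})"

definition thick ::
  "('w, 'm) monoid_scheme \<Rightarrow> 'w set \<Rightarrow> (bool \<Rightarrow> 'c set) \<Rightarrow> ('c \<Rightarrow> 'c \<Rightarrow> 'w) \<Rightarrow> bool" where
  "thick W S \<Delta> \<delta> \<longleftrightarrow>
     (\<forall>\<epsilon>. \<forall>s \<in> S. \<forall>P. residue_in W (\<Delta> \<epsilon>) \<delta> {s} P \<longrightarrow> infinite P \<or> 3 \<le> card P)"

definition locally_finite ::
  "('w, 'm) monoid_scheme \<Rightarrow> 'w set \<Rightarrow> (bool \<Rightarrow> 'c set) \<Rightarrow> ('c \<Rightarrow> 'c \<Rightarrow> 'w) \<Rightarrow> bool" where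
  "locally_finite W S \<Delta> \<delta> \<longleftrightarrow>
     (\<forall>\<epsilon>. \<forall>s \<in> S. \<forall>P. residue_in W (\<Delta> \<epsilon>) \<delta> {s} P \<longrightarrow> finite P)"

definition adjacent :: "'w set \<Rightarrow> (bool \<Rightarrow> 'c set) \<Rightarrow> ('c \<Rightarrow> 'c \<Rightarrow> 'w) \<Rightarrow> 'c \<Rightarrow> 'c \<Rightarrow> bool" where
  "adjacent S \<Delta> \<delta> C D \<longleftrightarrow> (\<exists>\<epsilon>. C \<in> \<Delta> \<epsilon> \<and> D \<in> \<Delta> \<epsilon> \<and> \<delta> C D \<in> S)"

definition opposite ::
  "('w, 'm) monoid_scheme \<Rightarrow> (bool \<Rightarrow> 'c set) \<Rightarrow> ('c \<Rightarrow> 'c \<Rightarrow> 'w) \<Rightarrow> 'c \<Rightarrow> 'c \<Rightarrow> bool" where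
  "opposite W \<Delta> \<delta>s C D \<longleftrightarrow> (\<exists>\<epsilon>. C \<in> \<Delta> \<epsilon> \<and> D \<in> \<Delta> (\<not> \<epsilon>) \<and> \<delta>s C D = \<one>\<^bsub>W\<^esub>)"

definition opposite_residues ::
  "('w, 'm) monoid_scheme \<Rightarrow> 'w set \<Rightarrow> (bool \<Rightarrow> 'c set) \<Rightarrow> ('c \<Rightarrow> 'c \<Rightarrow> 'w) \<Rightarrow> ('c \<Rightarrow> 'c \<Rightarrow> 'w) \<Rightarrow>
    'c set \<Rightarrow> 'c set \<Rightarrow> bool" where
  "opposite_residues W S \<Delta> \<delta> \<delta>s P Q \<longleftrightarrow>
     (\<exists>\<epsilon>. (\<exists>K \<subseteq> S. residue_in W (\<Delta> \<epsilon>) \<delta> K P) \<and> (\<exists>L \<subseteq> S. residue_in W (\<Delta> (\<not> \<epsilon>)) \<delta> L Q)) \<and>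
     (\<forall>C \<in> P. \<exists>D \<in> Q. opposite W \<Delta> \<delta>s C D)"

definition twin_automorphism ::
  "('w, 'm) monoid_scheme \<Rightarrow> 'w set \<Rightarrow> (bool \<Rightarrow> 'c set) \<Rightarrow> ('c \<Rightarrow> 'c \<Rightarrow> 'w) \<Rightarrow> ('c \<Rightarrow> 'c \<Rightarrow> 'w) \<Rightarrow>
    ('c \<Rightarrow> 'c) \<Rightarrow> bool" where
  "twin_automorphism W S \<Delta> \<delta> \<delta>s \<theta> \<longleftrightarrow>
     bij_betw \<theta> (\<Union>\<epsilon>. \<Delta> \<epsilon>) (\<Union>\<epsilon>. \<Delta> \<epsilon>) \<and>
     (\<forall>C \<in> (\<Union>\<epsilon>. \<Delta> \<epsilon>). \<forall>D \<in> (\<Union>\<epsilon>. \<Delta> \<epsilon>).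
        (adjacent S \<Delta> \<delta> (\<theta> C) (\<theta> D) \<longleftrightarrow> adjacent S \<Delta> \<delta> C D) \<and>
        (opposite W \<Delta> \<delta>s (\<theta> C) (\<theta> D) \<longleftrightarrow> opposite W \<Delta> \<delta>s C D))"

end

theory Submission
  imports Defs "HOL-Number_Theory.Cong" "HOL-Computational_Algebra.Primes" "HOL-Algebra.Sylow"
    "HOL-Combinatorics.Permutations"
begin

text \<open>
  Suppose \<open>\<theta>\<close> is such an automorphism. Looking at the supports of the codistances between \<open>C\<close> and
  \<open>\<theta> C\<close>, irreducibility forces \<open>\<theta>\<close> to preserve types and to map every chamber to an opposite one.
  Composed with projection, \<open>\<theta>\<close> induces on every rank 2 residue of non-commuting type \<open>{s, t}\<close> a map
  sending each chamber to an opposite one; counting closed walks modulo a prime shows that no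
  prime divides both panel parameters \<open>q s\<close> and \<open>q t\<close>. On the other hand, a third generator \<open>u\<close> not
  commuting with both \<open>s\<close> and \<open>t\<close> yields, via projectivities through neighbouring residues, many
  automorphisms of the residue fixing all chambers adjacent to a given one. For coprime parameters
  this is impossible: by a Thompson-Wielandt argument a minimal subnormal subgroup of the
  stabiliser of such a neighbourhood fixes the neighbourhoods of adjacent chambers as well, and hence
  the whole residue.
\<close>

text \<open>When a prime \<open>p\<close> divides both parameters of a rank 2 residue, the panel
  relations become idempotent modulo \<open>p\<close> and multiply as in the 0-Hecke algebra, where
  the longest product is the all-ones matrix. The product one letter shorter, twisted by the
  opposing map, has zero diagonal because a chamber is at distance \<open>m\<close> from its image,
  while its square is still all ones modulo \<open>p\<close>. The trace of its \<open>p\<close>-th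
  power is therefore one, and rotation of closed walks shows that it is zero.

  Coprimality of the parameters drives the group-theoretic half. A simple group of prime order
  cannot have that prime divide both parameters, so it lies in a core of coprime order and spreads
  to adjacent chambers. A nonabelian one may fail to spread to one chamber of a panel, but not to
  two: it would act semiregularly on \<open>q b\<close> chambers and have order coprime to
  \<open>q a\<close>. As panels have at least three chambers, there is still a way around to a panel
  opposite the exceptional one.\<close>

section \<open>Fixed points of maps of prime power order\<close>

lemma funpow_add_apply: "(f ^^ (m + n)) x = (f ^^ m) ((f ^^ n) x)"
  by (simp add: funpow_add)

lemma funpow_multiple_fixed: "(f ^^ n) x = x \<Longrightarrow> (f ^^ (n * k)) x = x"
  by (induction k) (simp_all add: funpow_add_apply)

lemma coprime_periods_fixed:
  fixes m n :: nat
  assumes "coprime m n" "0 < m" "(f ^^ m) x = x" "(f ^^ n) x = x"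
  shows "f x = x"
proof -
  obtain a b where ab: "m * a = n * b + 1" using bezout_nat[of m n] assms by (metis coprime_imp_gcd_eq_1 less_numeral_extra(3))
  have "(f ^^ (m * a)) x = x" "(f ^^ (n * b)) x = x" using assms funpow_multiple_fixed by metis+
  moreover have "(f ^^ (m * a)) x = f ((f ^^ (n * b)) x)" unfolding ab by simp
  ultimately show ?thesis by simp
qed

text \<open>An orbit that is not a fixed point has exactly \<open>p\<close> elements, on which
  \<open>g\<close> is constant, so it contributes a multiple of \<open>p\<close>. Removing such
  orbits one at a time leaves the fixed points.\<close>

lemma sum_prime_period:
  fixes g :: "'b \<Rightarrow> nat"
  assumes "finite A" "prime p" "f ` A \<subseteq> A" "\<And>x. x \<in> A \<Longrightarrow> (f ^^ p) x = x" "\<And>x. x \<in> A \<Longrightarrow> g (f x) = g x"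
  shows "[sum g A = sum g {x \<in> A. f x = x}] (mod p)"
  using assms(1,3,4,5)
proof (induction A rule: finite_psubset_induct)
  case (psubset A)
  show ?case
  proof (cases "\<forall>x\<in>A. f x = x")
    case True
    then have "{x \<in> A. f x = x} = A" by auto
    then show ?thesis by simp
  next
    case False
    then obtain a where a: "a \<in> A" "f a \<noteq> a" by blast
    define Orb where "Orb = (\<lambda>i. (f ^^ i) a) ` {..<p}"
    have Orb_iff: "x \<in> Orb \<longleftrightarrow> (\<exists>i<p. x = (f ^^ i) a)" for x unfolding Orb_def by auto
    have p0: "0 < p" using assms(2) prime_gt_0_nat by blast
    have iA: "(f ^^ i) a \<in> A" for i using psubset.prems(1) a by (induction i) auto
    have gi: "g ((f ^^ i) a) = g a" for i by (induction i) (use psubset.prems(3) iA in auto)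
    have modp: "(f ^^ (i mod p)) a = (f ^^ i) a" for i
    proof -
      have "(f ^^ (p * (i div p))) a = a" using funpow_multiple_fixed psubset.prems(2)[OF a(1)] by metis
      then show ?thesis using funpow_add_apply[of "i mod p" "p * (i div p)" f a] by simp
    qed
    have inj: "inj_on (\<lambda>i. (f ^^ i) a) {..<p}"
    proof (rule linorder_inj_onI)
      fix i j assume ij: "i < j" "i \<in> {..<p}" "j \<in> {..<p}"
      show "(f ^^ i) a \<noteq> (f ^^ j) a"
      proof
        assume e: "(f ^^ i) a = (f ^^ j) a"
        have "(f ^^ (p - i)) ((f ^^ i) a) = a" using funpow_add_apply[of "p - i" i f a] ij psubset.prems(2)[OF a(1)] by simp
        moreover have "(f ^^ (p - i)) ((f ^^ j) a) = (f ^^ (j - i)) a"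
        proof -
          have "p - i + j = (j - i) + p" using ij by auto
          then show ?thesis using funpow_add_apply[of "p - i" j f a] funpow_add_apply[of "j - i" p f a] psubset.prems(2)[OF a(1)] by simp
        qed
        ultimately have "(f ^^ (j - i)) a = a" using e by simp
        \<comment> \<open>The period \<open>j - i\<close> is less than \<open>p\<close>, hence
          coprime to it, and two coprime periods make \<open>a\<close> a fixed point.\<close>
        moreover have "\<not> p dvd (j - i)" using ij by (auto dest: dvd_imp_le)
        then have "coprime (j - i) p" using assms(2) prime_imp_coprime coprime_commute by blast
        ultimately have "f a = a" using coprime_periods_fixed[of "j - i" p f a] psubset.prems(2)[OF a(1)] ij by simp
        then show False using a by simp
      qed
    qed auto
    have sO: "sum g Orb = p * g a" unfolding Orb_def using sum.reindex[OF inj, of g] gi by simp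
    have Osub: "Orb \<subseteq> A" using iA Orb_iff by auto
    have fO: "f x \<in> Orb \<longleftrightarrow> x \<in> Orb" if "x \<in> A" for x
    proof
      assume "x \<in> Orb"
      then obtain i where "x = (f ^^ i) a" using Orb_iff by auto
      then have "f x = (f ^^ (Suc i mod p)) a" using modp[of "Suc i"] by simp
      then show "f x \<in> Orb" using p0 Orb_iff mod_less_divisor by blast
    next
      assume "f x \<in> Orb"
      then obtain i where i: "f x = (f ^^ i) a" using Orb_iff by auto
      have "x = (f ^^ (p - 1)) (f x)" using psubset.prems(2)[OF that] p0 funpow_add_apply[of "p - 1" 1 f x] by simp
      then have "x = (f ^^ ((p - 1 + i) mod p)) a" unfolding i using funpow_add_apply[of "p - 1" i f a] modp by simp
      then show "x \<in> Orb" using p0 Orb_iff mod_less_divisor by blast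
    qed
    have nofix: "f x \<noteq> x" if xO: "x \<in> Orb" for x
    proof
      assume e: "f x = x"
      obtain i where i: "x = (f ^^ i) a" "i < p" using xO Orb_iff by auto
      have "a = (f ^^ (p - i)) x" using i funpow_add_apply[of "p - i" i f a] psubset.prems(2)[OF a(1)] by simp
      moreover have "(f ^^ n) x = x" for n by (induction n) (use e in auto)
      ultimately show False using a e by simp
    qed
    have "[sum g (A - Orb) = sum g {x \<in> A - Orb. f x = x}] (mod p)"
    proof (rule psubset.IH)
      have "a \<in> Orb" unfolding Orb_iff using p0 by (intro exI[of _ 0]) auto
      then show "A - Orb \<subset> A" using Osub by blast
      show "f ` (A - Orb) \<subseteq> A - Orb" using psubset.prems(1) fO by blast
    qed (use psubset.prems in auto)
    moreover have "{x \<in> A - Orb. f x = x} = {x \<in> A. f x = x}" using nofix by auto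
    moreover have "sum g A = sum g (A - Orb) + sum g Orb" using sum.subset_diff[OF Osub psubset.hyps] by simp
    ultimately show ?thesis using sO by (simp add: cong_def)
  qed
qed

text \<open>Induction on the exponent: \<open>f ^^ (p ^ e)\<close> has period \<open>p\<close>,
  which reduces the sum to its own fixed points, and there \<open>f\<close> has period
  \<open>p ^ e\<close>.\<close>

lemma sum_prime_power_period:
  fixes g :: "'b \<Rightarrow> nat"
  assumes "finite A" "prime p" "f ` A \<subseteq> A" "\<And>x. x \<in> A \<Longrightarrow> (f ^^ (p ^ e)) x = x" "\<And>x. x \<in> A \<Longrightarrow> g (f x) = g x"
  shows "[sum g A = sum g {x \<in> A. f x = x}] (mod p)"
  using assms(1,3,4,5)
proof (induction e arbitrary: A)
  case 0
  then have "{x \<in> A. f x = x} = A" by auto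
  then show ?case by simp
next
  case (Suc e)
  let ?h = "f ^^ (p ^ e)" and ?B = "{x \<in> A. (f ^^ (p ^ e)) x = x}"
  have iA: "(f ^^ i) x \<in> A" if "x \<in> A" for i x using Suc.prems(2) that by (induction i) auto
  have gi: "g ((f ^^ i) x) = g x" if "x \<in> A" for i x by (induction i) (use Suc.prems(4) iA that in auto)
  have 1: "[sum g A = sum g ?B] (mod p)"
  proof (rule sum_prime_period[OF Suc.prems(1) assms(2)])
    fix x assume "x \<in> A"
    then show "(?h ^^ p) x = x" using Suc.prems(3) by (simp add: funpow_mult mult.commute)
  qed (use iA gi in auto)
  have 2: "[sum g ?B = sum g {x \<in> ?B. f x = x}] (mod p)"
  proof (rule Suc.IH)
    show "f ` ?B \<subseteq> ?B" using Suc.prems(2) by (auto simp: funpow_swap1[symmetric])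
  qed (use Suc.prems in auto)
  have 3: "{x \<in> ?B. f x = x} = {x \<in> A. f x = x}"
  proof -
    have "(f ^^ n) x = x" if "f x = x" for n x by (induction n) (use that in auto)
    then show ?thesis by auto
  qed
  show ?case using cong_trans[OF 1 2] unfolding 3 .
qed

lemma prime_power_period_fixed_point:
  assumes "finite A" "prime p" "f ` A \<subseteq> A" "\<And>x. x \<in> A \<Longrightarrow> (f ^^ (p ^ e)) x = x" "\<not> p dvd card A"
  obtains x where "x \<in> A" "f x = x"
proof -
  have "[sum (\<lambda>_. 1) A = sum (\<lambda>_. 1::nat) {x \<in> A. f x = x}] (mod p)"
    by (rule sum_prime_power_period[OF assms(1-4)]) auto
  then have c: "[card A = card {x \<in> A. f x = x}] (mod p)" by simp
  have "{x \<in> A. f x = x} \<noteq> {}"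
  proof
    assume e: "{x \<in> A. f x = x} = {}"
    show False using c assms(5) unfolding e cong_def by (simp add: dvd_eq_mod_eq_0)
  qed
  then show thesis using that by blast
qed

declare in_lists_conv_set [simp]

section \<open>Words, length and the exchange condition\<close>

context coxeter_system
begin

abbreviation len :: "'a \<Rightarrow> nat" where "len \<equiv> cox_length W S"
abbreviation ev :: "'a list \<Rightarrow> 'a" where "ev \<equiv> word_eval W"
abbreviation par :: "'a set \<Rightarrow> 'a set" where "par \<equiv> generate W"

lemma S_carrier [simp]: "s \<in> S \<Longrightarrow> s \<in> carrier W"
  using S_subset by blast

lemma S_sq [simp]: "s \<in> S \<Longrightarrow> s \<otimes> s = \<one>"
proof -
  assume s: "s \<in> S"
  have "s [^] ord s = \<one>" using s by (simp add: pow_ord_eq_1)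
  then show ?thesis using s involutions[OF s] by (simp add: numeral_2_eq_2)
qed

lemma S_inv [simp]: "s \<in> S \<Longrightarrow> inv s = s"
  by (simp add: inv_equality)

lemma S_cancel [simp]: "s \<in> S \<Longrightarrow> x \<in> carrier W \<Longrightarrow> s \<otimes> (s \<otimes> x) = x"
  by (simp add: m_assoc[symmetric])

lemma S_cancel_right [simp]: "s \<in> S \<Longrightarrow> x \<in> carrier W \<Longrightarrow> x \<otimes> s \<otimes> s = x"
  by (simp add: m_assoc)

lemma S_not_one: "s \<in> S \<Longrightarrow> s \<noteq> \<one>"
  using involutions ord_eq_1[of s] by fastforce

lemma S_not_one_simps [simp]: "\<one> \<notin> S" using S_not_one by blast

lemma ev_Nil [simp]: "ev [] = \<one>" by (simp add: word_eval_def)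
lemma ev_Cons [simp]: "ev (s # ws) = s \<otimes> ev ws" by (simp add: word_eval_def)

lemma ev_closed [simp]: "ws \<in> lists S \<Longrightarrow> ev ws \<in> carrier W"
  by (induction ws) auto

lemma ev_append: "u \<in> lists S \<Longrightarrow> v \<in> lists S \<Longrightarrow> ev (u @ v) = ev u \<otimes> ev v"
  by (induction u) (auto simp: m_assoc)

lemma rev_lists [simp]: "rev u \<in> lists A \<longleftrightarrow> u \<in> lists A"
  by (simp add: in_lists_conv_set)

lemma ev_rev: "u \<in> lists S \<Longrightarrow> ev (rev u) = inv (ev u)"
proof (induction u)
  case (Cons a u)
  then have "rev u \<in> lists S" "[a] \<in> lists S" by auto
  from ev_append[OF this] show ?case using Cons by (simp add: inv_mult_group)
qed simp

lemma generate_word: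
  assumes "J \<subseteq> S"
  shows "w \<in> par J \<longleftrightarrow> (\<exists>ws\<in>lists J. ev ws = w)"
proof
  assume "w \<in> par J"
  then show "\<exists>ws\<in>lists J. ev ws = w"
  proof (induction rule: generate.induct)
    case one then show ?case by (rule bexI[of _ "[]"]) auto
  next
    case (incl h) then show ?case using assms by (intro bexI[of _ "[h]"]) auto
  next
    case (inv h) then show ?case using assms S_inv by (intro bexI[of _ "[h]"]) auto
  next
    case (eng h1 h2)
    then obtain u v where "u \<in> lists J" "ev u = h1" "v \<in> lists J" "ev v = h2" by blast
    moreover from this have "u \<in> lists S" "v \<in> lists S" using lists_mono[OF assms] by blast+
    ultimately show ?case using ev_append[of u v] by (intro bexI[of _ "u @ v"]) auto
  qed
next
  assume "\<exists>ws\<in>lists J. ev ws = w"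
  then obtain ws where "ws \<in> lists J" "ev ws = w" by blast
  then show "w \<in> par J"
    by (induction ws arbitrary: w) (auto intro: generate.intros)
qed

lemma carrier_word: "w \<in> carrier W \<Longrightarrow> \<exists>ws\<in>lists S. ev ws = w"
  using generate_word[of S] generated by simp

lemma len_le: "ws \<in> lists S \<Longrightarrow> len (ev ws) \<le> length ws"
  unfolding cox_length_def by (rule Least_le) blast

lemma reduced_word:
  assumes "w \<in> carrier W"
  obtains ws where "ws \<in> lists S" "ev ws = w" "length ws = len w"
proof -
  obtain ws where "ws \<in> lists S" "ev ws = w" using carrier_word[OF assms] by blast
  then have "\<exists>n. \<exists>ws\<in>lists S. length ws = n \<and> ev ws = w" by blast
  from LeastI_ex[OF this] show thesis using that unfolding cox_length_def by blast
qed

lemma len_one [simp]: "len \<one> = 0"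
  using len_le[of "[]"] by simp

lemma len_eq_0: "w \<in> carrier W \<Longrightarrow> len w = 0 \<longleftrightarrow> w = \<one>"
  by (metis ev_Nil len_one length_0_conv reduced_word)

lemma len_S [simp]: "s \<in> S \<Longrightarrow> len s = 1"
  using len_le[of "[s]"] len_eq_0[of s] S_not_one[of s] by fastforce

lemma len_mult_le:
  assumes "v \<in> carrier W" "w \<in> carrier W"
  shows "len (v \<otimes> w) \<le> len v + len w"
proof -
  obtain a b where "a \<in> lists S" "ev a = v" "length a = len v" "b \<in> lists S" "ev b = w" "length b = len w"
    using reduced_word assms by metis
  then show ?thesis using len_le[of "a @ b"] ev_append[of a b] by auto
qed

lemma len_inv [simp]:
  assumes "w \<in> carrier W" shows "len (inv w) = len w"
proof -
  have le: "len (inv v) \<le> len v" if v: "v \<in> carrier W" for v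
  proof -
    obtain a where "a \<in> lists S" "ev a = v" "length a = len v" using reduced_word v by metis
    then show ?thesis using len_le[of "rev a"] ev_rev[of a] by auto
  qed
  show ?thesis using le[OF assms] le[of "inv w"] assms by auto
qed

subsection \<open>The reflection cocycle\<close>

text \<open>
  The reflections \<open>s\<^sub>1\<dots>s\<^sub>i\<dots>s\<^sub>1\<close> of the word \<open>s\<^sub>1\<dots>s\<^sub>n\<close>. The parity with which a reflection occurs is
  invariant under the defining relations, hence a function of the group element.
\<close>
primrec word_refls :: "'a list \<Rightarrow> 'a list" where
  "word_refls [] = []"
| "word_refls (s # ws) = s # map (\<lambda>t. s \<otimes> t \<otimes> s) (word_refls ws)"

definition odd_refl :: "'a list \<Rightarrow> 'a \<Rightarrow> bool" where
  "odd_refl ws x \<longleftrightarrow> odd (count_list (word_refls ws) x)"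

lemma word_refls_carrier: "ws \<in> lists S \<Longrightarrow> set (word_refls ws) \<subseteq> carrier W"
  by (induction ws) auto

lemma conj_eq_iff:
  assumes "s \<in> S" "x \<in> carrier W" "y \<in> carrier W"
  shows "s \<otimes> x \<otimes> s = y \<longleftrightarrow> x = s \<otimes> y \<otimes> s"
  using assms by (auto simp: m_assoc)

lemma count_conj:
  assumes "s \<in> S" "set xs \<subseteq> carrier W" "x \<in> carrier W"
  shows "count_list (map (\<lambda>t. s \<otimes> t \<otimes> s) xs) x = count_list xs (s \<otimes> x \<otimes> s)"
  using assms(2) by (induction xs) (use assms conj_eq_iff in auto)

lemma odd_refl_Nil [simp]: "\<not> odd_refl [] x" by (simp add: odd_refl_def)

lemma odd_refl_Cons:
  assumes "s \<in> S" "ws \<in> lists S" "x \<in> carrier W"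
  shows "odd_refl (s # ws) x \<longleftrightarrow> (x = s) \<noteq> odd_refl ws (s \<otimes> x \<otimes> s)"
  using assms word_refls_carrier[of ws] by (auto simp: odd_refl_def count_conj)

lemma odd_refl_append:
  assumes "u \<in> lists S" "v \<in> lists S" "x \<in> carrier W"
  shows "odd_refl (u @ v) x \<longleftrightarrow> odd_refl u x \<noteq> odd_refl v (inv (ev u) \<otimes> x \<otimes> ev u)"
  using assms
proof (induction u arbitrary: x rule: list.induct)
  case Nil then show ?case by simp
next
  case (Cons s u)
  have "ev u \<in> carrier W" "s \<in> S" using Cons.prems by auto
  then have "inv (ev u) \<otimes> (s \<otimes> x \<otimes> s) \<otimes> ev u = inv (ev (s # u)) \<otimes> x \<otimes> ev (s # u)"
    using Cons.prems(3) by (simp add: inv_mult_group m_assoc)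
  then have "odd_refl (u @ v) (s \<otimes> x \<otimes> s) \<longleftrightarrow>
      odd_refl u (s \<otimes> x \<otimes> s) \<noteq> odd_refl v (inv (ev (s # u)) \<otimes> x \<otimes> ev (s # u))"
    using Cons.IH[of "s \<otimes> x \<otimes> s"] Cons.prems by simp
  moreover have "s \<in> S" "u \<in> lists S" "u @ v \<in> lists S" using Cons.prems by auto
  ultimately show ?case using odd_refl_Cons[of s u x] odd_refl_Cons[of s "u @ v" x] Cons.prems(3) by auto
qed

lemma word_refls_relator:
  assumes "s \<in> S" "t \<in> S"
  shows "word_refls (concat (replicate n [s, t])) = map (\<lambda>k. (s \<otimes> t) [^] k \<otimes> s) [0..<2 * n]"
proof (induction n)
  case 0 then show ?case by simp
next
  case (Suc n)
  have e: "s \<otimes> (t \<otimes> ((s \<otimes> t) [^] k \<otimes> s) \<otimes> t) \<otimes> s = (s \<otimes> t) [^] (Suc (Suc k)) \<otimes> s" for k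
  proof -
    have "s \<otimes> (t \<otimes> ((s \<otimes> t) [^] k \<otimes> s) \<otimes> t) \<otimes> s = (s \<otimes> t) \<otimes> (s \<otimes> t) [^] k \<otimes> (s \<otimes> t) \<otimes> s"
      using assms by (simp add: m_assoc)
    also have "(s \<otimes> t) \<otimes> (s \<otimes> t) [^] k = (s \<otimes> t) [^] Suc k"
      using assms nat_pow_Suc2 by simp
    finally show ?thesis using assms by simp
  qed
  have u: "[0..<2 * Suc n] = 0 # 1 # map (\<lambda>k. Suc (Suc k)) [0..<2*n]"
    by (simp add: upt_conv_Cons map_Suc_upt[symmetric] del: upt_Suc)
  show ?case
    unfolding u using Suc e assms by (simp add: comp_def del: upt_Suc nat_pow_Suc)
qed

text \<open>The reflections of the relator form a list of length \<open>ord (s \<otimes> t)\<close>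
  repeated twice, so all multiplicities are even. For infinite order the relator is the empty
  word.\<close>

lemma odd_refl_relator:
  assumes "s \<in> S" "t \<in> S"
  shows "\<not> odd_refl (concat (replicate (ord (s \<otimes> t)) [s, t])) x"
proof -
  let ?n = "ord (s \<otimes> t)" and ?f = "\<lambda>k. (s \<otimes> t) [^] k \<otimes> s"
  have "?f (k + ?n) = ?f k" for k :: nat
    using assms pow_ord_eq_1[of "s \<otimes> t"] nat_pow_mult[of "s \<otimes> t" k ?n, symmetric] by simp
  then have "map ?f [0..<2 * ?n] = map ?f [0..<?n] @ map ?f [0..<?n]"
    by (auto simp: list_eq_iff_nth_eq nth_append) (metis le_add_diff_inverse2 linorder_not_less)
  then show ?thesis
    by (simp add: odd_refl_def word_refls_relator[OF assms] count_list_append)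
qed

lemma ev_relator:
  assumes "s \<in> S" "t \<in> S"
  shows "ev (concat (replicate n [s, t])) = (s \<otimes> t) [^] n"
proof (induction n)
  case (Suc n) then show ?case using assms nat_pow_Suc2[of "s \<otimes> t" n] by (simp add: m_assoc del: nat_pow_Suc)
qed simp

lemma relator_lists: "s \<in> S \<Longrightarrow> t \<in> S \<Longrightarrow> concat (replicate n [s, t]) \<in> lists S"
  by (induction n) auto

text \<open>Inserting a relator changes no parity: its own contribution is even, and as it evaluates
  to one it does not shift the reflections of the letters after it.\<close>

lemma coxeter_cong_odd_refl:
  assumes "coxeter_cong W S u v"
  shows "u \<in> lists S \<and> v \<in> lists S \<and> ev u = ev v \<and> (\<forall>x\<in>carrier W. odd_refl u x = odd_refl v x)"
  using assms
proof (induction rule: coxeter_cong.induct)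
  case (relator u v s t)
  let ?r = "concat (replicate (ord (s \<otimes> t)) [s, t])"
  have r: "?r \<in> lists S" "ev ?r = \<one>"
    using relator by (auto simp: relator_lists ev_relator pow_ord_eq_1)
  have "?r @ v \<in> lists S" "u @ ?r @ v \<in> lists S" "u @ v \<in> lists S" using r relator by auto
  moreover have "odd_refl (?r @ v) x = odd_refl v x" if "x \<in> carrier W" for x
    using odd_refl_append[OF r(1) relator(2) that] r(2) relator odd_refl_relator[of s t] that by auto
  moreover have "ev (?r @ v) = ev v"
    using ev_append[OF r(1) relator(2)] r(2) relator(2) by simp
  ultimately show ?case using relator r odd_refl_append ev_append
    by (auto)
qed auto

lemma odd_refl_cong:
  "u \<in> lists S \<Longrightarrow> v \<in> lists S \<Longrightarrow> ev u = ev v \<Longrightarrow> x \<in> carrier W \<Longrightarrow> odd_refl u x = odd_refl v x"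
  using presentation coxeter_cong_odd_refl by blast

definition del :: "nat \<Rightarrow> 'a list \<Rightarrow> 'a list" where
  "del i ws = take i ws @ drop (Suc i) ws"

lemma del_0 [simp]: "del 0 (s # ws) = ws" by (simp add: del_def)
lemma del_Suc [simp]: "del (Suc i) (s # ws) = s # del i ws" by (simp add: del_def)
lemma del_lists [simp]: "ws \<in> lists A \<Longrightarrow> del i ws \<in> lists A"
  by (auto simp: del_def dest: in_set_takeD in_set_dropD)
lemma length_del: "i < length ws \<Longrightarrow> length (del i ws) = length ws - 1"
  by (simp add: del_def)

text \<open>The reflection at a position is the letter there conjugated by the prefix before it, so
  multiplying by it cancels that letter.\<close>

lemma word_refls_del:
  "ws \<in> lists S \<Longrightarrow> x \<in> set (word_refls ws) \<Longrightarrow> \<exists>i<length ws. x \<otimes> ev ws = ev (del i ws)"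
proof (induction ws arbitrary: x)
  case (Cons s ws)
  show ?case
  proof (cases "x = s")
    case True then show ?thesis using Cons.prems by (intro exI[of _ 0]) auto
  next
    case False
    then obtain y where y: "y \<in> set (word_refls ws)" "x = s \<otimes> y \<otimes> s" using Cons.prems by auto
    then obtain i where i: "i < length ws" "y \<otimes> ev ws = ev (del i ws)" using Cons by auto
    have "y \<in> carrier W" using y Cons.prems word_refls_carrier[of ws] by auto
    then have "x \<otimes> ev (s # ws) = s \<otimes> (y \<otimes> ev ws)"
      using y Cons.prems by (simp add: m_assoc)
    then show ?thesis using i by (intro exI[of _ "Suc i"]) auto
  qed
qed simp

text \<open>The parity may be computed on a reduced word, where an odd count exhibits a letter whose
  deletion gives \<open>s \<otimes> ev ws\<close>. The converse applies this to
  \<open>s # ws\<close>, whose parity at \<open>s\<close> is the opposite one.\<close>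

lemma odd_refl_descent:
  assumes "s \<in> S" "ws \<in> lists S"
  shows "odd_refl ws s \<longleftrightarrow> len (s \<otimes> ev ws) < len (ev ws)"
proof -
  have one: "len (s \<otimes> ev v) < len (ev v)" if v: "v \<in> lists S" "odd_refl v s" for v
  proof -
    obtain v' where v': "v' \<in> lists S" "ev v' = ev v" "length v' = len (ev v)"
      using reduced_word[of "ev v"] v by auto
    then have "odd_refl v' s" using odd_refl_cong[of v' v s] v assms by auto
    then have "s \<in> set (word_refls v')" unfolding odd_refl_def by (metis count_notin even_zero)
    then obtain i where i: "i < length v'" "s \<otimes> ev v' = ev (del i v')" using word_refls_del v' by blast
    then have "len (s \<otimes> ev v) \<le> length (del i v')" using len_le[OF del_lists[OF v'(1)]] v' by auto
    also have "\<dots> < len (ev v)" using i v' length_del[OF i(1)] by auto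
    finally show ?thesis .
  qed
  have "len (s \<otimes> ev ws) \<ge> len (ev ws)" if "\<not> odd_refl ws s"
  proof -
    have "odd_refl (s # ws) s" using that assms by (simp add: odd_refl_Cons)
    then have "len (s \<otimes> ev (s # ws)) < len (ev (s # ws))" using one[of "s # ws"] assms by auto
    then show ?thesis using assms by auto
  qed
  then show ?thesis using one[of ws] assms by fastforce
qed

theorem exchange:
  assumes "s \<in> S" "ws \<in> lists S" "len (s \<otimes> ev ws) < len (ev ws)"
  obtains i where "i < length ws" "s \<otimes> ev ws = ev (del i ws)"
proof -
  have "s \<in> set (word_refls ws)"
    using odd_refl_descent[OF assms(1,2)] assms(3) unfolding odd_refl_def by (metis count_notin even_zero)
  then show thesis using that word_refls_del assms(2) by blast
qed

text \<open>Exactly one of \<open>ws\<close> and \<open>s # ws\<close> has odd parity at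
  \<open>s\<close>, so the two lengths differ.\<close>

lemma len_mult_S:
  assumes "s \<in> S" "w \<in> carrier W"
  shows "len (s \<otimes> w) = len w + 1 \<or> len w = len (s \<otimes> w) + 1"
proof -
  obtain ws where ws: "ws \<in> lists S" "ev ws = w" using carrier_word assms by blast
  have "len (s \<otimes> w) \<noteq> len w"
    using odd_refl_descent[of s ws] odd_refl_descent[of s "s # ws"] ws assms
    by (auto simp: odd_refl_Cons)
  moreover have "len (s \<otimes> w) \<le> len w + 1" using len_mult_le[of s w] assms by auto
  moreover have "len w \<le> len (s \<otimes> w) + 1" using len_mult_le[of s "s \<otimes> w"] assms by auto
  ultimately show ?thesis by linarith
qed

lemma exchange_right:
  assumes "s \<in> S" "ws \<in> lists S" "len (ev ws \<otimes> s) < len (ev ws)"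
  obtains i where "i < length ws" "ev ws \<otimes> s = ev (del i ws)"
proof -
  have e: "s \<otimes> ev (rev ws) = inv (ev ws \<otimes> s)" using assms by (simp add: ev_rev inv_mult_group)
  have r: "rev ws \<in> lists S" using assms by auto
  have "len (s \<otimes> ev (rev ws)) < len (ev (rev ws))"
    unfolding e using assms ev_rev by simp
  then obtain i where i: "i < length ws" "s \<otimes> ev (rev ws) = ev (del i (rev ws))"
    using exchange[OF assms(1) r] by auto
  let ?j = "length ws - Suc i"
  have j: "rev (del i (rev ws)) = del ?j ws"
    using i(1) by (simp add: del_def rev_take rev_drop Suc_diff_Suc)
  have "ev ws \<otimes> s = inv (ev (del i (rev ws)))"
    using e i(2) assms by (metis S_carrier ev_closed inv_inv m_closed)
  also have "\<dots> = ev (del ?j ws)" using j ev_rev[OF del_lists[OF r], of i] by simp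
  finally show thesis using that[of ?j] i by auto
qed

subsection \<open>Parabolic subgroups\<close>

lemma par_subgroup: "J \<subseteq> S \<Longrightarrow> subgroup (par J) W"
  using generate_is_subgroup S_subset by blast

lemma par_carrier: "J \<subseteq> S \<Longrightarrow> w \<in> par J \<Longrightarrow> w \<in> carrier W"
  by (rule subgroup.mem_carrier[OF par_subgroup])

lemma par_one [simp]: "\<one> \<in> par J" by (rule generate.one)
lemma par_incl: "s \<in> J \<Longrightarrow> s \<in> par J" by (rule generate.incl)
lemma par_mult: "v \<in> par J \<Longrightarrow> w \<in> par J \<Longrightarrow> v \<otimes> w \<in> par J" by (rule generate.eng)
lemma par_inv: "J \<subseteq> S \<Longrightarrow> w \<in> par J \<Longrightarrow> inv w \<in> par J"
  by (rule subgroup.m_inv_closed[OF par_subgroup])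

lemma par_mult_left:
  assumes "J \<subseteq> S" "v \<in> par J" "w \<in> carrier W"
  shows "v \<otimes> w \<in> par J \<longleftrightarrow> w \<in> par J"
proof
  assume "v \<otimes> w \<in> par J"
  then have "inv v \<otimes> (v \<otimes> w) \<in> par J" by (rule par_mult[OF par_inv[OF assms(1,2)]])
  then show "w \<in> par J" using assms par_carrier[OF assms(1,2)] by (simp add: m_assoc[symmetric])
qed (use assms par_mult in auto)

lemma par_mult_right:
  assumes "J \<subseteq> S" "v \<in> par J" "w \<in> carrier W"
  shows "w \<otimes> v \<in> par J \<longleftrightarrow> w \<in> par J"
proof
  assume "w \<otimes> v \<in> par J"
  then have "(w \<otimes> v) \<otimes> inv v \<in> par J" by (rule par_mult[OF _ par_inv[OF assms(1,2)]])
  then show "w \<in> par J" using assms par_carrier[OF assms(1,2)] by (simp add: m_assoc)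
qed (use assms par_mult in auto)

text \<open>Exchange only deletes letters, so a shortest word is reached without leaving
  \<open>J\<close>.\<close>

lemma par_reduced:
  assumes J: "J \<subseteq> S" and "w \<in> par J"
  obtains ws where "ws \<in> lists J" "ws \<in> lists S" "ev ws = w" "length ws = len w"
proof -
  obtain us where us: "us \<in> lists J" "ev us = w" using generate_word[OF J] assms by blast
  have "\<exists>ws\<in>lists J. ev ws = ev us \<and> length ws = len (ev us)" using us(1)
  proof (induction us rule: list.induct)
    case (Cons s us)
    then obtain v where v: "v \<in> lists J" "ev v = ev us" "length v = len (ev us)" by auto
    have s: "s \<in> J" "s \<in> S" and vS: "v \<in> lists S" using Cons v J by auto
    show ?case
    proof (cases "len (s \<otimes> ev v) < len (ev v)")
      case True
      obtain i where i: "i < length v" "s \<otimes> ev v = ev (del i v)" using exchange[OF s(2) vS True] .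
      then have "length (del i v) = len (s \<otimes> ev v)"
        using True v length_del[OF i(1)] len_mult_S[OF s(2) ev_closed[OF vS]] by auto
      then show ?thesis using i v del_lists[OF v(1)] by (intro bexI[of _ "del i v"]) auto
    next
      case False
      then have "len (s \<otimes> ev v) = len (ev v) + 1" using len_mult_S[OF s(2) ev_closed[OF vS]] by auto
      then show ?thesis using v s by (intro bexI[of _ "s # v"]) auto
    qed
  qed (auto intro: bexI[of _ "[]"])
  then show thesis using us that lists_mono[OF J] by blast
qed

lemma S_par: "J \<subseteq> S \<Longrightarrow> s \<in> S \<Longrightarrow> s \<in> par J \<longleftrightarrow> s \<in> J"
proof
  assume a: "J \<subseteq> S" "s \<in> S" "s \<in> par J"
  obtain ws where ws: "ws \<in> lists J" "ws \<in> lists S" "ev ws = s" "length ws = len s" using par_reduced[OF a(1,3)] .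
  then obtain t where "ws = [t]" using a by (auto simp: length_Suc_conv)
  then show "s \<in> J" using ws by simp
qed (simp add: par_incl)

text \<open>A descent would delete a letter from a word over \<open>J\<close>, putting
  \<open>s \<otimes> w\<close> and hence \<open>s\<close> into \<open>par J\<close>.\<close>

lemma par_len_up:
  assumes "J \<subseteq> S" "s \<in> S" "s \<notin> J" "w \<in> par J"
  shows "len (s \<otimes> w) = len w + 1"
proof (rule ccontr)
  assume n: "len (s \<otimes> w) \<noteq> len w + 1"
  have w: "w \<in> carrier W" using par_carrier assms by blast
  obtain ws where ws: "ws \<in> lists J" "ws \<in> lists S" "ev ws = w" "length ws = len w" using par_reduced[OF assms(1,4)] .
  have "len (s \<otimes> ev ws) < len (ev ws)" using n len_mult_S[OF assms(2) w] ws by auto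
  then obtain i where "s \<otimes> ev ws = ev (del i ws)" using exchange[OF assms(2) ws(2)] by blast
  then have "s \<otimes> w \<in> par J" using ws del_lists[OF ws(1)] generate_word[OF assms(1)] by metis
  then have "s \<in> par J" using par_mult_right[OF assms(1,4)] assms by simp
  then show False using S_par assms by blast
qed

lemma par_len_up_right:
  assumes "J \<subseteq> S" "s \<in> S" "s \<notin> J" "w \<in> par J"
  shows "len (w \<otimes> s) = len w + 1"
proof -
  have "w \<in> carrier W" using par_carrier assms by blast
  then show ?thesis
    using par_len_up[OF assms(1-3) par_inv[OF assms(1,4)]] len_inv[of "w \<otimes> s"] assms(2)
    by (simp add: inv_mult_group)
qed

lemma par_reduced_set:
  assumes "J \<subseteq> S" "ws \<in> lists S" "length ws = len (ev ws)" "ev ws \<in> par J"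
  shows "set ws \<subseteq> J"
  using assms(2-4)
proof (induction ws rule: list.induct)
  case (Cons s ws)
  have s: "s \<in> S" and ws: "ws \<in> lists S" using Cons.prems by auto
  have "len (s \<otimes> ev (s # ws)) < len (ev (s # ws))"
    using len_le[OF ws] Cons.prems s ws by auto
  then have sJ: "s \<in> J" using par_len_up[OF assms(1) s _ Cons.prems(3)] by auto
  have "length ws = len (ev ws)"
    using len_le[OF ws] Cons.prems len_mult_S[OF s ev_closed[OF ws]] by auto
  moreover have "ev ws \<in> par J"
    using Cons.prems(3) par_mult_left[OF assms(1) par_incl[OF sJ] ev_closed[OF ws]] by simp
  ultimately show ?case using Cons.IH ws sJ by auto
qed simp

text \<open>A maximum is only known to exist when \<open>par J\<close> is finite, which all uses
  assume; \<open>longest_unique\<close> makes the choice immaterial.\<close>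

definition longest :: "'a set \<Rightarrow> 'a" where
  "longest J = (SOME w. w \<in> par J \<and> (\<forall>v\<in>par J. len v \<le> len w))"

lemma longest:
  assumes "finite (par J)"
  shows "longest J \<in> par J" "v \<in> par J \<Longrightarrow> len v \<le> len (longest J)"
proof -
  have "\<exists>w. w \<in> par J \<and> (\<forall>v\<in>par J. len v \<le> len w)"
  proof -
    have "par J \<noteq> {}" using par_one[of J] by blast
    then have "Max (len ` par J) \<in> len ` par J" using assms by (intro Max_in) auto
    then obtain w where "w \<in> par J" "len w = Max (len ` par J)" by auto
    then show ?thesis using assms Max_ge[of "len ` par J"] by auto
  qed
  from someI_ex[OF this] show "longest J \<in> par J" "v \<in> par J \<Longrightarrow> len v \<le> len (longest J)"
    unfolding longest_def by auto
qed

text \<open>Every element of \<open>par J\<close> begins some reduced word of the longest element.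
  Inductively \<open>v @ b\<close> is such a word; \<open>s\<close> is a descent, so exchange
  deletes a letter, and not one of \<open>v\<close> because \<open>s # v\<close> is reduced. Hence
  \<open>s # v\<close> followed by the shortened \<open>b\<close> is again a reduced word.\<close>

lemma len_mult_longest:
  assumes J: "J \<subseteq> S" "finite (par J)" and "v \<in> par J"
  shows "len (inv v \<otimes> longest J) + len v = len (longest J)"
proof -
  let ?w = "longest J"
  have w: "?w \<in> par J" "?w \<in> carrier W" using longest(1)[OF J(2)] par_carrier[OF J(1)] by auto
  obtain vs where vs: "vs \<in> lists J" "vs \<in> lists S" "ev vs = v" "length vs = len v" using par_reduced[OF J(1) assms(3)] .
  have "len (inv (ev vs) \<otimes> ?w) + length vs = len ?w" using vs(1,2) vs(4)[folded vs(3)]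
  proof (induction vs rule: list.induct)
    case Nil then show ?case using w by simp
  next
    case (Cons s v)
    have s: "s \<in> J" "s \<in> S" and v: "v \<in> lists J" "v \<in> lists S" and evv: "ev v \<in> carrier W"
      using Cons.prems J by auto
    have lv: "length v = len (ev v)"
      using len_le[OF v(2)] Cons.prems(3) len_mult_S[OF s(2) evv] by auto
    let ?x = "inv (ev v) \<otimes> ?w"
    have x: "?x \<in> carrier W" using evv w by simp
    have IH: "len ?x + length v = len ?w" using Cons v lv by auto
    obtain b where b: "b \<in> lists S" "ev b = ?x" "length b = len ?x" using reduced_word[OF x] .
    have vb: "v @ b \<in> lists S" "ev (v @ b) = ?w"
      using v b ev_append[OF v(2) b(1)] evv w by (auto simp: m_assoc[symmetric])
    have "len (s \<otimes> ?w) \<le> len ?w" by (rule longest(2)[OF J(2) par_mult[OF par_incl[OF s(1)] w(1)]])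
    then have "len (s \<otimes> ev (v @ b)) < len (ev (v @ b))" using len_mult_S[OF s(2) w(2)] vb by auto
    then obtain i where i: "i < length (v @ b)" "s \<otimes> ?w = ev (del i (v @ b))"
      using exchange[OF s(2) vb(1)] vb(2) by metis
    have "\<not> i < length v"
    proof
      assume lt: "i < length v"
      then have "del i (v @ b) = del i v @ b" by (simp add: del_def)
      then have "s \<otimes> (ev v \<otimes> ?x) = ev (del i v) \<otimes> ?x"
        using i(2) vb(2) ev_append[OF del_lists[OF v(2)] b(1)] b(2) ev_append[OF v(2) b(1)] by metis
      then have "s \<otimes> ev v = ev (del i v)"
        using x evv s ev_closed[OF del_lists[OF v(2)]] by (metis S_carrier m_assoc m_closed right_cancel)
      then show False
        using len_le[OF del_lists[OF v(2)], of i] length_del[OF lt] Cons.prems(3) lv lt by auto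
    qed
    then obtain j where j: "i = length v + j" "j < length b" using i(1)
      by (metis add_less_cancel_left le_add_diff_inverse length_append linorder_not_less)
    then have "del i (v @ b) = v @ del j b" by (simp add: del_def)
    then have e: "s \<otimes> ?w = ev v \<otimes> ev (del j b)" using i(2) ev_append[OF v(2) del_lists[OF b(1)]] by simp
    have "inv (ev (s # v)) \<otimes> ?w = inv (ev v) \<otimes> (s \<otimes> ?w)"
      using s evv w by (simp add: inv_mult_group m_assoc)
    also have "\<dots> = ev (del j b)" unfolding e using evv ev_closed[OF del_lists[OF b(1)]] by (simp add: m_assoc[symmetric])
    finally have "len (inv (ev (s # v)) \<otimes> ?w) \<le> length b - 1"
      using len_le[OF del_lists[OF b(1)], of j] length_del[OF j(2)] by simp
    moreover have "len ?w \<le> len (ev (s # v)) + len (inv (ev (s # v)) \<otimes> ?w)"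
      using len_mult_le[of "ev (s # v)" "inv (ev (s # v)) \<otimes> ?w"] s evv w by (simp add: m_assoc[symmetric])
    ultimately show ?case using IH b(3) Cons.prems(3) j(2) by auto
  qed
  then show ?thesis using vs by simp
qed

lemma len_longest_mult:
  assumes J: "J \<subseteq> S" "finite (par J)" and "v \<in> par J"
  shows "len (v \<otimes> longest J) + len v = len (longest J)"
proof -
  have "v \<in> carrier W" using par_carrier[OF J(1) assms(3)] .
  then show ?thesis using len_mult_longest[OF J par_inv[OF J(1) assms(3)]] by simp
qed

context
  fixes J assumes J: "J \<subseteq> S" and fin: "finite (par J)"
begin

lemma longest_carrier [simp]: "longest J \<in> carrier W"
  using longest(1)[OF fin] par_carrier[OF J] by blast

lemma longest_unique: "v \<in> par J \<Longrightarrow> len v = len (longest J) \<Longrightarrow> v = longest J"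
proof -
  assume v: "v \<in> par J" "len v = len (longest J)"
  have vc: "v \<in> carrier W" using par_carrier[OF J v(1)] .
  have "len (inv v \<otimes> longest J) = 0" using len_mult_longest[OF J fin v(1)] v by simp
  then have "inv v \<otimes> longest J = \<one>" using len_eq_0 vc by simp
  then show ?thesis using vc by (metis inv_equality inv_closed inv_inv longest_carrier)
qed

lemma longest_inv [simp]: "inv (longest J) = longest J"
  using longest_unique par_inv[OF J] longest(1)[OF fin] by simp

lemma longest_sq [simp]: "longest J \<otimes> longest J = \<one>"
  using r_inv[OF longest_carrier] by simp

lemma longest_cancel [simp]: "x \<in> carrier W \<Longrightarrow> longest J \<otimes> (longest J \<otimes> x) = x"
  by (simp add: m_assoc[symmetric])

text \<open>Multiplication by the longest element on either side replaces a length by its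
  complement, so conjugation preserves length and sends letters to letters.\<close>

lemma longest_conj_S:
  assumes "s \<in> J" shows "longest J \<otimes> s \<otimes> longest J \<in> J"
proof -
  let ?w = "longest J" and ?v = "longest J \<otimes> s"
  have s: "s \<in> S" using assms J by blast
  have v: "?v \<in> par J" by (rule par_mult[OF longest(1)[OF fin] par_incl[OF assms]])
  have "len (s \<otimes> ?w) + 1 = len ?w" using len_longest_mult[OF J fin par_incl[OF assms]] s by simp
  moreover have "len ?v = len (s \<otimes> ?w)" using len_inv[of ?v] s by (simp add: inv_mult_group)
  ultimately have "len (?v \<otimes> ?w) = 1" using len_longest_mult[OF J fin v] by simp
  moreover have m: "?v \<otimes> ?w \<in> par J" by (rule par_mult[OF v longest(1)[OF fin]])
  moreover obtain ws where "ws \<in> lists J" "ws \<in> lists S" "ev ws = ?v \<otimes> ?w" "length ws = len (?v \<otimes> ?w)"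
    using par_reduced[OF J m] .
  ultimately show ?thesis by (auto simp: length_Suc_conv)
qed

end

lemma sts_reduced:
  assumes "s \<in> S" "t \<in> S" "s \<otimes> t \<noteq> t \<otimes> s"
  shows "len (s \<otimes> t \<otimes> s) = 3"
proof -
  have "t \<notin> {s}" using assms by auto
  then have ts: "len (t \<otimes> s) = 2" using par_len_up[of "{s}" t s] assms par_incl by simp
  have "\<not> len (s \<otimes> ev [t, s]) < len (ev [t, s])"
  proof
    assume "len (s \<otimes> ev [t, s]) < len (ev [t, s])"
    then obtain i where i: "i < length [t, s]" "s \<otimes> ev [t, s] = ev (del i [t, s])"
      using exchange[of s "[t, s]"] assms by auto
    then consider "s \<otimes> (t \<otimes> s) = s" | "s \<otimes> (t \<otimes> s) = t"
      using assms by (auto simp: less_Suc_eq)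
    then show False
    proof cases
      case 1
      then have "t \<otimes> s = \<one>" using assms l_cancel_one by auto
      then show ?thesis using ts by simp
    next
      case 2
      then have "s \<otimes> t = t \<otimes> s" using assms by (metis S_cancel S_carrier m_closed)
      then show ?thesis using assms by simp
    qed
  qed
  then show ?thesis using len_mult_S[of s "t \<otimes> s"] ts assms by (auto simp: m_assoc)
qed

lemma reduced_tail:
  assumes "s # ws \<in> lists S" "length (s # ws) = len (ev (s # ws))"
  shows "length ws = len (ev ws)"
proof -
  have "ws \<in> lists S" "s \<in> S" using assms by auto
  then show ?thesis using assms len_le[of ws] len_mult_S[of s "ev ws"] by auto
qed

text \<open>A letter outside \<open>K\<close> can disappear from \<open>s w s'\<close> only by
  commuting past all of \<open>w\<close>. The induction strips a reduced word of \<open>w\<close>: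
  length considerations give \<open>s w s = w\<close>, and once the leading letter commutes with
  \<open>s\<close> it cancels from this equation.\<close>

lemma par_conj_commute:
  assumes K: "K \<subseteq> S" and s: "s \<in> S" "s \<notin> K" and s': "s' \<in> S"
    and ws: "ws \<in> lists K" "length ws = len (ev ws)" and c: "s \<otimes> ev ws \<otimes> s' \<in> par K"
  shows "s' = s \<and> (\<forall>t\<in>set ws. s \<otimes> t = t \<otimes> s)"
  using ws c
proof (induction ws rule: list.induct)
  case Nil
  have "s' = s"
  proof (rule ccontr)
    assume "s' \<noteq> s"
    then have "len (s \<otimes> s') = 2" using par_len_up[of "{s'}" s s'] s s' par_incl by simp
    then have "set [s, s'] \<subseteq> K" using par_reduced_set[OF K, of "[s, s']"] Nil s s' by simp
    then show False using s by simp
  qed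
  then show ?case by simp
next
  case (Cons t v)
  let ?w = "ev (t # v)"
  have wsK: "t # v \<in> lists K" "t # v \<in> lists S" and t: "t \<in> K" "t \<in> S" and v: "v \<in> lists K" "v \<in> lists S"
    using Cons.prems K by auto
  have w: "?w \<in> carrier W" and wK: "?w \<in> par K" using wsK generate_word[OF K] ev_closed by blast+
  have evv: "ev v \<in> carrier W" using v by simp
  have "s \<in> par (insert s' K)"
  proof -
    have "s = (s \<otimes> ?w \<otimes> s') \<otimes> s' \<otimes> inv ?w" using w s s' by (simp add: m_assoc)
    moreover have "s \<otimes> ?w \<otimes> s' \<in> par (insert s' K)" "s' \<in> par (insert s' K)" "inv ?w \<in> par (insert s' K)"
      using mono_generate[of K "insert s' K"] Cons.prems(3) par_incl par_inv[OF K wK] by blast+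
    ultimately show ?thesis using par_mult by metis
  qed
  then have s's: "s' = s" using S_par[of "insert s' K" s] K s s' by auto
  have swl: "len (s \<otimes> ?w) = len ?w + 1" using par_len_up[OF K s wK] .
  have sw: "s # t # v \<in> lists S" "length (s # t # v) = len (ev (s # t # v))"
    using wsK s swl Cons.prems(2) by auto
  \<comment> \<open>The element on the left lies in \<open>par K\<close>, so multiplying it by
    \<open>s\<close> raises its length; the result is \<open>?w \<otimes> s\<close>, of length
    \<open>len ?w + 1\<close>.\<close>
  have "len (s \<otimes> ?w \<otimes> s) < len (s \<otimes> ?w)"
  proof -
    have "len (s \<otimes> (s \<otimes> ?w \<otimes> s)) = len (s \<otimes> ?w \<otimes> s) + 1"
      using par_len_up[OF K s] Cons.prems(3) s's by simp
    moreover have "s \<otimes> (s \<otimes> ?w \<otimes> s) = ?w \<otimes> s" using s w by (simp add: m_assoc)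
    moreover have "len (?w \<otimes> s) = len ?w + 1" using par_len_up_right[OF K s wK] .
    ultimately show ?thesis using swl by simp
  qed
  then have "len (ev (s # t # v) \<otimes> s) < len (ev (s # t # v))" by simp
  then obtain i where i: "i < length (s # t # v)" "ev (s # t # v) \<otimes> s = ev (del i (s # t # v))"
    using exchange_right[OF s(1) sw(1)] by blast
  have sws: "s \<otimes> ?w \<otimes> s = ?w"
  proof (cases i)
    case 0 then show ?thesis using i by simp
  next
    case (Suc j)
    then have e: "s \<otimes> ?w \<otimes> s = s \<otimes> ev (del j (t # v))" using i by simp
    have d: "ev (del j (t # v)) \<in> par K" using del_lists[OF wsK(1)] generate_word[OF K] by blast
    have "s \<otimes> ev (del j (t # v)) \<in> par K" using e Cons.prems(3) s's by simp
    then have "s \<in> par K" using par_mult_right[OF K d] s by simp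
    then show ?thesis using S_par[OF K] s by simp
  qed
  then have comm: "s \<otimes> ?w = ?w \<otimes> s" using s w by (metis S_cancel_right S_carrier m_closed)
  have st: "s \<otimes> t = t \<otimes> s"
  proof (rule ccontr)
    \<comment> \<open>\<open>t\<close> is a left descent of \<open>s w = w s\<close>. As
      \<open>s\<close> and \<open>t\<close> do not commute, exchange replaces the reduced word
      \<open>s t v\<close> by one starting with \<open>t s t\<close>; stripping \<open>s\<close>
      from that leaves a reduced word of \<open>w\<close>, which either contains \<open>s\<close> or
      starts with \<open>t t\<close>.\<close>
    assume nc: "s \<otimes> t \<noteq> t \<otimes> s"
    have "t \<otimes> (s \<otimes> ?w) = ev (v @ [s])"
      unfolding comm using t s evv ev_append[OF v(2), of "[s]"] by (simp add: m_assoc)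
    then have "len (t \<otimes> (s \<otimes> ?w)) \<le> length v + 1" using len_le[of "v @ [s]"] v s by simp
    then have "len (t \<otimes> ev (s # t # v)) < len (ev (s # t # v))" using sw(2) by simp
    then obtain k where k: "k < length (s # t # v)" "t \<otimes> ev (s # t # v) = ev (del k (s # t # v))"
      using exchange[OF t(2) sw(1)] by blast
    consider "k = 0" | "k = 1" | j where "k = Suc (Suc j)" by (metis One_nat_def not0_implies_Suc)
    then show False
    proof cases
      case 1
      then have "t \<otimes> (s \<otimes> (t \<otimes> ev v)) = t \<otimes> ev v" using k by simp
      then have "s \<otimes> (t \<otimes> ev v) = ev v" using t s evv by simp
      then have "s \<otimes> t = \<one>" using t s evv by (metis S_carrier l_cancel_one m_assoc m_closed r_cancel_one)
      then have "s = t" using t s by (metis S_carrier S_inv inv_equality)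
      then show False using nc by simp
    next
      case 2
      then have "t \<otimes> (s \<otimes> (t \<otimes> ev v)) = s \<otimes> ev v" using k by simp
      then have "(t \<otimes> s \<otimes> t) \<otimes> ev v = s \<otimes> ev v" using t s evv by (simp add: m_assoc)
      then have "t \<otimes> s \<otimes> t = s" using t s evv by (metis S_carrier m_closed right_cancel)
      then have "t \<otimes> s = s \<otimes> t" using t s by (metis S_cancel_right S_carrier m_closed)
      then show False using nc by simp
    next
      case 3
      let ?k = "del j v"
      have lk: "?k \<in> lists K" "?k \<in> lists S" and j: "j < length v"
        using del_lists[OF v(1)] del_lists[OF v(2)] k(1) 3 by auto
      have e: "t \<otimes> ev (s # t # v) = ev (s # t # ?k)" using k 3 by simp
      have u: "[t, s, t] @ ?k \<in> lists S" using lk s t by auto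
      have e2: "ev ([t, s, t] @ ?k) = s \<otimes> ?w"
      proof -
        have "t \<otimes> (t \<otimes> ev (s # t # v)) = t \<otimes> ev (s # t # ?k)" using e by simp
        then show ?thesis using t s evv by simp
      qed
      have "len (s \<otimes> ev ([t, s, t] @ ?k)) < len (ev ([t, s, t] @ ?k))"
        unfolding e2 using s w swl by simp
      then obtain n where n: "n < length ([t, s, t] @ ?k)" "s \<otimes> ev ([t, s, t] @ ?k) = ev (del n ([t, s, t] @ ?k))"
        using exchange[OF s(1) u] by blast
      have en: "ev (del n ([t, s, t] @ ?k)) = ?w" using n(2) e2 s w by simp
      have ln: "length (del n ([t, s, t] @ ?k)) = len (ev (del n ([t, s, t] @ ?k)))"
        unfolding en length_del[OF n(1)] using length_del[OF j] j Cons.prems(2) by simp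
      have sub: "set (del n ([t, s, t] @ ?k)) \<subseteq> K"
        using par_reduced_set[OF K del_lists[OF u] ln] en wK by simp
      consider "n = 0" | "n = 1" | "n = 2" | i where "n = Suc (Suc (Suc i))"
        by (metis One_nat_def not0_implies_Suc numeral_2_eq_2)
      then show False
      proof cases
        case 2
        then have r: "length (t # t # ?k) = len (ev (t # t # ?k))" using ln by simp
        have "ev (t # t # ?k) = ev ?k" using t ev_closed[OF lk(2)] by simp
        then show False using r len_le[OF lk(2)] by simp
      qed (use sub s in \<open>auto simp: numeral_2_eq_2\<close>)
    qed
  qed
  have "s \<otimes> ev v \<otimes> s = ev v"
  proof -
    have "t \<otimes> (s \<otimes> ev v \<otimes> s) = (s \<otimes> t) \<otimes> ev v \<otimes> s" unfolding st using s t evv by (simp add: m_assoc)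
    also have "\<dots> = t \<otimes> ev v" using sws s t evv by (simp add: m_assoc)
    finally show ?thesis using s t evv by (metis S_cancel S_carrier m_closed)
  qed
  moreover have "ev v \<in> par K" using v generate_word[OF K] by blast
  moreover have "length v = len (ev v)" using reduced_tail[OF wsK(2) Cons.prems(2)] .
  ultimately have "\<forall>t\<in>set v. s \<otimes> t = t \<otimes> s" using Cons.IH[OF v(1)] s's by simp
  then show ?case using st s's by simp
qed

end

context coxeter_system
begin

lemma par_singleton: "s \<in> S \<Longrightarrow> par {s} = {\<one>, s}"
proof (intro equalityI subsetI)
  fix x assume s: "s \<in> S" and "x \<in> par {s}"
  from this(2) show "x \<in> {\<one>, s}"
    by (induction rule: generate.induct) (use s in auto)
qed (auto intro: generate.intros)

lemma par_mono: "I \<subseteq> J \<Longrightarrow> x \<in> par I \<Longrightarrow> x \<in> par J"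
  using mono_generate by blast

end

subsection \<open>Galleries and residues\<close>

context building
begin

lemma dist_carrier [simp]: "C \<in> \<C> \<Longrightarrow> D \<in> \<C> \<Longrightarrow> \<delta> C D \<in> carrier W"
  by (rule dist_closed)

lemma dist_self [simp]: "C \<in> \<C> \<Longrightarrow> \<delta> C C = \<one>"
  using WD1 by blast

lemma adj_sym:
  assumes "C \<in> \<C>" "D \<in> \<C>" "\<delta> C D = s" "s \<in> S"
  shows "\<delta> D C = s"
proof -
  have "\<one> \<in> {s \<otimes> \<delta> D C, \<delta> D C}" using WD2[of D C C s] assms by auto
  moreover have "\<delta> D C \<noteq> \<one>" using WD1[of D C] WD1[of C D] assms by auto
  ultimately have "s \<otimes> \<delta> D C = \<one>" by auto
  then show ?thesis using assms by (metis S_cancel S_carrier dist_carrier r_one)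
qed

lemma dist_step: "\<lbrakk>C \<in> \<C>; D \<in> \<C>; E \<in> \<C>; s \<in> S; \<delta> C E = s\<rbrakk> \<Longrightarrow> \<delta> C D = s \<otimes> \<delta> E D \<or> \<delta> C D = \<delta> E D"
  using WD2[of E D C s] by auto

lemma dist_step_up:
  "\<lbrakk>C \<in> \<C>; D \<in> \<C>; E \<in> \<C>; s \<in> S; \<delta> C E = s; len (s \<otimes> \<delta> E D) = len (\<delta> E D) + 1\<rbrakk> \<Longrightarrow> \<delta> C D = s \<otimes> \<delta> E D"
  using WD2[of E D C s] by auto

primrec gallery :: "'c \<Rightarrow> 'a list \<Rightarrow> 'c \<Rightarrow> bool" where
  "gallery C [] D \<longleftrightarrow> C \<in> \<C> \<and> C = D"
| "gallery C (s # f) D \<longleftrightarrow> C \<in> \<C> \<and> s \<in> S \<and> (\<exists>E\<in>\<C>. \<delta> C E = s \<and> gallery E f D)"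

lemma gallery_end: "gallery C f D \<Longrightarrow> C \<in> \<C> \<and> D \<in> \<C> \<and> f \<in> lists S"
  by (induction f arbitrary: C) auto

lemma gallery_append: "gallery C (f @ g) D \<longleftrightarrow> (\<exists>E. gallery C f E \<and> gallery E g D)"
proof (induction f arbitrary: C)
  case Nil then show ?case using gallery_end[of C g D] by auto
next
  case (Cons s f) then show ?case by auto
qed

lemma gallery_rev: "gallery C f D \<Longrightarrow> gallery D (rev f) C"
proof (induction f arbitrary: C)
  case (Cons s f)
  then obtain E where E: "C \<in> \<C>" "E \<in> \<C>" "s \<in> S" "\<delta> C E = s" "gallery E f D" by auto
  then have "gallery E [s] C" using adj_sym[of C E s] by auto
  then show ?case using Cons.IH[OF E(5)] gallery_append[of D "rev f" "[s]" C] by auto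
qed simp

lemma gallery_exists:
  "C \<in> \<C> \<Longrightarrow> D \<in> \<C> \<Longrightarrow> f \<in> lists S \<Longrightarrow> \<delta> C D = ev f \<Longrightarrow> gallery C f D"
proof (induction f arbitrary: C rule: list.induct)
  case Nil then show ?case using WD1 by auto
next
  case (Cons s f)
  obtain E where E: "E \<in> \<C>" "\<delta> E C = s" "\<delta> E D = s \<otimes> \<delta> C D"
    using WD3[of C D s] Cons.prems by auto
  have "s \<in> S" "f \<in> lists S" using Cons.prems by auto
  then show ?case using Cons E adj_sym[of E C s] by auto
qed

lemma gallery_dist:
  "gallery C f D \<Longrightarrow> length f = len (ev f) \<Longrightarrow> \<delta> C D = ev f"
proof (induction f arbitrary: C)
  case (Cons s f)
  then obtain E where E: "C \<in> \<C>" "E \<in> \<C>" "s \<in> S" "\<delta> C E = s" "gallery E f D" by auto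
  have f: "f \<in> lists S" "D \<in> \<C>" using gallery_end[OF E(5)] by auto
  then have r: "length f = len (ev f)" using reduced_tail[of s f] E Cons.prems by simp
  then have "\<delta> E D = ev f" using Cons.IH E by blast
  then show ?case using dist_step_up[OF E(1) f(2) E(2,3,4)] Cons.prems r by simp
qed auto

lemma gallery_par: "gallery C f D \<Longrightarrow> J \<subseteq> S \<Longrightarrow> f \<in> lists J \<Longrightarrow> \<exists>v\<in>par J. \<delta> C X = v \<otimes> \<delta> D X" if X: "X \<in> \<C>"
proof (induction f arbitrary: C rule: list.induct)
  case Nil then show ?case using X by (intro bexI[of _ \<one>]) auto
next
  case (Cons s f)
  then obtain E where E: "C \<in> \<C>" "E \<in> \<C>" "s \<in> S" "\<delta> C E = s" "gallery E f D" by auto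
  have "f \<in> lists J" using Cons.prems(3) by auto
  then obtain v where v: "v \<in> par J" "\<delta> E X = v \<otimes> \<delta> D X"
    using Cons.IH[OF E(5) Cons.prems(2)] by blast
  have D: "D \<in> \<C>" using gallery_end[OF E(5)] by auto
  have s: "s \<in> J" using Cons.prems by auto
  consider "\<delta> C X = s \<otimes> \<delta> E X" | "\<delta> C X = \<delta> E X" using dist_step[OF E(1) X E(2,3,4)] by auto
  then show ?case
  proof cases
    case 1
    then have "\<delta> C X = (s \<otimes> v) \<otimes> \<delta> D X" using v E D X par_carrier[OF Cons.prems(2) v(1)] by (simp add: m_assoc)
    then show ?thesis using par_mult[OF par_incl[OF s] v(1)] by blast
  next
    case 2 then show ?thesis using v by auto
  qed
qed

text \<open>The axioms \<open>WD2\<close> and \<open>WD3\<close> move only the left argument.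
  Reversing a minimal gallery gives access to the right one.\<close>

lemma dist_inv: "C \<in> \<C> \<Longrightarrow> D \<in> \<C> \<Longrightarrow> \<delta> D C = inv (\<delta> C D)"
proof -
  assume a: "C \<in> \<C>" "D \<in> \<C>"
  obtain f where f: "f \<in> lists S" "ev f = \<delta> C D" "length f = len (\<delta> C D)" using reduced_word[of "\<delta> C D"] a by auto
  have "gallery D (rev f) C" using gallery_rev[OF gallery_exists] a f by auto
  then have "\<delta> D C = ev (rev f)" using gallery_dist[of D "rev f" C] f a ev_rev[OF f(1)] by auto
  then show ?thesis using ev_rev[OF f(1)] f by simp
qed

lemma dist_step_right:
  assumes "C \<in> \<C>" "D \<in> \<C>" "E \<in> \<C>" "s \<in> S" "\<delta> D E = s"
  shows "\<delta> C E = \<delta> C D \<otimes> s \<or> \<delta> C E = \<delta> C D"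
    and "len (\<delta> C D \<otimes> s) = len (\<delta> C D) + 1 \<Longrightarrow> \<delta> C E = \<delta> C D \<otimes> s"
proof -
  have e: "\<delta> E D = s" using adj_sym assms by blast
  have i: "inv (s \<otimes> \<delta> D C) = \<delta> C D \<otimes> s" "\<delta> C E = inv (\<delta> E C)" "\<delta> C D = inv (\<delta> D C)"
    using assms dist_inv[of D C] dist_inv[of E C] by (auto simp: inv_mult_group)
  show "\<delta> C E = \<delta> C D \<otimes> s \<or> \<delta> C E = \<delta> C D"
    using dist_step[of E C D s] assms e i by metis
  assume l: "len (\<delta> C D \<otimes> s) = len (\<delta> C D) + 1"
  have "len (s \<otimes> \<delta> D C) = len (\<delta> D C) + 1"
    using l i len_inv[of "s \<otimes> \<delta> D C"] len_inv[of "\<delta> D C"] assms by simp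
  then show "\<delta> C E = \<delta> C D \<otimes> s" using dist_step_up[of E C D s] assms e i by metis
qed

lemma par_gallery:
  assumes "J \<subseteq> S" "C \<in> \<C>" "D \<in> \<C>" "\<delta> C D \<in> par J"
  obtains f where "f \<in> lists J" "f \<in> lists S" "ev f = \<delta> C D" "length f = len (ev f)" "gallery C f D"
proof -
  obtain f where "f \<in> lists J" "f \<in> lists S" "ev f = \<delta> C D" "length f = len (\<delta> C D)" using par_reduced[OF assms(1,4)] .
  then show thesis using that[of f] gallery_exists[of C D f] assms by auto
qed

lemma dist_coset:
  assumes "J \<subseteq> S" "C \<in> \<C>" "D \<in> \<C>" "X \<in> \<C>" "\<delta> C D \<in> par J"
  obtains v where "v \<in> par J" "\<delta> C X = v \<otimes> \<delta> D X"
  using par_gallery[OF assms(1,2,3,5)] gallery_par[OF assms(4) _ assms(1)] by metis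

lemma par_sym: "J \<subseteq> S \<Longrightarrow> C \<in> \<C> \<Longrightarrow> D \<in> \<C> \<Longrightarrow> \<delta> C D \<in> par J \<Longrightarrow> \<delta> D C \<in> par J"
  by (simp add: dist_inv[of C D] par_inv)

lemma par_trans:
  assumes "J \<subseteq> S" "C \<in> \<C>" "D \<in> \<C>" "E \<in> \<C>" "\<delta> C D \<in> par J" "\<delta> D E \<in> par J"
  shows "\<delta> C E \<in> par J"
proof -
  obtain v where "v \<in> par J" "\<delta> C E = v \<otimes> \<delta> D E" using dist_coset[OF assms(1-5)] .
  then show ?thesis using par_mult assms(6) by simp
qed

lemma par_trans_iff:
  assumes "J \<subseteq> S" "C \<in> \<C>" "D \<in> \<C>" "E \<in> \<C>" "\<delta> C D \<in> par J"
  shows "\<delta> C E \<in> par J \<longleftrightarrow> \<delta> D E \<in> par J"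
  using par_trans[OF assms(1-5)] par_trans[OF assms(1,3,2,4) par_sym[OF assms(1-3,5)]] by blast

definition res :: "'a set \<Rightarrow> 'c \<Rightarrow> 'c set" where
  "res J C = {D \<in> \<C>. \<delta> C D \<in> par J}"

lemma res_self: "C \<in> \<C> \<Longrightarrow> C \<in> res J C" by (simp add: res_def)

lemma res_eq: "J \<subseteq> S \<Longrightarrow> C \<in> \<C> \<Longrightarrow> D \<in> res J C \<Longrightarrow> res J D = res J C"
  unfolding res_def using par_trans_iff[of J C D] by auto

lemma panel_iff: "s \<in> S \<Longrightarrow> C \<in> \<C> \<Longrightarrow> D \<in> res {s} C \<longleftrightarrow> D \<in> \<C> \<and> (D = C \<or> \<delta> C D = s)"
  unfolding res_def using par_singleton[of s] WD1[of C D] by auto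

lemma adj_trans:
  assumes "s \<in> S" "C \<in> \<C>" "D \<in> \<C>" "E \<in> \<C>" "\<delta> C D = s" "\<delta> D E = s" "C \<noteq> E"
  shows "\<delta> C E = s"
  using dist_step[of C E D s] assms WD1[of C E] by auto

lemma adj_exists:
  assumes "s \<in> S" "C \<in> \<C>" obtains D where "D \<in> \<C>" "\<delta> C D = s"
proof -
  obtain D where "D \<in> \<C>" "\<delta> D C = s" using WD3[of C C s] assms by blast
  then show thesis using that[of D] adj_sym[of D C s] assms by blast
qed

lemma res_panel: "J \<subseteq> S \<Longrightarrow> k \<in> J \<Longrightarrow> C \<in> \<C> \<Longrightarrow> D \<in> res J C \<Longrightarrow> res {k} D \<subseteq> res J C"
proof -
  assume a: "J \<subseteq> S" "k \<in> J" "C \<in> \<C>" "D \<in> res J C"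
  have "res {k} D \<subseteq> res J D" unfolding res_def using par_mono[of "{k}" J] a(2) by auto
  then show ?thesis using res_eq[OF a(1,3,4)] by simp
qed

lemma finite_res:
  assumes J: "J \<subseteq> S" and fin: "finite (par J)" and C: "C \<in> \<C>"
    and panels: "\<And>s C. s \<in> J \<Longrightarrow> C \<in> \<C> \<Longrightarrow> finite (res {s} C)"
  shows "finite (res J C)"
proof -
  have "finite {D. gallery C f D}" if "f \<in> lists J" "C \<in> \<C>" for f C
    using that
  proof (induction f arbitrary: C rule: list.induct)
    case Nil then show ?case by simp
  next
    case (Cons s f)
    have s: "s \<in> J" "s \<in> S" "f \<in> lists J" using Cons.prems J by auto
    have "{D. gallery C (s # f) D} \<subseteq> (\<Union>E\<in>res {s} C. {D. gallery E f D})"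
      using panel_iff[OF s(2) Cons.prems(2)] by auto
    moreover have "finite (\<Union>E\<in>res {s} C. {D. gallery E f D})"
      using panels[OF s(1) Cons.prems(2)] Cons.IH[OF s(3)] by (auto simp: res_def)
    ultimately show ?case using finite_subset by blast
  qed
  moreover have "\<forall>w\<in>par J. \<exists>f. f \<in> lists J \<and> f \<in> lists S \<and> ev f = w \<and> length f = len (ev f)"
    using par_reduced[OF J] by metis
  then obtain g where g: "\<forall>w\<in>par J. g w \<in> lists J \<and> g w \<in> lists S \<and> ev (g w) = w \<and> length (g w) = len (ev (g w))" by metis
  have "res J C \<subseteq> (\<Union>w\<in>par J. {D. gallery C (g w) D})"
  proof
    fix D assume "D \<in> res J C"
    then have D: "D \<in> \<C>" "\<delta> C D \<in> par J" by (auto simp: res_def)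
    then have "gallery C (g (\<delta> C D)) D" using gallery_exists[OF C D(1)] g by simp
    then show "D \<in> (\<Union>w\<in>par J. {D. gallery C (g w) D})" using D by blast
  qed
  ultimately show ?thesis using fin C g finite_subset[of "res J C" "\<Union>w\<in>par J. {D. gallery C (g w) D}"] by blast
qed

end

subsection \<open>Codistance\<close>

context twin_building
begin

sublocale half: building W S "\<Delta> \<epsilon>" \<delta> for \<epsilon>
  by (rule half_building)

lemma cod_carrier [simp]: "C \<in> \<Delta> \<epsilon> \<Longrightarrow> D \<in> \<Delta> (\<not> \<epsilon>) \<Longrightarrow> \<delta>s C D \<in> carrier W"
  by (rule codist_closed)

lemma cod_carrier' [simp]: "C \<in> \<Delta> (\<not> \<epsilon>) \<Longrightarrow> D \<in> \<Delta> \<epsilon> \<Longrightarrow> \<delta>s C D \<in> carrier W"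
  using codist_closed[of C "\<not> \<epsilon>" D] by simp

lemma cod_inv: "C \<in> \<Delta> \<epsilon> \<Longrightarrow> D \<in> \<Delta> (\<not> \<epsilon>) \<Longrightarrow> \<delta>s C D = inv (\<delta>s D C)"
  using Tw1[of D "\<not> \<epsilon>" C] by simp

context
  fixes \<epsilon> C D E s
  assumes C: "C \<in> \<Delta> \<epsilon>" and D: "D \<in> \<Delta> (\<not> \<epsilon>)" and E: "E \<in> \<Delta> (\<not> \<epsilon>)" and s: "s \<in> S" and adj: "\<delta> D E = s"
begin

lemma cod_down:
  assumes "len (s \<otimes> \<delta>s C D) < len (\<delta>s C D)"
  shows "\<delta>s C E = s \<otimes> \<delta>s C D"
proof -
  have "len (\<delta>s C D) = len (s \<otimes> \<delta>s C D) + 1" using len_mult_S[of s "\<delta>s C D"] C D s assms by auto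
  then have "int (len (s \<otimes> \<delta>s C D)) = int (len (\<delta>s C D)) - 1" by simp
  then show ?thesis using Tw2[OF C D E s adj] by simp
qed

text \<open>If the codistance cannot go down, \<open>Tw3\<close> supplies a chamber \<open>F\<close>
  of the panel where it is longer. From \<open>F\<close> every other chamber of the panel is a step
  down, so \<open>Tw2\<close> applies.\<close>

lemma cod_step: "\<delta>s C E = \<delta>s C D \<or> \<delta>s C E = s \<otimes> \<delta>s C D"
proof (cases "len (s \<otimes> \<delta>s C D) < len (\<delta>s C D)")
  case True then show ?thesis using cod_down by simp
next
  case False
  obtain F where F: "F \<in> \<Delta> (\<not> \<epsilon>)" "\<delta> D F = s" "\<delta>s C F = s \<otimes> \<delta>s C D" using Tw3[OF C D s] by blast
  show ?thesis
  proof (cases "F = E")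
    case True then show ?thesis using F by simp
  next
    case ne: False
    have FD: "\<delta> F D = s" using half.adj_sym[OF D F(1,2) s] .
    have FE: "\<delta> F E = s" using half.adj_trans[OF s F(1) D E FD adj ne] .
    have "len (\<delta>s C D) < len (s \<otimes> \<delta>s C D)"
      using False len_mult_S[of s "\<delta>s C D"] C D s by auto
    then have "int (len (s \<otimes> \<delta>s C F)) = int (len (\<delta>s C F)) - 1"
      using len_mult_S[of s "\<delta>s C D"] C D s F by auto
    then show ?thesis using Tw2[OF C F(1) E s FE] F C D s by simp
  qed
qed

end

lemma cod_step_left:
  assumes "C \<in> \<Delta> \<epsilon>" "C' \<in> \<Delta> \<epsilon>" "D \<in> \<Delta> (\<not> \<epsilon>)" "s \<in> S" "\<delta> C C' = s"
  shows "\<delta>s C' D = \<delta>s C D \<or> \<delta>s C' D = \<delta>s C D \<otimes> s"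
  using cod_step[of D "\<not> \<epsilon>" C C' s] assms cod_inv[of C \<epsilon> D] cod_inv[of C' \<epsilon> D]
  by (auto simp: inv_mult_group)

lemma cod_down_left:
  assumes "C \<in> \<Delta> \<epsilon>" "C' \<in> \<Delta> \<epsilon>" "D \<in> \<Delta> (\<not> \<epsilon>)" "s \<in> S" "\<delta> C C' = s" "len (\<delta>s C D \<otimes> s) < len (\<delta>s C D)"
  shows "\<delta>s C' D = \<delta>s C D \<otimes> s"
proof -
  have i: "\<delta>s C D \<otimes> s = inv (s \<otimes> \<delta>s D C)" using assms cod_inv[of C \<epsilon> D] by (simp add: inv_mult_group)
  have "len (s \<otimes> \<delta>s D C) < len (\<delta>s D C)"
    using assms i len_inv[of "s \<otimes> \<delta>s D C"] len_inv[of "\<delta>s D C"] cod_inv[of C \<epsilon> D] by simp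
  then have "\<delta>s D C' = s \<otimes> \<delta>s D C" using cod_down[of D "\<not> \<epsilon>" C C' s] assms by simp
  then show ?thesis using i cod_inv[of C' \<epsilon> D] assms by simp
qed

lemma Tw3_left:
  assumes "C \<in> \<Delta> \<epsilon>" "D \<in> \<Delta> (\<not> \<epsilon>)" "s \<in> S"
  obtains C' where "C' \<in> \<Delta> \<epsilon>" "\<delta> C C' = s" "\<delta>s C' D = \<delta>s C D \<otimes> s"
proof -
  obtain C' where "C' \<in> \<Delta> \<epsilon>" "\<delta> C C' = s" "\<delta>s D C' = s \<otimes> \<delta>s D C"
    using Tw3[of D "\<not> \<epsilon>" C s] assms by auto
  moreover from this have "\<delta>s C' D = \<delta>s C D \<otimes> s"
    using assms cod_inv[of C' \<epsilon> D] cod_inv[of C \<epsilon> D] by (simp add: inv_mult_group)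
  ultimately show thesis using that by blast
qed

lemma cod_coset:
  assumes J: "J \<subseteq> S" and "C \<in> \<Delta> \<epsilon>" "D \<in> \<Delta> (\<not> \<epsilon>)" "E \<in> \<Delta> (\<not> \<epsilon>)" "\<delta> D E \<in> par J"
  obtains v where "v \<in> par J" "\<delta>s C E = v \<otimes> \<delta>s C D"
proof -
  obtain f where f: "f \<in> lists J" "half.gallery (\<not> \<epsilon>) D f E" using half.par_gallery[OF J assms(3-5)] by metis
  have "\<exists>v\<in>par J. \<delta>s C E = v \<otimes> \<delta>s C D" using f assms(3)
  proof (induction f arbitrary: D rule: list.induct)
    case Nil then show ?case using assms by (intro bexI[of _ \<one>]) auto
  next
    case (Cons s f)
    then obtain F where F: "F \<in> \<Delta> (\<not> \<epsilon>)" "\<delta> D F = s" "half.gallery (\<not> \<epsilon>) F f E" and s: "s \<in> J" "s \<in> S" by auto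
    have "f \<in> lists J" using Cons.prems(1) by auto
    then obtain v where v: "v \<in> par J" "\<delta>s C E = v \<otimes> \<delta>s C F" using Cons.IH[OF _ F(3,1)] by blast
    have "v \<in> carrier W" using par_carrier[OF J v(1)] .
    consider "\<delta>s C F = \<delta>s C D" | "\<delta>s C F = s \<otimes> \<delta>s C D"
      using cod_step[OF assms(2) Cons.prems(3) F(1) s(2) F(2)] by auto
    then show ?case
    proof cases
      case 1 then show ?thesis using v by auto
    next
      case 2
      then have "\<delta>s C E = (v \<otimes> s) \<otimes> \<delta>s C D" using v s \<open>v \<in> carrier W\<close> assms Cons.prems by (simp add: m_assoc)
      then show ?thesis using par_mult[OF v(1) par_incl[OF s(1)]] by blast
    qed
  qed
  then show thesis using that by blast
qed

lemma cod_coset_left: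
  assumes J: "J \<subseteq> S" and "C \<in> \<Delta> \<epsilon>" "C' \<in> \<Delta> \<epsilon>" "D \<in> \<Delta> (\<not> \<epsilon>)" "\<delta> C C' \<in> par J"
  obtains v where "v \<in> par J" "\<delta>s C' D = \<delta>s C D \<otimes> v"
proof -
  obtain v where v: "v \<in> par J" "\<delta>s D C' = v \<otimes> \<delta>s D C"
    using cod_coset[OF J, of D "\<not> \<epsilon>" C C'] assms by auto
  have "v \<in> carrier W" using par_carrier[OF J v(1)] .
  then have "\<delta>s C' D = \<delta>s C D \<otimes> inv v"
    using v(2) assms cod_inv[of C' \<epsilon> D] cod_inv[of C \<epsilon> D] by (simp add: inv_mult_group)
  then show thesis using that par_inv[OF J v(1)] by blast
qed

lemma cod_par_iff:
  assumes J: "J \<subseteq> S" and "C \<in> \<Delta> \<epsilon>" "D \<in> \<Delta> (\<not> \<epsilon>)" "E \<in> \<Delta> (\<not> \<epsilon>)" "\<delta> D E \<in> par J"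
  shows "\<delta>s C E \<in> par J \<longleftrightarrow> \<delta>s C D \<in> par J"
proof -
  obtain v where "v \<in> par J" "\<delta>s C E = v \<otimes> \<delta>s C D" using cod_coset[OF assms] .
  then show ?thesis using par_mult_left[OF J] assms by simp
qed

lemma cod_par_sym:
  assumes J: "J \<subseteq> S" and "C \<in> \<Delta> \<epsilon>" "D \<in> \<Delta> (\<not> \<epsilon>)"
  shows "\<delta>s C D \<in> par J \<longleftrightarrow> \<delta>s D C \<in> par J"
  using par_inv[OF J] cod_inv[OF assms(2,3)] Tw1[OF assms(2,3)] by metis

lemma cod_par_iff_left:
  assumes J: "J \<subseteq> S" and "C \<in> \<Delta> \<epsilon>" "C' \<in> \<Delta> \<epsilon>" "D \<in> \<Delta> (\<not> \<epsilon>)" "\<delta> C C' \<in> par J"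
  shows "\<delta>s C' D \<in> par J \<longleftrightarrow> \<delta>s C D \<in> par J"
proof -
  obtain v where "v \<in> par J" "\<delta>s C' D = \<delta>s C D \<otimes> v" using cod_coset_left[OF assms] .
  then show ?thesis using par_mult_right[OF J] assms by simp
qed

subsection \<open>Projections between opposite spherical residues\<close>

lemma cod_word:
  assumes J: "J \<subseteq> S" and C: "C \<in> \<Delta> \<epsilon>" and D: "D \<in> \<Delta> (\<not> \<epsilon>)"
  shows "f \<in> lists J \<Longrightarrow> \<exists>E\<in>\<Delta> (\<not> \<epsilon>). \<delta> D E \<in> par J \<and> \<delta>s C E = ev f \<otimes> \<delta>s C D"
proof (induction f rule: list.induct)
  case Nil then show ?case using C D by (intro bexI[of _ D]) auto
next
  case (Cons s f)
  then obtain E where E: "E \<in> \<Delta> (\<not> \<epsilon>)" "\<delta> D E \<in> par J" "\<delta>s C E = ev f \<otimes> \<delta>s C D" by auto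
  have s: "s \<in> J" "s \<in> S" "f \<in> lists S" using Cons.prems J by auto
  obtain F where F: "F \<in> \<Delta> (\<not> \<epsilon>)" "\<delta> E F = s" "\<delta>s C F = s \<otimes> \<delta>s C E" using Tw3[OF C E(1) s(2)] by blast
  have "\<delta> D F \<in> par J" using half.par_trans[OF J D E(1) F(1) E(2)] F(2) par_incl[OF s(1)] by simp
  moreover have "\<delta>s C F = ev (s # f) \<otimes> \<delta>s C D" using F(3) E(3) s C D ev_closed[OF s(3)] by (simp add: m_assoc)
  ultimately show ?case using F(1) by blast
qed

context
  fixes J assumes J: "J \<subseteq> S" and fin: "finite (par J)"
begin

text \<open>\<open>Tw3\<close> allows any word over \<open>J\<close> to be applied to the
  codistance, so its longest value is attained. The chamber attaining it is the projection of
  \<open>C\<close> to the residue.\<close>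

lemma proj_exists:
  assumes C: "C \<in> \<Delta> \<epsilon>" and D: "D \<in> \<Delta> (\<not> \<epsilon>)" and opp: "\<delta>s C D \<in> par J"
  obtains E where "E \<in> \<Delta> (\<not> \<epsilon>)" "\<delta> D E \<in> par J" "\<delta>s C E = longest J"
proof -
  have "longest J \<otimes> inv (\<delta>s C D) \<in> par J" by (rule par_mult[OF longest(1)[OF fin] par_inv[OF J opp]])
  then obtain f where f: "f \<in> lists J" "ev f = longest J \<otimes> inv (\<delta>s C D)" using generate_word[OF J] by blast
  have "ev f \<otimes> \<delta>s C D = longest J" unfolding f(2) using C D longest_carrier[OF J fin] by (simp add: m_assoc)
  then show thesis using that cod_word[OF J C D f(1)] by auto
qed

text \<open>Moving away from the projection along a minimal gallery shortens the codistance at every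
  step, so \<open>Tw2\<close> determines it.\<close>

lemma cod_proj:
  assumes C: "C \<in> \<Delta> \<epsilon>" and E: "E \<in> \<Delta> (\<not> \<epsilon>)" and E': "E' \<in> \<Delta> (\<not> \<epsilon>)"
    and p: "\<delta>s C E = longest J" and r: "\<delta> E E' \<in> par J"
  shows "\<delta>s C E' = \<delta> E' E \<otimes> longest J"
proof -
  obtain f where f: "f \<in> lists J" "f \<in> lists S" "ev f = \<delta> E' E" "length f = len (ev f)" "half.gallery (\<not> \<epsilon>) E' f E"
    using half.par_gallery[OF J E' E half.par_sym[OF J E E' r]] .
  have "\<delta>s C E' = ev f \<otimes> longest J" using f(1,2,4,5) E'
  proof (induction f arbitrary: E' rule: list.induct)
    case Nil then show ?case using p longest_carrier[OF J fin] by simp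
  next
    case (Cons s f)
    then obtain F where F: "F \<in> \<Delta> (\<not> \<epsilon>)" "\<delta> E' F = s" "half.gallery (\<not> \<epsilon>) F f E"
      and s: "s \<in> J" "s \<in> S" and fl: "f \<in> lists J" "f \<in> lists S" by auto
    have r: "length f = len (ev f)" using reduced_tail[of s f] Cons.prems by simp
    have "\<delta>s C F = ev f \<otimes> longest J" using Cons.IH[OF fl r F(3,1)] .
    moreover have "len (s \<otimes> (ev f \<otimes> longest J)) < len (ev f \<otimes> longest J)"
    proof -
      have "ev f \<in> par J" "ev (s # f) \<in> par J" using generate_word[OF J] fl(1) Cons.prems(1) by blast+
      from this[THEN len_longest_mult[OF J fin]] show ?thesis
        using r Cons.prems(3) s fl longest_carrier[OF J fin] by (simp add: m_assoc)
    qed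
    ultimately show ?case
      using cod_down[OF C F(1) Cons.prems(5) s(2) half.adj_sym[OF Cons.prems(5) F(1,2) s(2)]]
        s fl longest_carrier[OF J fin] by (simp add: m_assoc)
  qed
  then show ?thesis using f(3) by simp
qed

lemma proj_unique:
  assumes "C \<in> \<Delta> \<epsilon>" "E \<in> \<Delta> (\<not> \<epsilon>)" "E' \<in> \<Delta> (\<not> \<epsilon>)" "\<delta>s C E = longest J" "\<delta>s C E' = longest J" "\<delta> E E' \<in> par J"
  shows "E = E'"
proof -
  have "\<delta> E' E \<otimes> longest J = longest J" using cod_proj[OF assms(1-4,6)] assms(5) by simp
  then have "\<delta> E' E = \<one>" using longest_carrier[OF J fin] assms by (simp add: l_cancel_one')
  then show ?thesis using half.WD1 assms by blast
qed

lemma proj_sym: "C \<in> \<Delta> \<epsilon> \<Longrightarrow> D \<in> \<Delta> (\<not> \<epsilon>) \<Longrightarrow> \<delta>s C D = longest J \<longleftrightarrow> \<delta>s D C = longest J"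
  using cod_inv[of C \<epsilon> D] Tw1[of C \<epsilon> D] longest_inv[OF J fin] by metis

text \<open>The codistance of \<open>C\<close> and \<open>E'\<close> is evaluated twice, from
  \<open>E\<close> as projection of \<open>C\<close> and from \<open>C'\<close> as projection of
  \<open>E'\<close>.\<close>

lemma proj_isometry:
  assumes C: "C \<in> \<Delta> \<epsilon>" "C' \<in> \<Delta> \<epsilon>" and E: "E \<in> \<Delta> (\<not> \<epsilon>)" "E' \<in> \<Delta> (\<not> \<epsilon>)"
    and r: "\<delta> C C' \<in> par J" "\<delta> E E' \<in> par J" and p: "\<delta>s C E = longest J" "\<delta>s C' E' = longest J"
  shows "\<delta> E E' = longest J \<otimes> \<delta> C C' \<otimes> longest J"
proof -
  let ?w = "longest J"
  have w: "?w \<in> carrier W" "?w \<otimes> ?w = \<one>" "inv ?w = ?w"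
    using longest_carrier[OF J fin] longest_sq[OF J fin] longest_inv[OF J fin] by auto
  have 1: "\<delta>s C E' = \<delta> E' E \<otimes> ?w" using cod_proj[OF C(1) E p(1) r(2)] .
  have "\<delta>s E' C' = ?w" using p(2) proj_sym C E by blast
  then have "\<delta>s E' C = \<delta> C C' \<otimes> ?w"
    using cod_proj[of E' "\<not> \<epsilon>" C' C] C E half.par_sym[OF J C r(1)] by simp
  then have "inv (\<delta>s C E') = \<delta> C C' \<otimes> ?w" by (simp add: Tw1[OF C(1) E(2)])
  then have "?w \<otimes> \<delta> E E' = \<delta> C C' \<otimes> ?w"
    unfolding 1 using E w half.dist_inv[OF E(2,1)] by (simp add: inv_mult_group)
  then have "?w \<otimes> (?w \<otimes> \<delta> E E') = ?w \<otimes> (\<delta> C C' \<otimes> ?w)" by simp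
  then show ?thesis using w C E by (simp add: m_assoc[symmetric])
qed

end

end

context coxeter_system
begin

lemma commute_ord:
  assumes "s \<in> S" "t \<in> S" "s \<noteq> t"
  shows "ord (s \<otimes> t) = 2 \<longleftrightarrow> s \<otimes> t = t \<otimes> s"
proof -
  have ne: "s \<otimes> t \<noteq> \<one>" using assms S_inv inv_equality[of s t] by auto
  have "s \<otimes> t = t \<otimes> s \<longleftrightarrow> (s \<otimes> t) \<otimes> (s \<otimes> t) = \<one>"
  proof
    assume "s \<otimes> t = t \<otimes> s"
    then have "(s \<otimes> t) \<otimes> (s \<otimes> t) = (s \<otimes> t) \<otimes> (t \<otimes> s)" by simp
    then show "(s \<otimes> t) \<otimes> (s \<otimes> t) = \<one>" using assms by (simp add: m_assoc)
  next
    assume "(s \<otimes> t) \<otimes> (s \<otimes> t) = \<one>"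
    then have "inv (s \<otimes> t) = s \<otimes> t" using assms by (simp add: inv_equality)
    then show "s \<otimes> t = t \<otimes> s" using assms by (simp add: inv_mult_group)
  qed
  also have "\<dots> \<longleftrightarrow> (s \<otimes> t) [^] (2::nat) = \<one>" using assms by (simp add: numeral_2_eq_2)
  also have "\<dots> \<longleftrightarrow> ord (s \<otimes> t) dvd 2" using pow_eq_id assms by simp
  also have "\<dots> \<longleftrightarrow> ord (s \<otimes> t) = 2"
  proof -
    have "n dvd 2 \<Longrightarrow> n = 1 \<or> n = 2" for n :: nat
      using dvd_imp_le[of n 2] by (cases "n = 0") (auto simp: le_Suc_eq numeral_2_eq_2)
    then show ?thesis using ord_eq_1[of "s \<otimes> t"] ne assms by auto
  qed
  finally show ?thesis by simp
qed

lemma irreducible_commuting: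
  assumes irr: "irreducible_type W S" and K: "K \<subseteq> S" "K \<noteq> S"
    and comm: "\<And>s t. s \<in> S - K \<Longrightarrow> t \<in> K \<Longrightarrow> s \<otimes> t = t \<otimes> s"
  shows "K = {}"
proof (rule ccontr)
  assume "K \<noteq> {}"
  then obtain t s where t: "t \<in> K" and s: "s \<in> S" "s \<notin> K" using K by blast
  have "(t, s) \<in> (coxeter_diagram W S)\<^sup>*" using irr t s K unfolding irreducible_type_def by blast
  then have "s \<in> K"
  proof (induction rule: rtrancl_induct)
    case (step y z)
    then have "z \<in> S" "y \<noteq> z" "y \<in> S" "ord (y \<otimes> z) \<noteq> 2" by (auto simp: coxeter_diagram_def)
    then have "z \<otimes> y \<noteq> y \<otimes> z" using commute_ord[of y z] by metis
    then show ?case using comm[of z y] step.IH \<open>z \<in> S\<close> by blast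
  qed (use t in simp)
  then show False using s by simp
qed

end

subsection \<open>Reduction to type preserving automorphisms mapping every chamber to an opposite one\<close>

locale residue_opposing = twin_building +
  fixes \<theta> J
  assumes finS: "finite S" and irr: "irreducible_type W S" and J: "J \<subseteq> S" "J \<noteq> {}"
    and aut: "twin_automorphism W S \<Delta> \<delta> \<delta>s \<theta>"
    and opp: "\<And>\<epsilon> R. residue_in W (\<Delta> \<epsilon>) \<delta> (S - J) R \<Longrightarrow> opposite_residues W S \<Delta> \<delta> \<delta>s R (\<theta> ` R)"
begin

lemma half_unique: "C \<in> \<Delta> \<epsilon> \<Longrightarrow> C \<in> \<Delta> \<epsilon>' \<Longrightarrow> \<epsilon> = \<epsilon>'"
  using disjoint_halves by (cases \<epsilon>; cases \<epsilon>') auto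

text \<open>\<open>opposite_residues\<close> only asserts that some half and some types exist, and
  \<open>\<theta>\<close> may permute types. The half is recovered here; the type \<open>L\<close>
  is identified in \<open>residue_type\<close>.\<close>

lemma residue_image:
  assumes "C \<in> \<Delta> \<epsilon>"
  obtains L where "L \<subseteq> S" "\<theta> C \<in> \<Delta> (\<not> \<epsilon>)" "\<theta> ` half.res \<epsilon> (S - J) C = half.res (\<not> \<epsilon>) L (\<theta> C)"
    "\<And>E. E \<in> half.res \<epsilon> (S - J) C \<Longrightarrow> \<exists>D \<in> half.res (\<not> \<epsilon>) L (\<theta> C). \<delta>s E D = \<one>"
proof -
  let ?R = "half.res \<epsilon> (S - J) C"
  have CR: "C \<in> ?R" using half.res_self assms by blast
  have "residue_in W (\<Delta> \<epsilon>) \<delta> (S - J) ?R" unfolding residue_in_def half.res_def using assms by blast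
  from opp[OF this] obtain \<epsilon>' K0 L where
    k: "residue_in W (\<Delta> \<epsilon>') \<delta> K0 ?R" and L: "L \<subseteq> S" "residue_in W (\<Delta> (\<not> \<epsilon>')) \<delta> L (\<theta> ` ?R)"
    and o: "\<And>E. E \<in> ?R \<Longrightarrow> \<exists>D\<in>\<theta> ` ?R. opposite W \<Delta> \<delta>s E D"
    unfolding opposite_residues_def by blast
  have "C \<in> \<Delta> \<epsilon>'" using k CR unfolding residue_in_def by auto
  then have e: "\<epsilon>' = \<epsilon>" using half_unique assms by blast
  obtain F where F: "F \<in> \<Delta> (\<not> \<epsilon>)" "\<theta> ` ?R = half.res (\<not> \<epsilon>) L F"
    using L(2) unfolding residue_in_def half.res_def e by blast
  then have tC: "\<theta> C \<in> half.res (\<not> \<epsilon>) L F" using CR by blast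
  then have t: "\<theta> C \<in> \<Delta> (\<not> \<epsilon>)" "\<theta> ` ?R = half.res (\<not> \<epsilon>) L (\<theta> C)"
    using half.res_eq[OF L(1) F(1) tC] F by (auto simp: half.res_def)
  show thesis
    by (rule that[OF L(1) t]) (use o t in \<open>auto simp: opposite_def\<close>)
qed

lemma theta_half: "C \<in> \<Delta> \<epsilon> \<Longrightarrow> \<theta> C \<in> \<Delta> (\<not> \<epsilon>)"
  using residue_image by metis

lemma theta_adj:
  assumes "C \<in> \<Delta> \<epsilon>" "D \<in> \<Delta> \<epsilon>"
  shows "\<delta> (\<theta> C) (\<theta> D) \<in> S \<longleftrightarrow> \<delta> C D \<in> S"
proof -
  have u: "C \<in> (\<Union>\<epsilon>. \<Delta> \<epsilon>)" "D \<in> (\<Union>\<epsilon>. \<Delta> \<epsilon>)" using assms by blast+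
  have "adjacent S \<Delta> \<delta> (\<theta> C) (\<theta> D) \<longleftrightarrow> adjacent S \<Delta> \<delta> C D"
    using aut u unfolding twin_automorphism_def by blast
  moreover have "adjacent S \<Delta> \<delta> C D \<longleftrightarrow> \<delta> C D \<in> S" using assms unfolding adjacent_def by blast
  moreover have "adjacent S \<Delta> \<delta> (\<theta> C) (\<theta> D) \<longleftrightarrow> \<delta> (\<theta> C) (\<theta> D) \<in> S"
    using theta_half[OF assms(1)] theta_half[OF assms(2)] unfolding adjacent_def by blast
  ultimately show ?thesis by simp
qed

lemma S_mult_notin: "a \<in> S \<Longrightarrow> b \<in> S \<Longrightarrow> a \<otimes> b \<notin> S"
proof (cases "a = b")
  case False
  assume ab: "a \<in> S" "b \<in> S"
  then have "len (a \<otimes> b) = 2" using par_len_up[of "{b}" a b] False par_incl by simp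
  then show ?thesis using len_S by fastforce
qed auto

text \<open>Three pairwise adjacent chambers lie in one panel, since a product of two letters is
  never a letter.\<close>

lemma theta_panel:
  assumes C: "C \<in> \<Delta> \<epsilon>" and E: "E \<in> \<Delta> \<epsilon>" "E' \<in> \<Delta> \<epsilon>" and s: "s \<in> S" "\<delta> C E = s" "\<delta> C E' = s"
  shows "\<delta> (\<theta> C) (\<theta> E) = \<delta> (\<theta> C) (\<theta> E')"
proof (cases "E = E'")
  case False
  have "\<delta> E E' = s" using half.adj_trans[OF s(1) E(1) C E(2) half.adj_sym[OF C E(1) s(2,1)] s(3) False] .
  then have c: "\<delta> (\<theta> E) (\<theta> E') \<in> S" using theta_adj[OF E] s by simp
  have a: "\<delta> (\<theta> C) (\<theta> E) \<in> S" "\<delta> (\<theta> C) (\<theta> E') \<in> S" using theta_adj[OF C] E s by auto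
  show ?thesis
    using half.dist_step_right(1)[OF theta_half[OF C] theta_half[OF E(1)] theta_half[OF E(2)] c HOL.refl]
      a c S_mult_notin by metis
qed simp

text \<open>Let \<open>D\<close> in the image be opposite \<open>C\<close>. For \<open>s\<close> in
  \<open>S - J\<close> some \<open>s\<close>-neighbour of \<open>C\<close> has codistance
  \<open>s\<close> to \<open>D\<close>, yet it is opposite another chamber of the image, so
  \<open>s\<close> lies in \<open>L\<close>. Equality follows by counting, as every letter of
  \<open>L\<close> is induced by a letter of \<open>S - J\<close>.\<close>

lemma residue_type:
  assumes "C \<in> \<Delta> \<epsilon>" "L \<subseteq> S" "\<theta> ` half.res \<epsilon> (S - J) C = half.res (\<not> \<epsilon>) L (\<theta> C)"
    "\<And>E. E \<in> half.res \<epsilon> (S - J) C \<Longrightarrow> \<exists>D \<in> half.res (\<not> \<epsilon>) L (\<theta> C). \<delta>s E D = \<one>"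
  shows "L = S - J"
proof -
  let ?K = "S - J" and ?R = "half.res \<epsilon> (S - J) C"
  note tC = theta_half[OF assms(1)]
  have "?K \<subseteq> L"
  proof
    fix s assume s: "s \<in> ?K"
    obtain D where D: "D \<in> half.res (\<not> \<epsilon>) L (\<theta> C)" "\<delta>s C D = \<one>" using assms(4) half.res_self[OF assms(1)] by blast
    then have Dh: "D \<in> \<Delta> (\<not> \<epsilon>)" by (simp add: half.res_def)
    obtain C' where C': "C' \<in> \<Delta> \<epsilon>" "\<delta> C C' = s" "\<delta>s C' D = s"
      using Tw3_left[OF assms(1) Dh, of s] s D by auto
    then have "C' \<in> ?R" using s par_incl by (simp add: half.res_def)
    then obtain D' where D': "D' \<in> half.res (\<not> \<epsilon>) L (\<theta> C)" "\<delta>s C' D' = \<one>" using assms(4) by blast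
    then have D'h: "D' \<in> \<Delta> (\<not> \<epsilon>)" by (simp add: half.res_def)
    have "\<delta> D D' \<in> par L" using half.res_eq[OF assms(2) tC D(1)] D' by (auto simp: half.res_def)
    then have "\<delta>s C' D \<in> par L" using cod_par_iff[OF assms(2) C'(1) Dh D'h] D' by simp
    then show "s \<in> L" using C' S_par[OF assms(2)] s by simp
  qed
  moreover have "card L \<le> card ?K"
  proof -
    \<comment> \<open>By \<open>theta_panel\<close> the choice of the neighbour does not
      matter.\<close>
    define g where "g s = \<delta> (\<theta> C) (\<theta> (SOME E. E \<in> \<Delta> \<epsilon> \<and> \<delta> C E = s))" for s
    have "L \<subseteq> g ` ?K"
    proof
      fix t assume t: "t \<in> L"
      obtain F where F: "F \<in> \<Delta> (\<not> \<epsilon>)" "\<delta> (\<theta> C) F = t" using half.adj_exists[OF _ tC, of t] t assms(2) by blast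
      then have "F \<in> \<theta> ` ?R" using assms(3) t par_incl by (simp add: half.res_def)
      then obtain E where E: "E \<in> ?R" "F = \<theta> E" by blast
      have Eh: "E \<in> \<Delta> \<epsilon>" "\<delta> C E \<in> par ?K" using E by (auto simp: half.res_def)
      have "\<delta> C E \<in> S" using theta_adj[OF assms(1) Eh(1)] E F t assms(2) by auto
      then have s: "\<delta> C E \<in> ?K" using S_par[of ?K] Eh by auto
      have "\<exists>E'. E' \<in> \<Delta> \<epsilon> \<and> \<delta> C E' = \<delta> C E" using Eh by blast
      from someI_ex[OF this] have "g (\<delta> C E) = t"
        unfolding g_def using theta_panel[OF assms(1) _ Eh(1) \<open>\<delta> C E \<in> S\<close>] F E by metis
      then show "t \<in> g ` ?K" using s by blast
    qed
    then show ?thesis using finS by (meson card_image_le card_mono finite_Diff finite_imageI le_trans)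
  qed
  ultimately show ?thesis using card_seteq[of L ?K] finite_subset[OF assms(2) finS] by simp
qed

lemma cod_theta_par:
  assumes "C \<in> \<Delta> \<epsilon>" shows "\<delta>s C (\<theta> C) \<in> par (S - J)"
proof -
  obtain L where L: "L \<subseteq> S" "\<theta> ` half.res \<epsilon> (S - J) C = half.res (\<not> \<epsilon>) L (\<theta> C)"
    "\<And>E. E \<in> half.res \<epsilon> (S - J) C \<Longrightarrow> \<exists>D \<in> half.res (\<not> \<epsilon>) L (\<theta> C). \<delta>s E D = \<one>"
    using residue_image[OF assms] by metis
  have LK: "L = S - J" using residue_type[OF assms L] .
  obtain D where D: "D \<in> \<Delta> (\<not> \<epsilon>)" "\<delta> (\<theta> C) D \<in> par L" "\<delta>s C D = \<one>"
    using L(3)[OF half.res_self[OF assms]] by (auto simp: half.res_def)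
  show ?thesis using cod_par_iff[OF L(1) assms theta_half[OF assms] D(1,2)] D(3) LK by simp
qed

text \<open>Its emptiness means that every chamber is opposite its image.\<close>

definition supp :: "'a set" where
  "supp = {t. \<exists>\<epsilon> C ws. C \<in> \<Delta> \<epsilon> \<and> ws \<in> lists S \<and> ev ws = \<delta>s C (\<theta> C) \<and> length ws = len (ev ws) \<and> t \<in> set ws}"

lemma supp_sub: "supp \<subseteq> S - J"
  unfolding supp_def using par_reduced_set[of "S - J"] cod_theta_par by fastforce

lemma cod_theta_supp:
  assumes "C \<in> \<Delta> \<epsilon>"
  obtains ws where "ws \<in> lists supp" "ev ws = \<delta>s C (\<theta> C)" "length ws = len (ev ws)"
proof -
  have "\<delta>s C (\<theta> C) \<in> carrier W" using assms theta_half[OF assms] by simp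
  then obtain ws where ws: "ws \<in> lists S" "ev ws = \<delta>s C (\<theta> C)" "length ws = len (\<delta>s C (\<theta> C))"
    using reduced_word by metis
  then have "length ws = len (ev ws)" by simp
  then have "set ws \<subseteq> supp" unfolding supp_def using assms ws(1,2) by blast
  then have "ws \<in> lists supp" by auto
  then show thesis using that ws by simp
qed

text \<open>A suitable \<open>s\<close>-neighbour \<open>E\<close> of \<open>C\<close> has
  codistance \<open>w s\<close> to \<open>\<theta> C\<close>, which is outside
  \<open>par supp\<close>. The codistance of \<open>E\<close> and \<open>\<theta> E\<close> is
  inside, so the step of type \<open>s'\<close> from \<open>\<theta> C\<close> to
  \<open>\<theta> E\<close> must bring it back: \<open>s' w s\<close> lies in
  \<open>par supp\<close>, and \<open>par_conj_commute\<close> applies.\<close>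

lemma supp_step:
  assumes C: "C \<in> \<Delta> \<epsilon>" and s: "s \<in> S" "s \<notin> supp"
    and ws: "ws \<in> lists supp" "ev ws = \<delta>s C (\<theta> C)" "length ws = len (ev ws)"
  obtains E where "E \<in> \<Delta> \<epsilon>" "\<delta> C E = s" "\<delta> (\<theta> C) (\<theta> E) = s" "\<And>t. t \<in> set ws \<Longrightarrow> s \<otimes> t = t \<otimes> s"
proof -
  have K: "supp \<subseteq> S" using supp_sub by blast
  let ?w = "\<delta>s C (\<theta> C)"
  note tC = theta_half[OF C]
  have w: "?w \<in> carrier W" "?w \<in> par supp" using C tC ws generate_word[OF K] by auto
  obtain E where E: "E \<in> \<Delta> \<epsilon>" "\<delta> C E = s" "\<delta>s E (\<theta> C) = ?w \<otimes> s" using Tw3_left[OF C tC s(1)] .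
  let ?s = "\<delta> (\<theta> C) (\<theta> E)"
  have s': "?s \<in> S" using theta_adj[OF C E(1)] E s by simp
  have ns: "?w \<otimes> s \<notin> par supp" using par_mult_left[OF K w(2)] S_par[OF K] s by simp
  obtain es where "es \<in> lists supp" "ev es = \<delta>s E (\<theta> E)" using cod_theta_supp[OF E(1)] by metis
  then have "\<delta>s E (\<theta> E) \<in> par supp" using generate_word[OF K] by metis
  moreover have "\<delta>s E (\<theta> E) = \<delta>s E (\<theta> C) \<or> \<delta>s E (\<theta> E) = ?s \<otimes> \<delta>s E (\<theta> C)"
    using cod_step[OF E(1) tC theta_half[OF E(1)] s' HOL.refl] .
  ultimately have p: "?s \<otimes> (?w \<otimes> s) \<in> par supp" using E(3) ns by auto
  have "?s \<notin> supp" using p ns par_mult_left[OF K par_incl, of ?s "?w \<otimes> s"] w s by auto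
  then have "s = ?s \<and> (\<forall>t\<in>set ws. ?s \<otimes> t = t \<otimes> ?s)"
    using par_conj_commute[OF K s' _ s(1) ws(1,3)] p ws(2) s s' w by (simp add: m_assoc)
  then show thesis using that[OF E(1,2)] by auto
qed

text \<open>The letters outside the support commute with those inside, and \<open>J\<close> being
  nonempty keeps it proper, so irreducibility leaves nothing.\<close>

lemma supp_empty: "supp = {}"
proof (rule irreducible_commuting[OF irr])
  show "supp \<subseteq> S" "supp \<noteq> S" using supp_sub J by blast+
  fix s t assume s: "s \<in> S - supp" and "t \<in> supp"
  then obtain \<epsilon> C ws where c: "C \<in> \<Delta> \<epsilon>" "ws \<in> lists S" "ev ws = \<delta>s C (\<theta> C)" "length ws = len (ev ws)" "t \<in> set ws"
    unfolding supp_def by blast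
  then have "set ws \<subseteq> supp" unfolding supp_def by blast
  then have "ws \<in> lists supp" by auto
  then show "s \<otimes> t = t \<otimes> s" using supp_step[OF c(1) _ _ _ c(3,4)] s c(5) by (metis DiffD1 DiffD2)
qed

lemma cod_theta: "C \<in> \<Delta> \<epsilon> \<Longrightarrow> \<delta>s C (\<theta> C) = \<one>"
  using cod_theta_supp[of C \<epsilon>] supp_empty by (metis ev_Nil lists_empty singletonD)

lemma theta_type:
  assumes "C \<in> \<Delta> \<epsilon>" "D \<in> \<Delta> \<epsilon>" "\<delta> C D = s" "s \<in> S"
  shows "\<delta> (\<theta> C) (\<theta> D) = s"
proof -
  obtain ws where ws: "ws \<in> lists supp" "ev ws = \<delta>s C (\<theta> C)" "length ws = len (ev ws)"
    using cod_theta_supp[OF assms(1)] .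
  obtain E where "E \<in> \<Delta> \<epsilon>" "\<delta> C E = s" "\<delta> (\<theta> C) (\<theta> E) = s"
    using supp_step[OF assms(1,4) _ ws] supp_empty by auto
  then show ?thesis using theta_panel[OF assms(1,2) _ assms(4,3)] by metis
qed

lemma theta_dist:
  assumes "C \<in> \<Delta> \<epsilon>" "D \<in> \<Delta> \<epsilon>"
  shows "\<delta> (\<theta> C) (\<theta> D) = \<delta> C D"
proof -
  obtain f where f: "f \<in> lists S" "ev f = \<delta> C D" "length f = len (\<delta> C D)" using reduced_word[of "\<delta> C D"] assms by auto
  have "half.gallery \<epsilon> C f D" using half.gallery_exists[OF assms f(1)] f(2) by simp
  then have "half.gallery (\<not> \<epsilon>) (\<theta> C) f (\<theta> D)"
    by (induction f arbitrary: C) (auto simp: theta_half intro: theta_type)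
  then show ?thesis using half.gallery_dist f by metis
qed

end

subsection \<open>Words in two letters\<close>

primrec alt :: "nat \<Rightarrow> 'b \<Rightarrow> 'b \<Rightarrow> 'b list" where
  "alt 0 i j = []"
| "alt (Suc n) i j = i # alt n j i"

lemma length_alt [simp]: "length (alt n i j) = n"
  by (induction n arbitrary: i j) auto

lemma set_alt: "set (alt n i j) \<subseteq> {i, j}"
  by (induction n arbitrary: i j) auto

lemma alt_snoc: "alt (Suc n) i j = alt n i j @ [if even n then i else j]"
  by (induction n arbitrary: i j) auto

lemma alt_take: "n \<le> m \<Longrightarrow> take n (alt m i j) = alt n i j"
proof (induction m arbitrary: n i j)
  case (Suc m) then show ?case by (cases n) auto
qed simp

lemma map_alt: "map f (alt n i j) = alt n (f i) (f j)"
  by (induction n arbitrary: i j) auto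

locale dihedral = coxeter_system +
  fixes i j
  assumes i: "i \<in> S" and j: "j \<in> S" and nc: "i \<otimes> j \<noteq> j \<otimes> i" and fin: "finite (par {i, j})"
begin

definition m :: nat where "m = len (longest {i, j})"

lemma ij: "{i, j} \<subseteq> S" and ne: "i \<noteq> j" using i j nc by auto

lemma flip: "dihedral W S j i"
  using nc fin by unfold_locales (auto simp: i j insert_commute)

lemma flip_m: "dihedral.m W S j i = m"
  using flip by (simp add: dihedral.m_def m_def insert_commute)

lemma alt_lists: "alt n i j \<in> lists {i, j}" "alt n i j \<in> lists S"
  using set_alt[of n i j] i j by auto

lemma reduced_alt:
  "ws \<in> lists {x, y} \<Longrightarrow> {x, y} = {i, j} \<Longrightarrow> length ws = len (ev ws) \<Longrightarrow> ws = [] \<or> hd ws = x \<Longrightarrow> ws = alt (length ws) x y"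
proof (induction ws arbitrary: x y rule: list.induct)
  case (Cons a v)
  have vS: "v \<in> lists S" "v \<in> lists {x, y}" "a = x" "x \<in> S" using Cons.prems i j by auto
  have r: "length v = len (ev v)" using reduced_tail[of a v] Cons.prems vS by auto
  have "v = [] \<or> hd v = y"
  proof (cases v)
    case (Cons b u)
    have "b \<noteq> x"
    proof
      assume "b = x"
      then have "ev (a # v) = ev u" using Cons vS by simp
      moreover have "u \<in> lists S" using vS Cons by auto
      ultimately show False using len_le[of u] Cons Cons.prems(3) r local.Cons.prems by auto
    qed
    then show ?thesis using vS Cons by auto
  qed simp
  moreover have "v \<in> lists {y, x}" using vS(2) by (simp add: insert_commute)
  moreover have "{y, x} = {i, j}" using Cons.prems(2) by (simp add: insert_commute)
  ultimately have "v = alt (length v) y x" using Cons.IH[of y x] r by blast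
  then show ?case using vS by simp
qed simp

lemma descent_alt:
  assumes x: "x \<in> par {i, j}" and up: "len x \<le> len (j \<otimes> x)"
  shows "x = ev (alt (len x) i j)"
proof -
  obtain ws where ws: "ws \<in> lists {i, j}" "ws \<in> lists S" "ev ws = x" "length ws = len x" using par_reduced[OF ij x] .
  have "ws = [] \<or> hd ws = i"
  proof (cases ws)
    case (Cons a v)
    have "a \<noteq> j"
    proof
      assume "a = j"
      then have "j \<otimes> x = ev v" "v \<in> lists S" using Cons ws j by auto
      then show False using len_le[of v] up ws(4) Cons by simp
    qed
    then show ?thesis using Cons ws by auto
  qed simp
  then show ?thesis using reduced_alt[OF ws(1)] ws by simp
qed

lemma longest_alt: "longest {i, j} = ev (alt m i j)"
proof -
  let ?w = "longest {i, j}"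
  have w: "?w \<in> par {i, j}" "?w \<in> carrier W" using longest(1)[OF fin] par_carrier[OF ij] by auto
  have l: "len (i \<otimes> ?w) + 1 = len ?w" using len_longest_mult[OF ij fin par_incl, of i] i by simp
  have iw: "i \<otimes> ?w \<in> par {i, j}" by (rule par_mult[OF par_incl w(1)]) simp
  obtain ws where ws: "ws \<in> lists {i, j}" "ws \<in> lists S" "ev ws = i \<otimes> ?w" "length ws = len (i \<otimes> ?w)" using par_reduced[OF ij iw] .
  have "ev (i # ws) = ?w" using ws i w by simp
  moreover have "i # ws = alt (length (i # ws)) i j"
    by (rule reduced_alt) (use ws l calculation in auto)
  ultimately show ?thesis unfolding m_def using ws l by (metis Suc_eq_plus1 length_Cons)
qed

text \<open>A prefix of a reduced word of the longest element is reduced.\<close>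

lemma len_alt: "n \<le> m \<Longrightarrow> len (ev (alt n i j)) = n"
proof -
  assume n: "n \<le> m"
  have "alt m i j = alt n i j @ drop n (alt m i j)" using alt_take[OF n, of i j] append_take_drop_id by metis
  moreover have d: "drop n (alt m i j) \<in> lists S" using alt_lists(2)[of m] by (auto dest: in_set_dropD)
  ultimately have "longest {i, j} = ev (alt n i j) \<otimes> ev (drop n (alt m i j))"
    using longest_alt ev_append[OF alt_lists(2) d] by metis
  then have "m \<le> len (ev (alt n i j)) + len (ev (drop n (alt m i j)))"
    using len_mult_le[OF ev_closed[OF alt_lists(2)] ev_closed[OF d], of n] m_def by simp
  moreover have "len (ev (drop n (alt m i j))) \<le> m - n" using len_le[OF d] by simp
  moreover have "len (ev (alt n i j)) \<le> n" using len_le[OF alt_lists(2), of n] by simp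
  ultimately show ?thesis using n by linarith
qed

lemma m_ge_3: "3 \<le> m"
proof (rule ccontr)
  have "i \<otimes> j \<otimes> i \<in> par {i, j}" by (intro par_mult par_incl) auto
  then have "len (i \<otimes> j \<otimes> i) \<le> m" unfolding m_def using longest(2)[OF fin] by blast
  moreover assume "\<not> 3 \<le> m"
  ultimately show False using sts_reduced[OF i j nc] by simp
qed

text \<open>
  The disjunctions on the left say that an element is the value of a subword of an alternating word.
\<close>
lemma below_alt:
  assumes n: "n < m" and v: "v \<in> par {i, j}" and up: "len (i \<otimes> v) = len v + 1"
  shows "len v < n \<or> v = ev (alt n j i) \<longleftrightarrow> len v \<le> n"
    and "len (i \<otimes> v) < n \<or> i \<otimes> v = ev (alt n j i) \<longleftrightarrow> len v + 1 < n"
    and "len v < Suc n \<or> v = ev (alt (Suc n) i j) \<longleftrightarrow> len v \<le> n"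
    and "len (i \<otimes> v) < Suc n \<or> i \<otimes> v = ev (alt (Suc n) i j) \<longleftrightarrow> len v \<le> n"
proof -
  interpret f: dihedral W S j i by (rule flip)
  have vc: "v \<in> carrier W" using par_carrier[OF ij v] .
  have va: "v = ev (alt (len v) j i)"
    using f.descent_alt[of v] v up by (simp add: insert_commute)
  have lj: "len (ev (alt n j i)) = n" using f.len_alt[of n] n flip_m by simp
  have ls: "len (ev (alt (Suc n) i j)) = Suc n" using len_alt[of "Suc n"] n by simp
  show 1: "len v < n \<or> v = ev (alt n j i) \<longleftrightarrow> len v \<le> n"
    using va lj by (metis le_less)
  have "i \<otimes> v \<noteq> ev (alt n j i)"
  proof
    assume e: "i \<otimes> v = ev (alt n j i)"
    have "ev (alt (Suc n) i j) = i \<otimes> (i \<otimes> v)" using e by simp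
    then have "ev (alt (Suc n) i j) = v" using i vc by simp
    then show False using ls lj e up by simp
  qed
  then show "len (i \<otimes> v) < n \<or> i \<otimes> v = ev (alt n j i) \<longleftrightarrow> len v + 1 < n" using up by auto
  have "v \<noteq> ev (alt (Suc n) i j)"
  proof
    assume e: "v = ev (alt (Suc n) i j)"
    then have "i \<otimes> v = ev (alt n j i)" using i f.alt_lists(2)[of n] by simp
    then show False using \<open>i \<otimes> v \<noteq> ev (alt n j i)\<close> by simp
  qed
  then show "len v < Suc n \<or> v = ev (alt (Suc n) i j) \<longleftrightarrow> len v \<le> n" by auto
  have "i \<otimes> v = ev (alt (Suc n) i j) \<longleftrightarrow> v = ev (alt n j i)"
    using i vc f.alt_lists(2)[of n] by auto
  then show "len (i \<otimes> v) < Suc n \<or> i \<otimes> v = ev (alt (Suc n) i j) \<longleftrightarrow> len v \<le> n"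
    using up 1 by auto
qed

end

subsection \<open>Counting stuttering galleries modulo a prime\<close>

context building
begin

text \<open>\<open>G\<close> is the projection of \<open>D\<close> to the panel. All other chambers
  of the panel share one distance to \<open>D\<close>, so sums over a panel involve only two
  values.\<close>

lemma panel_gate:
  assumes "s \<in> S" "C \<in> \<C>" "D \<in> \<C>"
  obtains G where "G \<in> res {s} C" "len (s \<otimes> \<delta> G D) = len (\<delta> G D) + 1"
    "\<forall>E\<in>res {s} C. E \<noteq> G \<longrightarrow> \<delta> E D = s \<otimes> \<delta> G D"
proof -
  have "\<exists>G\<in>res {s} C. len (s \<otimes> \<delta> G D) = len (\<delta> G D) + 1"
  proof (cases "len (s \<otimes> \<delta> C D) = len (\<delta> C D) + 1")
    case True then show ?thesis using res_self assms by blast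
  next
    case False
    obtain G where G: "G \<in> \<C>" "\<delta> G C = s" "\<delta> G D = s \<otimes> \<delta> C D" using WD3[OF assms(2,3,1)] by blast
    then have "G \<in> res {s} C" using panel_iff adj_sym assms by metis
    moreover have "len (s \<otimes> \<delta> G D) = len (\<delta> G D) + 1"
      using False len_mult_S[OF assms(1), of "\<delta> C D"] G assms by auto
    ultimately show ?thesis by blast
  qed
  then obtain G where G: "G \<in> res {s} C" "len (s \<otimes> \<delta> G D) = len (\<delta> G D) + 1" by blast
  have s: "{s} \<subseteq> S" using assms by simp
  have Gc: "G \<in> \<C>" "res {s} G = res {s} C" using G res_eq[OF s assms(2) G(1)] by (auto simp: res_def)
  have "\<delta> E D = s \<otimes> \<delta> G D" if "E \<in> res {s} C" "E \<noteq> G" for E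
  proof -
    have "E \<in> \<C>" "\<delta> G E = s" using that Gc panel_iff[OF assms(1) Gc(1), of E] by auto
    then show ?thesis using dist_step_up[OF _ assms(3) Gc(1) assms(1) _ G(2)] adj_sym Gc assms by blast
  qed
  then show thesis using that G by blast
qed

text \<open>Stuttering galleries: unlike in \<open>gallery\<close>, a step may stay in place, as the
  panel contains \<open>C\<close>. In matrix terms this is an entry of a product of factors
  \<open>1 + T_s\<close>.\<close>

primrec ngal :: "'a list \<Rightarrow> 'c \<Rightarrow> 'c \<Rightarrow> nat" where
  "ngal [] C D = (if C = D then 1 else 0)"
| "ngal (s # f) C D = (\<Sum>E\<in>res {s} C. ngal f E D)"

lemma ngal_len:
  "f \<in> lists S \<Longrightarrow> C \<in> \<C> \<Longrightarrow> D \<in> \<C> \<Longrightarrow> ngal f C D \<noteq> 0 \<Longrightarrow> len (\<delta> C D) \<le> length f"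
proof (induction f arbitrary: C rule: list.induct)
  case Nil then show ?case by (auto split: if_splits)
next
  case (Cons s f)
  have s: "s \<in> S" "f \<in> lists S" using Cons.prems by auto
  obtain E where E: "E \<in> res {s} C" "ngal f E D \<noteq> 0" using Cons.prems(4) by (metis ngal.simps(2) sum.neutral)
  have Ec: "E \<in> \<C>" using E by (simp add: res_def)
  have "len (\<delta> E D) \<le> length f" using Cons.IH[OF s(2) Ec Cons.prems(3) E(2)] .
  moreover have "\<delta> C D = s \<otimes> \<delta> E D \<or> \<delta> C D = \<delta> E D"
    using E(1) panel_iff[OF s(1) Cons.prems(2)] dist_step[OF Cons.prems(2,3) Ec s(1)] by auto
  moreover have "len (s \<otimes> \<delta> E D) \<le> len (\<delta> E D) + 1" using len_mult_le[of s "\<delta> E D"] s Ec Cons.prems by simp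
  ultimately show ?case by auto
qed

end

locale mod_p_residue = building W S \<C> \<delta> + dihedral W S i j
  for W (structure) and S and \<C> :: "'c set" and \<delta> and i j +
  fixes p :: nat and c0
  assumes p: "prime p" and c0: "c0 \<in> \<C>"
    and panel: "\<And>k C. k \<in> {i, j} \<Longrightarrow> C \<in> \<C> \<Longrightarrow> finite (res {k} C) \<and> [card (res {k} C) = 1] (mod p)"
begin

abbreviation R :: "'c set" where "R \<equiv> res {i, j} c0"

lemma R_sub: "R \<subseteq> \<C>" by (auto simp: res_def)

lemma R_panel: "k \<in> {i, j} \<Longrightarrow> C \<in> R \<Longrightarrow> res {k} C \<subseteq> R"
  by (rule res_panel[OF ij _ c0])

lemma R_dist: "C \<in> R \<Longrightarrow> D \<in> R \<Longrightarrow> \<delta> C D \<in> par {i, j}"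
  using res_eq[OF ij c0] by (auto simp: res_def)

lemma flip_mod: "mod_p_residue W S \<C> \<delta> j i p c0"
proof -
  interpret f: dihedral W S j i by (rule flip)
  show ?thesis using p c0 panel by unfold_locales auto
qed

lemma cong_sum_panel:
  assumes k: "k \<in> {i, j}" and C: "C \<in> \<C>" and g: "\<And>E. E \<in> res {k} C \<Longrightarrow> [g E = b] (mod p)"
  shows "[sum g (res {k} C) = b] (mod p)"
proof -
  have "[sum g (res {k} C) = (\<Sum>E\<in>res {k} C. b)] (mod p)" by (rule cong_sum) (use g in auto)
  also have "(\<Sum>E\<in>res {k} C. b) = card (res {k} C) * b" by simp
  also have "[card (res {k} C) * b = 1 * b] (mod p)" using panel[OF k C] cong_scalar_right by blast
  finally show ?thesis by simp
qed

text \<open>Modulo \<open>p\<close> the factors \<open>1 + T_s\<close> multiply as in the 0-Hecke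
  algebra, so the count becomes the indicator that the distance is the value of a subword of the
  type. In the induction the values on a panel either are all equal, and sum to that value since the
  panel has size one modulo \<open>p\<close>, or are one at the gate and zero elsewhere. The second
  case occurs when the gate is at distance \<open>n - 1\<close> or \<open>n\<close>.\<close>

lemma ngal_alt:
  "n \<le> m \<Longrightarrow> C \<in> R \<Longrightarrow> D \<in> R \<Longrightarrow>
    [ngal (alt n i j) C D = of_bool (len (\<delta> C D) < n \<or> \<delta> C D = ev (alt n i j))] (mod p) \<and>
    [ngal (alt n j i) C D = of_bool (len (\<delta> C D) < n \<or> \<delta> C D = ev (alt n j i))] (mod p)"
proof (induction n arbitrary: C)
  case 0
  then show ?case using WD1[of C D] R_sub by auto
next
  case (Suc n)
  have step: "[ngal (alt (Suc n) x y) C D = of_bool (len (\<delta> C D) < Suc n \<or> \<delta> C D = ev (alt (Suc n) x y))] (mod p)"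
    if di: "mod_p_residue W S \<C> \<delta> x y p c0" and xy: "{x, y} = {i, j}" and mm: "dihedral.m W S x y = m"
      and IH: "\<And>E. E \<in> R \<Longrightarrow> [ngal (alt n y x) E D = of_bool (len (\<delta> E D) < n \<or> \<delta> E D = ev (alt n y x))] (mod p)" for x y
  proof -
    interpret d: mod_p_residue W S \<C> \<delta> x y p c0 by (rule di)
    have x: "x \<in> {i, j}" using xy by auto
    have CC: "C \<in> \<C>" "D \<in> \<C>" using Suc.prems R_sub by auto
    obtain G where G: "G \<in> res {x} C" "len (x \<otimes> \<delta> G D) = len (\<delta> G D) + 1"
      "\<forall>E\<in>res {x} C. E \<noteq> G \<longrightarrow> \<delta> E D = x \<otimes> \<delta> G D" using panel_gate[OF d.i CC] .
    note G3 = G(3)[rule_format]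
    have GR: "G \<in> R" using G R_panel[OF x Suc.prems(2)] by auto
    have v: "\<delta> G D \<in> par {x, y}" using R_dist[OF GR Suc.prems(3)] xy by simp
    have nm: "n < d.m" using Suc.prems mm by simp
    note b = d.below_alt[OF nm v G(2)]
    have fin: "finite (res {x} C)" using panel[OF x CC(1)] by simp
    have E: "E \<in> R" if "E \<in> res {x} C" for E using that R_panel[OF x Suc.prems(2)] by auto
    have "[ngal (alt (Suc n) x y) C D = of_bool (len (\<delta> G D) \<le> n)] (mod p)"
    proof (cases "len (\<delta> G D) + 1 < n \<or> n < len (\<delta> G D)")
      case True
      have "[ngal (alt n y x) E D = of_bool (len (\<delta> G D) \<le> n)] (mod p)" if "E \<in> res {x} C" for E
      proof -
        have "(len (\<delta> E D) < n \<or> \<delta> E D = ev (alt n y x)) = (len (\<delta> G D) \<le> n)"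
          using True b(1,2) G3[OF that] by (cases "E = G") auto
        then show ?thesis using IH[OF E[OF that]] by simp
      qed
      then show ?thesis using cong_sum_panel[OF x CC(1)] by simp
    next
      case False
      have "[ngal (alt n y x) E D = of_bool (E = G)] (mod p)" if "E \<in> res {x} C" for E
      proof -
        have "(len (\<delta> E D) < n \<or> \<delta> E D = ev (alt n y x)) = (E = G)"
          using False b(1,2) G3[OF that] by (cases "E = G") auto
        then show ?thesis using IH[OF E[OF that]] by simp
      qed
      then have "[(\<Sum>E\<in>res {x} C. ngal (alt n y x) E D) = (\<Sum>E\<in>res {x} C. of_bool (E = G))] (mod p)"
        by (intro cong_sum) auto
      moreover have "(\<Sum>E\<in>res {x} C. of_bool (E = G)) = (1::nat)"
        using fin G(1) by (simp add: of_bool_def)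
      ultimately show ?thesis using False by simp
    qed
    moreover have "(len (\<delta> C D) < Suc n \<or> \<delta> C D = ev (alt (Suc n) x y)) = (len (\<delta> G D) \<le> n)"
      using b(3,4) G3[of C] res_self[OF CC(1)] by (cases "C = G") auto
    ultimately show ?thesis by simp
  qed
  have "mod_p_residue W S \<C> \<delta> i j p c0" by unfold_locales
  then show ?case
    using step[of i j] step[of j i] flip_mod flip_m Suc by (simp add: insert_commute)
qed

text \<open>At length \<open>m\<close> every distance in the residue is a subword, so the counting
  matrix is all ones modulo \<open>p\<close>.\<close>

lemma ngal_longest:
  assumes "C \<in> R" "D \<in> R" shows "[ngal (alt m i j) C D = 1] (mod p)"
proof -
  have d: "\<delta> C D \<in> par {i, j}" using R_dist assms by blast
  have "len (\<delta> C D) < m \<or> \<delta> C D = ev (alt m i j)"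
    using longest(2)[OF fin d] longest_unique[OF ij fin d] longest_alt unfolding m_def by (metis le_less)
  then show ?thesis using ngal_alt[of m C D] assms by simp
qed

lemma ngal_prefix:
  "f \<in> lists {i, j} \<Longrightarrow> (\<And>C. C \<in> R \<Longrightarrow> [ngal g C D = 1] (mod p)) \<Longrightarrow> C \<in> R \<Longrightarrow> [ngal (f @ g) C D = 1] (mod p)"
proof (induction f arbitrary: C rule: list.induct)
  case (Cons s f)
  have s: "s \<in> {i, j}" "f \<in> lists {i, j}" using Cons.prems by auto
  have "[ngal (f @ g) E D = 1] (mod p)" if "E \<in> res {s} C" for E
    using Cons.IH[OF s(2) Cons.prems(2)] that R_panel[OF s(1) Cons.prems(3)] by auto
  then show ?case using cong_sum_panel[OF s(1), of C "\<lambda>E. ngal (f @ g) E D" 1] Cons.prems(3) R_sub by auto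
qed simp

lemma ngal_double:
  assumes k: "k \<in> {i, j}" and C: "C \<in> \<C>"
  shows "[ngal (k # k # f) C D = ngal (k # f) C D] (mod p)"
proof -
  have k': "{k} \<subseteq> S" using k i j by auto
  have "ngal (k # f) E D = ngal (k # f) C D" if "E \<in> res {k} C" for E
    using res_eq[OF k' C that] by simp
  then have "[ngal (k # f) E D = ngal (k # f) C D] (mod p)" if "E \<in> res {k} C" for E using that by simp
  then show ?thesis using cong_sum_panel[OF k C, of "\<lambda>E. ngal (k # f) E D"] by simp
qed

lemma R_finite: "finite R"
  using finite_res[OF ij fin c0] panel by blast

lemma sum_ngal:
  "f \<in> lists {i, j} \<Longrightarrow> C \<in> R \<Longrightarrow> [(\<Sum>D\<in>R. ngal f C D) = 1] (mod p)"
proof (induction f arbitrary: C rule: list.induct)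
  case Nil then show ?case using R_finite by simp
next
  case (Cons s f)
  have s: "s \<in> {i, j}" "f \<in> lists {i, j}" using Cons.prems by auto
  have "(\<Sum>D\<in>R. ngal (s # f) C D) = (\<Sum>E\<in>res {s} C. \<Sum>D\<in>R. ngal f E D)" by (simp add: sum.swap[of _ R])
  moreover have "[(\<Sum>D\<in>R. ngal f E D) = 1] (mod p)" if "E \<in> res {s} C" for E
    using Cons.IH[OF s(2)] that R_panel[OF s(1) Cons.prems(2)] by auto
  ultimately show ?case using cong_sum_panel[OF s(1), of C "\<lambda>E. \<Sum>D\<in>R. ngal f E D" 1] Cons.prems(2) R_sub by auto
qed

text \<open>A row of the all-ones matrix sums to \<open>card R\<close>, while all row sums are one
  modulo \<open>p\<close>.\<close>

lemma card_R: "[card R = 1] (mod p)"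
proof -
  have c: "c0 \<in> R" using res_self c0 .
  have "[(\<Sum>D\<in>R. ngal (alt m i j) c0 D) = (\<Sum>D\<in>R. 1)] (mod p)"
    by (rule cong_sum) (use ngal_longest c in auto)
  then show ?thesis using sum_ngal[OF alt_lists(1) c, of m] by (simp add: cong_def)
qed

lemma ngal_append:
  "f \<in> lists {i, j} \<Longrightarrow> C \<in> R \<Longrightarrow> ngal (f @ g) C D = (\<Sum>E\<in>R. ngal f C E * ngal g E D)"
proof (induction f arbitrary: C rule: list.induct)
  case Nil
  have "(\<Sum>E\<in>R. (if C = E then 1 else 0) * ngal g E D) = (\<Sum>E\<in>R. if C = E then ngal g E D else 0)"
    by (intro sum.cong) auto
  then show ?case using R_finite Nil by simp
next
  case (Cons s f)
  have s: "s \<in> {i, j}" "f \<in> lists {i, j}" using Cons.prems by auto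
  have "ngal ((s # f) @ g) C D = (\<Sum>F\<in>res {s} C. \<Sum>E\<in>R. ngal f F E * ngal g E D)"
    using Cons.IH[OF s(2)] R_panel[OF s(1) Cons.prems(2)] by (auto intro!: sum.cong)
  also have "\<dots> = (\<Sum>E\<in>R. \<Sum>F\<in>res {s} C. ngal f F E * ngal g E D)" by (rule sum.swap)
  finally show ?case by (simp add: sum_distrib_right)
qed

text \<open>
  If the two letters at the junction coincide, they merge modulo \<open>p\<close>, and what remains is still an
  alternating word of length at least \<open>m\<close>.
\<close>
lemma ngal_alt_alt:
  assumes xy: "{x, y} = {i, j}" and C: "C \<in> R" "D \<in> R"
  shows "[ngal (alt (m - 1) i j @ alt (m - 1) x y) C D = 1] (mod p)"
proof -
  interpret f: mod_p_residue W S \<C> \<delta> j i p c0 by (rule flip_mod)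
  have Rf: "res {j, i} c0 = R" by (simp add: insert_commute)
  have full: "[ngal (a # alt (m - 1) b a) E D = 1] (mod p)" if "{a, b} = {i, j}" "E \<in> R" for a b E
  proof -
    have "a # alt (m - 1) b a = alt m a b" using m_ge_3 by (cases m) auto
    then show ?thesis
      using ngal_longest[of E D] f.ngal_longest[of E D] flip_m that C(2) Rf ne by (auto simp: doubleton_eq_iff)
  qed
  define n where "n = m - 3"
  have n: "m - 1 = Suc (Suc n)" using m_ge_3 by (simp add: n_def)
  define a b where "a = (if even n then i else j)" and "b = (if even n then j else i)"
  have ab: "{a, b} = {i, j}" "a \<in> {i, j}" "b \<in> {i, j}" unfolding a_def b_def by auto
  have w: "alt (m - 1) i j = alt n i j @ [a, b]"
    unfolding n alt_snoc[of "Suc n"] alt_snoc[of n] a_def b_def by auto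
  have "[ngal ([a, b] @ alt (m - 1) x y) E D = 1] (mod p)" if E: "E \<in> R" for E
  proof (cases "x = b")
    case False
    then have xb: "x = a" "y = b" using xy ab ne unfolding a_def b_def by (auto split: if_splits simp: doubleton_eq_iff)
    have "[ngal (b # alt (m - 1) x y) F D = 1] (mod p)" if "F \<in> R" for F
      unfolding xb using full[of b a F] that ab by (simp add: insert_commute)
    then show ?thesis using ngal_prefix[of "[a]" "b # alt (m - 1) x y" D E] ab E by simp
  next
    case True
    then have ya: "y = a" using xy ab ne unfolding a_def b_def by (auto split: if_splits simp: doubleton_eq_iff)
    have al: "alt (m - 1) x y = b # alt (Suc n) a b" unfolding n True ya by simp
    have "[ngal (b # alt (m - 1) x y) F D = ngal (alt (m - 1) x y) F D] (mod p)" if "F \<in> res {a} E" for F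
    proof -
      have "F \<in> \<C>" using that by (simp add: res_def)
      then show ?thesis unfolding al by (rule ngal_double[OF ab(3)])
    qed
    then have "[(\<Sum>F\<in>res {a} E. ngal (b # alt (m - 1) x y) F D) = (\<Sum>F\<in>res {a} E. ngal (alt (m - 1) x y) F D)] (mod p)"
      by (intro cong_sum) auto
    then have "[ngal ([a, b] @ alt (m - 1) x y) E D = ngal (a # alt (m - 1) b a) E D] (mod p)"
      unfolding True ya by simp
    then show ?thesis using full[OF ab(1) E] cong_trans by blast
  qed
  then show ?thesis unfolding w append_assoc
    using ngal_prefix[OF alt_lists(1), of "[a, b] @ alt (m - 1) x y" D C n] C by simp
qed

end

section \<open>An opposing map and the trace modulo a prime\<close>

locale opposing_residue = mod_p_residue +
  fixes \<pi>
  assumes bij: "bij_betw \<pi> R R"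
    and iso: "\<And>A B. A \<in> R \<Longrightarrow> B \<in> R \<Longrightarrow> \<delta> (\<pi> A) (\<pi> B) = longest {i, j} \<otimes> \<delta> A B \<otimes> longest {i, j}"
    and opp: "\<And>A. A \<in> R \<Longrightarrow> \<delta> A (\<pi> A) = longest {i, j}"
begin

text \<open>The permutation of the two panel types induced by \<open>\<pi>\<close>.\<close>

definition star where "star k = longest {i, j} \<otimes> k \<otimes> longest {i, j}"

lemma w: "longest {i, j} \<in> carrier W" "longest {i, j} \<otimes> longest {i, j} = \<one>"
  using longest_carrier[OF ij fin] longest_sq[OF ij fin] by auto

lemma star_inj: "x \<in> carrier W \<Longrightarrow> y \<in> carrier W \<Longrightarrow> star x = star y \<longleftrightarrow> x = y"
  unfolding star_def using w by auto

lemma star_set: "{star i, star j} = {i, j}"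
proof -
  have "star i \<in> {i, j}" "star j \<in> {i, j}" unfolding star_def using longest_conj_S[OF ij fin] by auto
  moreover have "star i \<noteq> star j" using star_inj[of i j] i j ne by simp
  ultimately show ?thesis by auto
qed

lemma pi_R: "A \<in> R \<Longrightarrow> \<pi> A \<in> R" using bij by (auto simp: bij_betw_def)

lemma panel_bij:
  assumes k: "k \<in> {i, j}" and C: "C \<in> R"
  shows "bij_betw \<pi> (res {k} C) (res {star k} (\<pi> C))"
proof -
  have "star k \<in> {star i, star j}" using k by auto
  then have sk: "star k \<in> {i, j}" unfolding star_set .
  then have kS: "k \<in> S" "star k \<in> {i, j}" "star k \<in> S" using k i j by auto
  have CC: "C \<in> \<C>" "\<pi> C \<in> \<C>" using C pi_R R_sub by auto
  have sub: "res {k} C \<subseteq> R" "res {star k} (\<pi> C) \<subseteq> R" using R_panel k kS C pi_R by auto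
  have iff: "\<pi> E \<in> res {star k} (\<pi> C) \<longleftrightarrow> E \<in> res {k} C" if E: "E \<in> R" for E
  proof -
    have EC: "E \<in> \<C>" "\<pi> E \<in> \<C>" using E pi_R R_sub by auto
    have "\<pi> E = \<pi> C \<longleftrightarrow> E = C" using bij E C by (auto simp: bij_betw_def inj_on_def)
    moreover have "\<delta> (\<pi> C) (\<pi> E) = star k \<longleftrightarrow> \<delta> C E = k"
      using iso[OF C E] star_inj[of "\<delta> C E" k] CC EC kS unfolding star_def by auto
    ultimately show ?thesis using panel_iff[OF kS(1) CC(1)] panel_iff[OF kS(3) CC(2)] EC by auto
  qed
  have "\<pi> ` res {k} C = res {star k} (\<pi> C)"
  proof (intro equalityI subsetI)
    fix F assume "F \<in> \<pi> ` res {k} C"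
    then show "F \<in> res {star k} (\<pi> C)" using iff sub(1) by blast
  next
    fix F assume F: "F \<in> res {star k} (\<pi> C)"
    then have "F \<in> \<pi> ` R" using sub(2) bij bij_betw_imp_surj_on by blast
    then obtain E where "E \<in> R" "F = \<pi> E" by blast
    then show "F \<in> \<pi> ` res {k} C" using F iff by blast
  qed
  then show ?thesis using inj_on_subset[OF bij_betw_imp_inj_on[OF bij] sub(1)] by (simp add: bij_betw_def)
qed

lemma ngal_iso: "f \<in> lists {i, j} \<Longrightarrow> C \<in> R \<Longrightarrow> D \<in> R \<Longrightarrow> ngal (map star f) (\<pi> C) (\<pi> D) = ngal f C D"
proof (induction f arbitrary: C rule: list.induct)
  case Nil then show ?case using bij by (auto simp: bij_betw_def inj_on_def)
next
  case (Cons k f)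
  have k: "k \<in> {i, j}" "f \<in> lists {i, j}" using Cons.prems by auto
  have "(\<Sum>E\<in>res {star k} (\<pi> C). ngal (map star f) E (\<pi> D)) = (\<Sum>E\<in>res {k} C. ngal (map star f) (\<pi> E) (\<pi> D))"
    by (rule sum.reindex_bij_betw[OF panel_bij[OF k(1) Cons.prems(2)], symmetric])
  also have "\<dots> = (\<Sum>E\<in>res {k} C. ngal f E D)"
  proof (rule sum.cong[OF HOL.refl])
    fix E assume "E \<in> res {k} C"
    then have "E \<in> R" using R_panel[OF k(1) Cons.prems(2)] by blast
    then show "ngal (map star f) (\<pi> E) (\<pi> D) = ngal f E D" using Cons.IH[OF k(2)] Cons.prems(3) by blast
  qed
  finally show ?case by simp
qed

text \<open>The alternating product twisted by \<open>\<pi>\<close>. Its length \<open>m - 1\<close>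
  is one short of the all-ones matrix, so that a chamber is not joined to its image at distance
  \<open>m\<close>.\<close>

definition Y :: "'c \<Rightarrow> 'c \<Rightarrow> nat" where "Y A B = ngal (alt (m - 1) i j) A (\<pi> B)"

lemma Y_diag: "A \<in> R \<Longrightarrow> Y A A = 0"
proof (rule ccontr)
  assume A: "A \<in> R" "Y A A \<noteq> 0"
  then have "len (\<delta> A (\<pi> A)) \<le> m - 1"
    using ngal_len[OF alt_lists(2), of A "\<pi> A" "m - 1"] pi_R R_sub unfolding Y_def by auto
  then show False using opp A m_ge_3 unfolding m_def by simp
qed

text \<open>Carrying \<open>\<pi>\<close> through the second factor replaces its letters by their
  \<open>star\<close> images. What remains is a product of two alternating words of length
  \<open>m - 1\<close>, all ones modulo \<open>p\<close> by \<open>ngal_alt_alt\<close>.\<close>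

lemma Y_sq: "A \<in> R \<Longrightarrow> B \<in> R \<Longrightarrow> [(\<Sum>X\<in>R. Y A X * Y X B) = 1] (mod p)"
proof -
  assume A: "A \<in> R" "B \<in> R"
  let ?f = "alt (m - 1) i j" and ?g = "alt (m - 1) (star i) (star j)"
  have "(\<Sum>X\<in>R. Y A X * Y X B) = (\<Sum>X\<in>R. ngal ?f A (\<pi> X) * ngal ?g (\<pi> X) (\<pi> (\<pi> B)))"
    using ngal_iso[OF alt_lists(1), of _ "\<pi> B" "m - 1"] pi_R A unfolding Y_def map_alt by (intro sum.cong) auto
  also have "\<dots> = (\<Sum>X\<in>R. ngal ?f A X * ngal ?g X (\<pi> (\<pi> B)))"
    by (rule sum.reindex_bij_betw[OF bij])
  also have "\<dots> = ngal (?f @ ?g) A (\<pi> (\<pi> B))" using ngal_append[OF alt_lists(1) A(1)] by metis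
  finally show ?thesis using ngal_alt_alt[OF star_set A(1) pi_R[OF pi_R[OF A(2)]]] by simp
qed

lemma Y_sum: "A \<in> R \<Longrightarrow> [(\<Sum>X\<in>R. Y A X) = 1] (mod p)"
  using sum_ngal[OF alt_lists(1), of A "m - 1"] sum.reindex_bij_betw[OF bij, of "ngal (alt (m - 1) i j) A"]
  unfolding Y_def by simp

primrec walk :: "'c \<Rightarrow> 'c list \<Rightarrow> 'c \<Rightarrow> nat" where
  "walk a [] b = Y a b"
| "walk a (x # xs) b = Y a x * walk x xs b"

lemma walk_append: "walk a (xs @ y # ys) b = walk a xs y * walk y ys b"
  by (induction xs arbitrary: a) auto

definition words :: "nat \<Rightarrow> 'c list set" where "words n = {xs. set xs \<subseteq> R \<and> length xs = n}"

lemma words_Suc: "words (Suc n) = (\<lambda>(x, xs). x # xs) ` (R \<times> words n)"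
  unfolding words_def by (auto simp: length_Suc_conv image_iff)

lemma finite_words: "finite (words n)"
  unfolding words_def using finite_lists_length_eq[OF R_finite] .

lemma sum_words_Suc: "sum g (words (Suc n)) = (\<Sum>x\<in>R. \<Sum>xs\<in>words n. g (x # xs))"
proof -
  have "inj_on (\<lambda>(x, xs). x # xs) (R \<times> words n)" by (auto simp: inj_on_def)
  from sum.reindex[OF this, of g] show ?thesis unfolding words_Suc
    by (simp add: sum.cartesian_product comp_def case_prod_beta)
qed

text \<open>The words list the intermediate chambers, so \<open>Suc n\<close> of them belong to the
  power of \<open>Y\<close> with exponent \<open>n + 2\<close>. The square of \<open>Y\<close> is
  all ones modulo \<open>p\<close>, and row sums equal to one preserve this.\<close>

lemma sum_walk: "A \<in> R \<Longrightarrow> B \<in> R \<Longrightarrow> [(\<Sum>xs\<in>words (Suc n). walk A xs B) = 1] (mod p)"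
proof (induction n arbitrary: A)
  case 0
  have "words 0 = {[]}" by (auto simp: words_def)
  then show ?case using Y_sq[OF 0] by (simp add: sum_words_Suc)
next
  case (Suc n)
  have "(\<Sum>xs\<in>words (Suc (Suc n)). walk A xs B) = (\<Sum>x\<in>R. Y A x * (\<Sum>xs\<in>words (Suc n). walk x xs B))"
    unfolding sum_words_Suc[of _ "Suc n"] by (simp add: sum_distrib_left)
  also have "[\<dots> = (\<Sum>x\<in>R. Y A x * 1)] (mod p)"
    by (intro cong_sum cong_scalar_left) (use Suc in auto)
  finally show ?case using Y_sum[OF Suc.prems(1)] by (simp add: cong_def)
qed

text \<open>
  Modulo \<open>p\<close> there are \<open>card R\<close>, that is one, closed \<open>Y\<close>-walks of length \<open>p\<close>, while rotation acts
  on them without fixed points because \<open>Y\<close> vanishes on the diagonal.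
\<close>
lemma contradiction: False
proof -
  obtain n where n: "p = Suc (Suc n)" using prime_ge_2_nat[OF p] by (metis add_2_eq_Suc le_Suc_ex)
  define g where "g xs = walk (hd xs) (tl xs) (hd xs)" for xs
  have "sum g (words p) = (\<Sum>x\<in>R. \<Sum>xs\<in>words (Suc n). walk x xs x)"
    unfolding n sum_words_Suc[of _ "Suc n"] g_def by simp
  also have "[\<dots> = (\<Sum>x\<in>R. 1)] (mod p)" by (intro cong_sum sum_walk) auto
  also have "(\<Sum>x\<in>R. 1) = card R" by simp
  finally have 1: "[sum g (words p) = 1] (mod p)" using card_R cong_trans by blast
  have "[sum g (words p) = sum g {xs \<in> words p. rotate1 xs = xs}] (mod p)"
  proof (rule sum_prime_period[OF finite_words p])
    show "rotate1 ` words p \<subseteq> words p" by (auto simp: words_def)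
    fix xs assume xs: "xs \<in> words p"
    then show "(rotate1 ^^ p) xs = xs" using rotate_id[of p xs] by (simp add: words_def rotate_def)
    obtain x y ys where "xs = x # y # ys" using xs n by (auto simp: words_def length_Suc_conv)
    then show "g (rotate1 xs) = g xs"
      unfolding g_def using walk_append[of y ys x "[]" y] by simp
  qed
  moreover have "sum g {xs \<in> words p. rotate1 xs = xs} = 0"
  proof (rule sum.neutral, safe)
    fix xs assume xs: "xs \<in> words p" "rotate1 xs = xs"
    obtain x y ys where e: "xs = x # y # ys" using xs n by (auto simp: words_def length_Suc_conv)
    then have "y = x" "x \<in> R" using xs by (auto simp: words_def)
    then show "g xs = 0" unfolding g_def e using Y_diag by simp
  qed
  ultimately have "[0 = 1] (mod p)" using 1 by (metis cong_def)
  then show False using prime_gt_1_nat[OF p] by (simp add: cong_def)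
qed

end

section \<open>Perspectivities between residues with a common opposite\<close>

context twin_building
begin

text \<open>Meaningful when \<open>Q\<close> is a \<open>J\<close>-residue at codistance in
  \<open>par J\<close> from \<open>X\<close>; the lemma \<open>prj\<close> gives existence and
  uniqueness in that case.\<close>

definition prj :: "'a set \<Rightarrow> 'c set \<Rightarrow> 'c \<Rightarrow> 'c" where
  "prj J Q X = (THE E. E \<in> Q \<and> \<delta>s X E = longest J)"

text \<open>Perspectivity from the \<open>J\<close>-residues opposite that of \<open>z\<close> to the \<open>J\<close>-residue of \<open>c\<close>.\<close>
definition psp :: "bool \<Rightarrow> 'a set \<Rightarrow> 'c \<Rightarrow> 'c \<Rightarrow> 'c \<Rightarrow> 'c" where
  "psp \<epsilon> J z c X = prj J (half.res \<epsilon> J c) (prj J (half.res (\<not> \<epsilon>) J z) X)"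

context
  fixes J assumes J: "J \<subseteq> S" and fin: "finite (par J)"
begin

lemma prj:
  assumes X: "X \<in> \<Delta> \<epsilon>" and D: "D \<in> \<Delta> \<epsilon>'" "\<epsilon>' = (\<not> \<epsilon>)" and opp: "\<delta>s X D \<in> par J"
  shows "prj J (half.res \<epsilon>' J D) X \<in> half.res \<epsilon>' J D"
    and "\<delta>s X (prj J (half.res \<epsilon>' J D) X) = longest J"
    and "E \<in> half.res \<epsilon>' J D \<Longrightarrow> \<delta>s X E = longest J \<Longrightarrow> prj J (half.res \<epsilon>' J D) X = E"
proof -
  have D': "D \<in> \<Delta> (\<not> \<epsilon>)" using D by simp
  have uq: "E = F" if "E \<in> half.res \<epsilon>' J D" "F \<in> half.res \<epsilon>' J D" "\<delta>s X E = longest J" "\<delta>s X F = longest J" for E F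
  proof (rule proj_unique[OF J fin X _ _ that(3,4)])
    show E: "E \<in> \<Delta> (\<not> \<epsilon>)" "F \<in> \<Delta> (\<not> \<epsilon>)" using that D by (auto simp: half.res_def)
    show "\<delta> E F \<in> par J" using half.res_eq[OF J D(1) that(1)] that(2) by (auto simp: half.res_def)
  qed
  obtain E0 where E0: "E0 \<in> \<Delta> (\<not> \<epsilon>)" "\<delta> D E0 \<in> par J" "\<delta>s X E0 = longest J" using proj_exists[OF J fin X D' opp] .
  then have E0r: "E0 \<in> half.res \<epsilon>' J D" using D by (simp add: half.res_def)
  have e: "prj J (half.res \<epsilon>' J D) X = E" if "E \<in> half.res \<epsilon>' J D" "\<delta>s X E = longest J" for E
    unfolding prj_def using that uq by (intro the_equality) blast+
  show "prj J (half.res \<epsilon>' J D) X \<in> half.res \<epsilon>' J D" "\<delta>s X (prj J (half.res \<epsilon>' J D) X) = longest J"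
    using e[OF E0r E0(3)] E0r E0 by auto
  show "E \<in> half.res \<epsilon>' J D \<Longrightarrow> \<delta>s X E = longest J \<Longrightarrow> prj J (half.res \<epsilon>' J D) X = E" using e .
qed

text \<open>By \<open>cod_proj\<close>, codistances to the chambers of a residue depend only on the
  projection to it.\<close>

lemma cod_same_proj:
  assumes t: "\<tau> \<in> \<Delta> \<epsilon>" and e: "e \<in> \<Delta> \<epsilon>" and z: "z \<in> \<Delta> (\<not> \<epsilon>)" "z' \<in> \<Delta> (\<not> \<epsilon>)"
    and p: "\<delta>s \<tau> z = longest J" "\<delta>s \<tau> z' = longest J" and r: "\<delta> \<tau> e \<in> par J"
  shows "\<delta>s e z = \<delta>s e z'"
proof -
  have "\<delta>s z e = \<delta> e \<tau> \<otimes> longest J"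
    using cod_proj[OF J fin z(1), of \<tau> e] proj_sym[OF J fin t z(1)] p t e r by simp
  moreover have "\<delta>s z' e = \<delta> e \<tau> \<otimes> longest J"
    using cod_proj[OF J fin z(2), of \<tau> e] proj_sym[OF J fin t z(2)] p t e r by simp
  ultimately show ?thesis using cod_inv[OF e z(1)] cod_inv[OF e z(2)] by simp
qed

lemma cod_opp_res:
  assumes y: "y \<in> \<Delta> \<epsilon>" "z \<in> \<Delta> (\<not> \<epsilon>)" "\<delta>s y z \<in> par J"
    and X: "X \<in> half.res \<epsilon> J y" and Z: "Z \<in> half.res (\<not> \<epsilon>) J z"
  shows "\<delta>s X Z \<in> par J"
proof -
  have 1: "X \<in> \<Delta> \<epsilon>" "\<delta> y X \<in> par J" "Z \<in> \<Delta> (\<not> \<epsilon>)" "\<delta> z Z \<in> par J" using X Z by (auto simp: half.res_def)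
  have "\<delta>s X z \<in> par J" using cod_par_iff_left[OF J y(1) 1(1) y(2) 1(2)] y(3) by simp
  then show ?thesis using cod_par_iff[OF J 1(1) y(2) 1(3,4)] by simp
qed

text \<open>The image of \<open>X\<close> is pinned down by its codistances to the whole residue of
  \<open>z\<close>. Later arguments identify images by this property instead of following the two
  projections.\<close>

lemma psp:
  assumes y: "y \<in> \<Delta> \<epsilon>" "c \<in> \<Delta> \<epsilon>" "z \<in> \<Delta> (\<not> \<epsilon>)" "\<delta>s y z \<in> par J" "\<delta>s c z \<in> par J"
    and X: "X \<in> half.res \<epsilon> J y"
  shows "psp \<epsilon> J z c X \<in> half.res \<epsilon> J c"
    and "\<forall>Z\<in>half.res (\<not> \<epsilon>) J z. \<delta>s (psp \<epsilon> J z c X) Z = \<delta>s X Z"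
    and "X' \<in> half.res \<epsilon> J c \<Longrightarrow> \<forall>Z\<in>half.res (\<not> \<epsilon>) J z. \<delta>s X' Z = \<delta>s X Z \<Longrightarrow> psp \<epsilon> J z c X = X'"
    and "\<exists>a\<in>half.res (\<not> \<epsilon>) J z. \<delta>s X a = longest J \<and> \<delta>s (psp \<epsilon> J z c X) a = longest J"
proof -
  let ?a = "prj J (half.res (\<not> \<epsilon>) J z) X"
  have Xh: "X \<in> \<Delta> \<epsilon>" "\<delta>s X z \<in> par J"
    using cod_opp_res[OF y(1,3,4) X half.res_self[OF y(3)]] X by (auto simp: half.res_def)
  note a = prj[OF Xh(1) y(3) HOL.refl Xh(2)]
  have ah: "?a \<in> \<Delta> (\<not> \<epsilon>)" using a(1) by (auto simp: half.res_def)
  have ca: "\<delta>s c ?a \<in> par J" by (rule cod_opp_res[OF y(2,3,5) half.res_self[OF y(2)] a(1)])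
  have ac: "\<delta>s ?a c \<in> par J" using cod_par_sym[OF J y(2) ah] ca by simp
  have nn: "\<epsilon> = (\<not> \<not> \<epsilon>)" by simp
  note b = prj[OF ah y(2) nn ac]
  have bb: "prj J (half.res \<epsilon> J c) ?a = psp \<epsilon> J z c X" by (simp add: psp_def)
  show 1: "psp \<epsilon> J z c X \<in> half.res \<epsilon> J c" using b(1) bb by simp
  have bh: "psp \<epsilon> J z c X \<in> \<Delta> \<epsilon>" using 1 by (simp add: half.res_def)
  have ba: "\<delta>s (psp \<epsilon> J z c X) ?a = longest J" using b(2) bb proj_sym[OF J fin bh ah] by simp
  show 4: "\<exists>a\<in>half.res (\<not> \<epsilon>) J z. \<delta>s X a = longest J \<and> \<delta>s (psp \<epsilon> J z c X) a = longest J" using a ba by blast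
  show "\<forall>Z\<in>half.res (\<not> \<epsilon>) J z. \<delta>s (psp \<epsilon> J z c X) Z = \<delta>s X Z"
  proof
    fix Z assume Z: "Z \<in> half.res (\<not> \<epsilon>) J z"
    then have Zh: "Z \<in> \<Delta> (\<not> \<epsilon>)" by (simp add: half.res_def)
    have r: "\<delta> ?a Z \<in> par J" using half.res_eq[OF J y(3) a(1)] Z by (auto simp: half.res_def)
    show "\<delta>s (psp \<epsilon> J z c X) Z = \<delta>s X Z"
      using cod_proj[OF J fin bh ah Zh ba r] cod_proj[OF J fin Xh(1) ah Zh a(2) r] by simp
  qed
  assume X': "X' \<in> half.res \<epsilon> J c" "\<forall>Z\<in>half.res (\<not> \<epsilon>) J z. \<delta>s X' Z = \<delta>s X Z"
  then have xa: "\<delta>s X' ?a = longest J" using a(1,2) by simp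
  have "X' \<in> \<Delta> \<epsilon>" using X' by (simp add: half.res_def)
  then have "\<delta>s ?a X' = longest J" using proj_sym[OF J fin _ ah] xa by simp
  then show "psp \<epsilon> J z c X = X'" using b(3)[OF X'(1)] bb by simp
qed

lemma psp_inverse:
  assumes y: "y \<in> \<Delta> \<epsilon>" "c \<in> \<Delta> \<epsilon>" "z \<in> \<Delta> (\<not> \<epsilon>)" "\<delta>s y z \<in> par J" "\<delta>s c z \<in> par J"
    and X: "X \<in> half.res \<epsilon> J y"
  shows "psp \<epsilon> J z y (psp \<epsilon> J z c X) = X"
  by (rule psp(3)[OF y(2,1,3,5,4)]) (use psp(1,2)[OF y X] X in auto)

lemma psp_isometry:
  assumes y: "y \<in> \<Delta> \<epsilon>" "c \<in> \<Delta> \<epsilon>" "z \<in> \<Delta> (\<not> \<epsilon>)" "\<delta>s y z \<in> par J" "\<delta>s c z \<in> par J"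
    and X: "X \<in> half.res \<epsilon> J y" "X' \<in> half.res \<epsilon> J y"
  shows "\<delta> (psp \<epsilon> J z c X) (psp \<epsilon> J z c X') = \<delta> X X'"
proof -
  obtain a where a: "a \<in> half.res (\<not> \<epsilon>) J z" "\<delta>s X a = longest J" "\<delta>s (psp \<epsilon> J z c X) a = longest J"
    using psp(4)[OF y X(1)] by blast
  obtain a' where a': "a' \<in> half.res (\<not> \<epsilon>) J z" "\<delta>s X' a' = longest J" "\<delta>s (psp \<epsilon> J z c X') a' = longest J"
    using psp(4)[OF y X(2)] by blast
  note P = psp(1)[OF y X(1)] psp(1)[OF y X(2)]
  have h: "X \<in> \<Delta> \<epsilon>" "X' \<in> \<Delta> \<epsilon>" "a \<in> \<Delta> (\<not> \<epsilon>)" "a' \<in> \<Delta> (\<not> \<epsilon>)"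
    "psp \<epsilon> J z c X \<in> \<Delta> \<epsilon>" "psp \<epsilon> J z c X' \<in> \<Delta> \<epsilon>" using X a a' P by (auto simp: half.res_def)
  have r: "\<delta> a a' \<in> par J" "\<delta> X X' \<in> par J" "\<delta> (psp \<epsilon> J z c X) (psp \<epsilon> J z c X') \<in> par J"
    using half.res_eq[OF J y(3) a(1)] a'(1) half.res_eq[OF J y(1) X(1)] X(2) half.res_eq[OF J y(2) P(1)] P(2)
    by (auto simp: half.res_def)
  have "longest J \<otimes> \<delta> X X' \<otimes> longest J = longest J \<otimes> \<delta> (psp \<epsilon> J z c X) (psp \<epsilon> J z c X') \<otimes> longest J"
    using proj_isometry[OF J fin h(1,2,3,4) r(2,1) a(2) a'(2)] proj_isometry[OF J fin h(5,6,3,4) r(3,1) a(3) a'(3)] by simp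
  then show ?thesis using longest_carrier[OF J fin] h by auto
qed

text \<open>
  If \<open>z\<close> and \<open>z''\<close> project to adjacent chambers of the residue of \<open>c\<close>, then the chamber of the panel of \<open>c\<close> on a
  minimal gallery towards the first projection distinguishes them.
\<close>
lemma proj_adjacent_contradiction:
  assumes h: "c \<in> \<Delta> \<epsilon>" "\<tau> \<in> \<Delta> \<epsilon>" "z \<in> \<Delta> (\<not> \<epsilon>)" "z'' \<in> \<Delta> (\<not> \<epsilon>)" and r: "\<delta> c \<tau> \<in> par J"
    and o: "\<delta>s c z = \<one>" "\<delta>s c z'' = \<one>" and t: "\<delta>s \<tau> z = longest J" "\<delta>s \<tau> z'' = j \<otimes> longest J" and j: "j \<in> J"
    and eq: "\<forall>e\<in>\<Delta> \<epsilon>. \<delta> c e = j \<longrightarrow> \<delta>s e z = \<delta>s e z''"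
  shows False
proof -
  let ?w = "longest J"
  have w: "?w \<in> carrier W" "?w \<otimes> ?w = \<one>" "inv ?w = ?w"
    using longest_carrier[OF J fin] longest_sq[OF J fin] longest_inv[OF J fin] by auto
  have jS: "j \<in> S" using j J by auto
  have oz: "\<delta>s z c = \<one>" "\<delta>s z'' c = \<one>" using o Tw1[OF h(1,3)] Tw1[OF h(1,4)] by auto
  obtain \<rho> where \<rho>: "\<rho> \<in> \<Delta> \<epsilon>" "\<delta> c \<rho> \<in> par J" "\<delta>s z'' \<rho> = ?w"
    using proj_exists[OF J fin h(4), of c] h(1) oz by auto
  have tz: "\<delta>s z \<tau> = ?w" using proj_sym[OF J fin h(2,3)] t by simp
  have pz: "\<delta>s z e = \<delta> e \<tau> \<otimes> ?w" if e: "e \<in> \<Delta> \<epsilon>" "\<delta> c e \<in> par J" for e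
  proof (rule cod_proj[OF J fin h(3)])
    show "\<tau> \<in> \<Delta> (\<not> \<not> \<epsilon>)" "e \<in> \<Delta> (\<not> \<not> \<epsilon>)" using h e by auto
    show "\<delta> \<tau> e \<in> par J" using half.par_trans[OF J h(2,1) e(1) half.par_sym[OF J h(1,2) r] e(2)] .
  qed (use tz in simp)
  have pz'': "\<delta>s z'' e = \<delta> e \<rho> \<otimes> ?w" if e: "e \<in> \<Delta> \<epsilon>" "\<delta> c e \<in> par J" for e
  proof (rule cod_proj[OF J fin h(4)])
    show "\<rho> \<in> \<Delta> (\<not> \<not> \<epsilon>)" "e \<in> \<Delta> (\<not> \<not> \<epsilon>)" using \<rho> e by auto
    show "\<delta> \<rho> e \<in> par J" using half.par_trans[OF J \<rho>(1) h(1) e(1) half.par_sym[OF J h(1) \<rho>(1,2)] e(2)] .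
  qed (use \<rho> in simp)
  have cancel: "x = a \<otimes> ?w" if "x \<otimes> ?w = a" "x \<in> carrier W" "a \<in> carrier W" for x a
  proof -
    have "x = x \<otimes> ?w \<otimes> ?w" using that(2) w by (simp add: m_assoc)
    then show ?thesis using that(1) by simp
  qed
  have ct: "\<delta> c \<tau> = ?w" using cancel[of "\<delta> c \<tau>" \<one>] pz[of c] oz h w by simp
  have "\<delta>s z'' \<tau> = inv (j \<otimes> ?w)" using Tw1[OF h(2,4)] t by simp
  then have "\<delta> \<tau> \<rho> \<otimes> ?w = ?w \<otimes> j" using pz''[OF h(2) r] w jS by (simp add: inv_mult_group)
  then have tr: "\<delta> \<tau> \<rho> = ?w \<otimes> j \<otimes> ?w" using cancel[of "\<delta> \<tau> \<rho>" "?w \<otimes> j"] h \<rho> w jS by simp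
  have j': "?w \<otimes> j \<otimes> ?w \<in> S" using longest_conj_S[OF J fin j] J by auto
  obtain e where e: "e \<in> \<Delta> \<epsilon>" "\<delta> e c = j" "\<delta> e \<tau> = j \<otimes> ?w" using half.WD3[OF h(1,2) jS] ct by auto
  have ce: "\<delta> c e = j" using half.adj_sym[OF e(1) h(1) e(2) jS] .
  have cep: "\<delta> c e \<in> par J" using ce par_incl[OF j] by simp
  have "\<delta>s z e = \<delta>s z'' e" using eq e(1) ce Tw1[OF e(1) h(3)] Tw1[OF e(1) h(4)] by simp
  then have "\<delta> e \<tau> \<otimes> ?w = \<delta> e \<rho> \<otimes> ?w" using pz[OF e(1) cep] pz''[OF e(1) cep] by simp
  then have er: "\<delta> e \<rho> = j \<otimes> ?w" using e h \<rho> w by auto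
  have id: "j \<otimes> ?w \<otimes> (?w \<otimes> j \<otimes> ?w) = ?w" using w jS by (simp add: m_assoc longest_cancel[OF J fin])
  have "len (j \<otimes> ?w) + 1 = len ?w" using len_longest_mult[OF J fin par_incl[OF j]] jS by simp
  \<comment> \<open>\<open>\<rho>\<close> is one step beyond \<open>\<tau>\<close>, and that step
    raises the distance from \<open>e\<close> to \<open>?w\<close>, although equal codistances have
    made it \<open>j \<otimes> ?w\<close>.\<close>
  then have "\<delta> e \<rho> = ?w"
    using half.dist_step_right(2)[OF e(1) h(2) \<rho>(1) j' tr] e(3) id by simp
  then have "j \<otimes> ?w = ?w" using er by simp
  then show False using jS w S_not_one[OF jS] by (simp add: l_cancel_one)
qed

end

end

subsection \<open>Local automorphisms from self-projectivities\<close>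

locale three_letters = twin_building +
  fixes \<epsilon> :: bool and s t u
  assumes s: "s \<in> S" and t: "t \<in> S" and u: "u \<in> S" and us: "u \<noteq> s" and ut: "u \<noteq> t"
    and st: "s \<otimes> t \<noteq> t \<otimes> s" and nc: "\<not> (u \<otimes> s = s \<otimes> u \<and> u \<otimes> t = t \<otimes> u)"
    and fin: "finite (par {s, t})" "finite (par {t, u})" "finite (par {s, u})"
begin

lemma ne: "s \<noteq> t" using st by auto

lemma subs: "{s, t} \<subseteq> S" "{t, u} \<subseteq> S" "{s, u} \<subseteq> S" using s t u by auto

lemma letter_out: "u \<notin> par {s, t}" "s \<notin> par {t, u}" "t \<notin> par {s, u}"
  using S_par[OF subs(1) u] S_par[OF subs(2) s] S_par[OF subs(3) t] us ut ne by auto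

lemma sts_out: "s \<otimes> (t \<otimes> s) \<notin> par {t, u}"
proof
  assume "s \<otimes> (t \<otimes> s) \<in> par {t, u}"
  then have "ev [s, t, s] \<in> par {t, u}" using s t by simp
  moreover have "length [s, t, s] = len (ev [s, t, s])" using sts_reduced[OF s t st] s t by (simp add: m_assoc)
  ultimately have "set [s, t, s] \<subseteq> {t, u}" using par_reduced_set[OF subs(2), of "[s, t, s]"] s t by simp
  then show False using us ne by auto
qed

text \<open>Applied to short words between two letters \<open>u\<close>: by \<open>nc\<close>, the
  letter \<open>u\<close> fails to commute with one of \<open>s\<close> and \<open>t\<close>, which
  keeps \<open>u s t u\<close> and \<open>u s t s u\<close> outside \<open>par {s, t}\<close>, and
  \<open>u s u\<close> as well unless \<open>u\<close> commutes with \<open>s\<close>.\<close>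

lemma conj_out:
  assumes "ws \<in> lists {s, t}" "length ws = len (ev ws)" "u \<otimes> (ev ws \<otimes> u) \<in> par {s, t}"
  shows "\<forall>a\<in>set ws. u \<otimes> a = a \<otimes> u"
proof -
  have w: "ev ws \<in> carrier W" using assms(1) s t by (intro ev_closed) auto
  show ?thesis
    using par_conj_commute[OF subs(1) u _ u assms(1,2)] assms(3) us ut w u by (simp add: m_assoc)
qed

lemma usu: "u \<otimes> (s \<otimes> u) \<in> par {s, t} \<Longrightarrow> u \<otimes> s = s \<otimes> u"
  using conj_out[of "[s]"] s by simp

lemma ustu: "u \<otimes> (s \<otimes> (t \<otimes> u)) \<notin> par {s, t}"
proof
  assume a: "u \<otimes> (s \<otimes> (t \<otimes> u)) \<in> par {s, t}"
  have "len (s \<otimes> t) = 2" using par_len_up[of "{t}" s t] s t ne par_incl by simp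
  then have "\<forall>a\<in>set [s, t]. u \<otimes> a = a \<otimes> u" using conj_out[of "[s, t]"] a s t u by (simp add: m_assoc)
  then show False using nc by simp
qed

lemma ustsu: "u \<otimes> (s \<otimes> (t \<otimes> (s \<otimes> u))) \<notin> par {s, t}"
proof
  assume a: "u \<otimes> (s \<otimes> (t \<otimes> (s \<otimes> u))) \<in> par {s, t}"
  have "len (s \<otimes> (t \<otimes> s)) = 3" using sts_reduced[OF s t st] s t by (simp add: m_assoc)
  then have "\<forall>a\<in>set [s, t, s]. u \<otimes> a = a \<otimes> u" using conj_out[of "[s, t, s]"] a s t u by (simp add: m_assoc)
  then show False using nc by simp
qed

end

text \<open>
  The residue of \<open>y\<close> is projected to that of \<open>z'\<close>, then to those of \<open>c\<close> and \<open>z''\<close>, and back to that of \<open>y\<close>.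
  The chambers \<open>z'\<close> and \<open>z''\<close> are joined by a gallery of type \<open>(u, s, t, s, u)\<close> whose middle step, invisible
  from the \<open>{s, u}\<close>-residue of \<open>c\<close>, carries \<open>x'\<close> to \<open>x''\<close>.
\<close>
locale self_projectivity = three_letters +
  fixes c y x x' x'' z' z1 z2 w2 w1 z''
  assumes pos: "c \<in> \<Delta> \<epsilon>" "y \<in> \<Delta> \<epsilon>" "x \<in> \<Delta> \<epsilon>" "x' \<in> \<Delta> \<epsilon>" "x'' \<in> \<Delta> \<epsilon>"
    and cy: "\<delta> c y = u" and yx: "\<delta> y x = s" and xx: "\<delta> x x' = t" "\<delta> x x'' = t"
    and neg: "z' \<in> \<Delta> (\<not> \<epsilon>)" "z1 \<in> \<Delta> (\<not> \<epsilon>)" "z2 \<in> \<Delta> (\<not> \<epsilon>)" "w2 \<in> \<Delta> (\<not> \<epsilon>)" "w1 \<in> \<Delta> (\<not> \<epsilon>)" "z'' \<in> \<Delta> (\<not> \<epsilon>)"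
    and path: "\<delta> z' z1 = u" "\<delta> z1 z2 = s" "z2 = w2 \<or> \<delta> z2 w2 = t" "\<delta> w2 w1 = s" "\<delta> w1 z'' = u"
    and c_z: "\<delta>s c z' = \<one>" "\<delta>s c z1 = u" "\<delta>s c z2 = s \<otimes> u" "\<delta>s c w2 = s \<otimes> u" "\<delta>s c w1 = u" "\<delta>s c z'' = \<one>"
    and y_z: "\<delta>s y z' = \<one>" "\<delta>s y z'' = \<one>"
    and I_eq: "\<forall>e\<in>\<Delta> \<epsilon>. \<delta> c e \<in> par {s, u} \<longrightarrow> \<delta>s e z' = \<delta>s e z''"
    and x_z: "\<delta>s x z2 = \<one>" "\<delta>s x' z2 = t" "\<delta>s x'' w2 = t"
begin

lemma panel_eq: "a \<in> {s, u} \<Longrightarrow> \<forall>e\<in>\<Delta> \<epsilon>. \<delta> c e = a \<longrightarrow> \<delta>s e z' = \<delta>s e z''"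
  using I_eq par_incl by blast

text \<open>Two chambers of a \<open>J\<close>-residue have codistances to \<open>v\<close> in the
  same coset of \<open>par J\<close>. As those of \<open>c\<close> are known along the path, this
  decides which of the two values offered by \<open>cod_step\<close> occurs for
  \<open>\<tau>\<close>.\<close>

lemma coset:
  assumes J: "J \<subseteq> S" and tau: "\<tau> \<in> \<Delta> \<epsilon>" "\<delta> c \<tau> \<in> par J" and v: "v \<in> \<Delta> (\<not> \<epsilon>)"
  shows "inv (\<delta>s c v) \<otimes> \<delta>s \<tau> v \<in> par J"
proof -
  obtain g where g: "g \<in> par J" "\<delta>s \<tau> v = \<delta>s c v \<otimes> g" using cod_coset_left[OF J pos(1) tau(1) v tau(2)] .
  have "inv (\<delta>s c v) \<otimes> \<delta>s \<tau> v = g"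
    using g par_carrier[OF J g(1)] pos(1) v by (simp add: m_assoc[symmetric])
  then show ?thesis using g by simp
qed

text \<open>The codistance from \<open>\<tau>\<close> is followed along the path. After the first
  step, \<open>coset\<close> excludes all but one value each time, until the last step leaves two
  candidates, which \<open>proj_adjacent_contradiction\<close> tells apart.\<close>

lemma proj_tu:
  assumes tau: "\<tau> \<in> \<Delta> \<epsilon>" "\<delta> c \<tau> \<in> par {t, u}" "\<delta>s \<tau> z' = longest {t, u}"
  shows "\<delta>s \<tau> z'' = longest {t, u}"
proof -
  let ?w = "longest {t, u}" and ?J = "{t, u}"
  note J = subs(2) and F = fin(2)
  have w: "?w \<in> carrier W" using longest_carrier[OF J F] .
  have wp: "?w \<in> par ?J" using longest(1)[OF F] .
  have up: "u \<in> par ?J" by (rule par_incl) simp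
  have uw: "u \<otimes> ?w \<in> par ?J" by (rule par_mult[OF up wp])
  have strip: "g \<in> par ?J" if "u \<otimes> (g \<otimes> (u \<otimes> ?w)) \<in> par ?J" "g \<in> carrier W" for g
  proof -
    have "g \<otimes> (u \<otimes> ?w) \<in> par ?J" using par_mult_left[OF J up, of "g \<otimes> (u \<otimes> ?w)"] that w u by simp
    then show ?thesis using par_mult_right[OF J uw that(2)] by simp
  qed
  have c1: "u \<otimes> \<delta>s \<tau> w1 \<in> par ?J" using coset[OF J tau(1,2) neg(5)] c_z u by simp
  have c2: "u \<otimes> (s \<otimes> \<delta>s \<tau> z2) \<in> par ?J" "u \<otimes> (s \<otimes> \<delta>s \<tau> w2) \<in> par ?J"
    using coset[OF J tau(1,2) neg(3)] coset[OF J tau(1,2) neg(4)] c_z u s neg tau by (auto simp: inv_mult_group m_assoc)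
  have f1: "\<delta>s \<tau> z1 = u \<otimes> ?w"
    using cod_proj[OF J F tau(1) neg(1,2) tau(3)] half.adj_sym[OF neg(1,2) path(1) u] path(1) up by simp
  have f2: "\<delta>s \<tau> z2 = s \<otimes> (u \<otimes> ?w)"
    using cod_step[OF tau(1) neg(2,3) s path(2)] f1 c2(1) strip[of s] letter_out(2) s by auto
  have f3: "\<delta>s \<tau> w2 = s \<otimes> (u \<otimes> ?w)"
  proof (cases "z2 = w2")
    case False
    then have "\<delta>s \<tau> w2 = \<delta>s \<tau> z2 \<or> \<delta>s \<tau> w2 = t \<otimes> \<delta>s \<tau> z2" using cod_step[OF tau(1) neg(3,4) t] path(3) by auto
    moreover have "\<delta>s \<tau> w2 \<noteq> t \<otimes> \<delta>s \<tau> z2"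
      using c2(2) f2 strip[of "s \<otimes> (t \<otimes> s)"] sts_out s t u w by (auto simp: m_assoc)
    ultimately show ?thesis using f2 by auto
  qed (use f2 in simp)
  have f4: "\<delta>s \<tau> w1 = u \<otimes> ?w"
    using cod_step[OF tau(1) neg(4,5) s path(4)] f3 c1 strip[of s] letter_out(2) s u w by auto
  have "\<delta>s \<tau> z'' = u \<otimes> ?w \<or> \<delta>s \<tau> z'' = ?w"
    using cod_step[OF tau(1) neg(5,6) u path(5)] f4 u w by auto
  moreover have "\<delta>s \<tau> z'' \<noteq> u \<otimes> ?w"
    using proj_adjacent_contradiction[OF J F pos(1) tau(1) neg(1,6) tau(2) c_z(1,6) tau(3), of u] panel_eq[of u] by auto
  ultimately show ?thesis by blast
qed

text \<open>Now \<open>s\<close> is a letter of the residue, so cosets no longer decide the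
  \<open>s\<close>-steps. A deviation at \<open>w1\<close> forces \<open>u\<close> and
  \<open>s\<close> to commute and gives \<open>z''\<close> the codistance
  \<open>s \<otimes> ?w\<close>, which \<open>proj_adjacent_contradiction\<close> excludes.\<close>

lemma proj_st:
  assumes tau: "\<tau> \<in> \<Delta> \<epsilon>" "\<delta> c \<tau> \<in> par {s, t}" "\<delta>s \<tau> z' = longest {s, t}"
  shows "\<delta>s \<tau> z'' = longest {s, t}"
proof -
  let ?w = "longest {s, t}" and ?J = "{s, t}"
  note J = subs(1) and F = fin(1)
  have w: "?w \<in> carrier W" using longest_carrier[OF J F] .
  have wp: "?w \<in> par ?J" using longest(1)[OF F] .
  have strip: "g \<in> par ?J" if "g \<otimes> ?w \<in> par ?J" "g \<in> carrier W" for g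
    using par_mult_right[OF J wp that(2)] that(1) by simp
  have c0: "\<delta>s \<tau> z'' \<in> par ?J" using coset[OF J tau(1,2) neg(6)] c_z tau neg by simp
  have c1: "u \<otimes> \<delta>s \<tau> z1 \<in> par ?J" "u \<otimes> \<delta>s \<tau> w1 \<in> par ?J"
    using coset[OF J tau(1,2) neg(2)] coset[OF J tau(1,2) neg(5)] c_z u by auto
  have c2: "u \<otimes> (s \<otimes> \<delta>s \<tau> z2) \<in> par ?J" "u \<otimes> (s \<otimes> \<delta>s \<tau> w2) \<in> par ?J"
    using coset[OF J tau(1,2) neg(3)] coset[OF J tau(1,2) neg(4)] c_z u s neg tau by (auto simp: inv_mult_group m_assoc)
  have f1: "\<delta>s \<tau> z1 = u \<otimes> ?w"
    using cod_step[OF tau(1) neg(1,2) u path(1)] tau(3) c1(1) strip[of u] letter_out(1) u by auto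
  have f2: "\<delta>s \<tau> z2 = u \<otimes> ?w \<or> \<delta>s \<tau> z2 = s \<otimes> (u \<otimes> ?w)"
    using cod_step[OF tau(1) neg(2,3) s path(2)] f1 by auto
  have f3: "\<delta>s \<tau> w2 = \<delta>s \<tau> z2"
  proof (cases "z2 = w2")
    case False
    then have "\<delta>s \<tau> w2 = \<delta>s \<tau> z2 \<or> \<delta>s \<tau> w2 = t \<otimes> \<delta>s \<tau> z2" using cod_step[OF tau(1) neg(3,4) t] path(3) by auto
    moreover have "\<delta>s \<tau> w2 \<noteq> t \<otimes> (u \<otimes> ?w)"
      using c2(2) strip[of "u \<otimes> (s \<otimes> (t \<otimes> u))"] ustu s t u w by (auto simp: m_assoc)
    moreover have "\<delta>s \<tau> w2 \<noteq> t \<otimes> (s \<otimes> (u \<otimes> ?w))"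
      using c2(2) strip[of "u \<otimes> (s \<otimes> (t \<otimes> (s \<otimes> u)))"] ustsu s t u w by (auto simp: m_assoc)
    ultimately show ?thesis using f2 by auto
  qed simp
  have f4: "\<delta>s \<tau> w1 = u \<otimes> ?w \<or> \<delta>s \<tau> w1 = s \<otimes> (u \<otimes> ?w)"
    using cod_step[OF tau(1) neg(4,5) s path(4)] f3 f2 s u w by auto
  have uw: "u \<otimes> ?w \<notin> par ?J" using strip[of u] letter_out(1) u by auto
  have z'': "\<delta>s \<tau> z'' = \<delta>s \<tau> w1 \<or> \<delta>s \<tau> z'' = u \<otimes> \<delta>s \<tau> w1" using cod_step[OF tau(1) neg(5,6) u path(5)] .
  show ?thesis
  proof (cases "\<delta>s \<tau> w1 = u \<otimes> ?w")
    case True then show ?thesis using z'' c0 uw u w by auto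
  next
    case False
    then have f: "\<delta>s \<tau> w1 = s \<otimes> (u \<otimes> ?w)" using f4 by simp
    have com: "u \<otimes> s = s \<otimes> u"
      using c1(2) f strip[of "u \<otimes> (s \<otimes> u)"] usu s u w by (simp add: m_assoc)
    have "s \<otimes> (u \<otimes> ?w) \<notin> par ?J"
      using par_mult_left[OF J par_incl, of s "u \<otimes> ?w"] uw u w by simp
    then have "\<delta>s \<tau> z'' = u \<otimes> (s \<otimes> (u \<otimes> ?w))" using z'' f c0 by auto
    also have "\<dots> = (u \<otimes> s) \<otimes> (u \<otimes> ?w)" using s u w by (simp add: m_assoc)
    also have "\<dots> = s \<otimes> ?w" unfolding com using s u w by (simp add: m_assoc)
    finally have "\<delta>s \<tau> z'' = s \<otimes> ?w" .
    then show ?thesis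
      using proj_adjacent_contradiction[OF J F pos(1) tau(1) neg(1,6) tau(2) c_z(1,6) tau(3), of s] panel_eq[of s] by auto
  qed
qed

lemma opp_par: "\<delta>s y z' \<in> par J" "\<delta>s y z'' \<in> par J" "\<delta>s c z' \<in> par J" "\<delta>s c z'' \<in> par J"
  using y_z c_z by auto

lemma cod_c_y:
  assumes "Z \<in> \<Delta> (\<not> \<epsilon>)" "\<delta>s y Z \<in> par {s, t}" "\<delta>s c Z \<in> par {s, t}"
  shows "\<delta>s c Z = \<delta>s y Z"
  using cod_step_left[OF pos(1,2) assms(1) u cy] par_mult_left[OF subs(1) assms(3), of u] assms(2) u letter_out(1) by auto

text \<open>\<open>c\<close> and \<open>y\<close> are \<open>u\<close>-adjacent and \<open>u\<close>
  is outside \<open>par {s, t}\<close>, so their codistances to the opposite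
  \<open>{s, t}\<close>-residue agree.\<close>

lemma psp_y:
  assumes z: "z \<in> {z', z''}" shows "psp \<epsilon> {s, t} z c y = c"
proof -
  have h: "z \<in> \<Delta> (\<not> \<epsilon>)" "\<delta>s y z \<in> par {s, t}" "\<delta>s c z \<in> par {s, t}" using z neg opp_par by auto
  show ?thesis
  proof (rule psp(3)[OF subs(1) fin(1) pos(2,1) h half.res_self[OF pos(2)] half.res_self[OF pos(1)]], rule ballI)
    fix Z assume Z: "Z \<in> half.res (\<not> \<epsilon>) {s, t} z"
    have "\<delta>s y Z \<in> par {s, t}" by (rule cod_opp_res[OF subs(1) fin(1) pos(2) h(1,2) half.res_self[OF pos(2)] Z])
    moreover have "\<delta>s c Z \<in> par {s, t}" by (rule cod_opp_res[OF subs(1) fin(1) pos(1) h(1,3) half.res_self[OF pos(1)] Z])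
    ultimately show "\<delta>s c Z = \<delta>s y Z" using cod_c_y Z by (simp add: half.res_def)
  qed
qed

lemma proj_iu:
  assumes "i \<in> {s, t}" "\<tau> \<in> \<Delta> \<epsilon>" "\<delta> c \<tau> \<in> par {i, u}" "\<delta>s \<tau> z' = longest {i, u}"
  shows "\<delta>s \<tau> z'' = longest {i, u}"
  using assms proj_tu I_eq by auto

text \<open>\<open>z'\<close> and \<open>z''\<close> have the same projection \<open>\<tau>\<close>
  to the \<open>{i, u}\<close>-residue of \<open>c\<close>. Projecting \<open>Z\<close> there and
  back towards \<open>z'\<close> yields a chamber placed relative to \<open>z'\<close> as
  \<open>Z\<close> is to \<open>z''\<close>, by \<open>proj_isometry\<close>.\<close>

lemma panel_transfer:
  assumes i: "i \<in> {s, t}" and Z: "Z \<in> \<Delta> (\<not> \<epsilon>)" "\<delta> z'' Z \<in> par {i}"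
  obtains Z' where "Z' \<in> \<Delta> (\<not> \<epsilon>)" "\<delta> z' Z' \<in> par {i}" "\<forall>e\<in>\<Delta> \<epsilon>. \<delta> c e \<in> par {i, u} \<longrightarrow> \<delta>s e Z' = \<delta>s e Z"
proof -
  let ?L = "{i, u}"
  have L: "?L \<subseteq> S" "finite (par ?L)" using i s t u fin by auto
  have nn: "c \<in> \<Delta> (\<not> \<not> \<epsilon>)" using pos by simp
  have ZL: "\<delta> z'' Z \<in> par ?L" by (rule par_mono[OF _ Z(2)]) simp
  obtain \<tau> where \<tau>0: "\<tau> \<in> \<Delta> (\<not> \<not> \<epsilon>)" "\<delta> c \<tau> \<in> par ?L" "\<delta>s z' \<tau> = longest ?L"
    using proj_exists[OF L neg(1) nn] Tw1[OF pos(1) neg(1)] c_z(1) by auto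
  have \<tau>: "\<tau> \<in> \<Delta> \<epsilon>" "\<delta>s \<tau> z' = longest ?L" using \<tau>0 proj_sym[OF L neg(1), of \<tau>] by auto
  have \<tau>'': "\<delta>s \<tau> z'' = longest ?L" using proj_iu[OF i \<tau>(1) \<tau>0(2) \<tau>(2)] .
  have cZ: "\<delta>s c Z \<in> par ?L" using cod_par_iff[OF L(1) pos(1) neg(6) Z(1) ZL] c_z by simp
  then have Zc: "\<delta>s Z c \<in> par ?L" using cod_par_sym[OF L(1) pos(1) Z(1)] by simp
  obtain \<sigma> where \<sigma>0: "\<sigma> \<in> \<Delta> (\<not> \<not> \<epsilon>)" "\<delta> c \<sigma> \<in> par ?L" "\<delta>s Z \<sigma> = longest ?L"
    using proj_exists[OF L Z(1) nn Zc] .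
  have \<sigma>: "\<sigma> \<in> \<Delta> \<epsilon>" "\<delta>s \<sigma> Z = longest ?L" using \<sigma>0 proj_sym[OF L Z(1), of \<sigma>] by auto
  have "\<delta>s \<sigma> z' \<in> par ?L" using cod_par_iff_left[OF L(1) pos(1) \<sigma>(1) neg(1) \<sigma>0(2)] c_z by simp
  then obtain Z' where Z': "Z' \<in> \<Delta> (\<not> \<epsilon>)" "\<delta> z' Z' \<in> par ?L" "\<delta>s \<sigma> Z' = longest ?L"
    using proj_exists[OF L \<sigma>(1) neg(1)] by blast
  have \<tau>\<sigma>: "\<delta> \<tau> \<sigma> \<in> par ?L"
    by (rule half.par_trans[OF L(1) \<tau>(1) pos(1) \<sigma>(1) half.par_sym[OF L(1) pos(1) \<tau>(1) \<tau>0(2)] \<sigma>0(2)])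
  have "\<delta> z' Z' = \<delta> z'' Z"
    using proj_isometry[OF L \<tau>(1) \<sigma>(1) neg(1) Z'(1) \<tau>\<sigma> Z'(2) \<tau>(2) Z'(3)]
      proj_isometry[OF L \<tau>(1) \<sigma>(1) neg(6) Z(1) \<tau>\<sigma> ZL \<tau>'' \<sigma>(2)] by simp
  moreover have "\<delta>s e Z' = \<delta>s e Z" if e: "e \<in> \<Delta> \<epsilon>" "\<delta> c e \<in> par ?L" for e
    by (rule cod_same_proj[OF L \<sigma>(1) e(1) Z'(1) Z(1) Z'(3) \<sigma>(2)])
      (rule half.par_trans[OF L(1) \<sigma>(1) pos(1) e(1) half.par_sym[OF L(1) pos(1) \<sigma>(1) \<sigma>0(2)] e(2)])
  ultimately show thesis using that[OF Z'(1)] Z(2) by simp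
qed

text \<open>\<open>X\<close> and both images lie in the \<open>{i, u}\<close>-residue of
  \<open>c\<close>, from which a chamber \<open>Z\<close> of the \<open>i\<close>-panel of
  \<open>z''\<close> and its transfer \<open>Z'\<close> look alike. Hence the images have equal
  codistances to that panel, and both are the projection of one chamber of it.\<close>

lemma psp_panel:
  assumes i: "i \<in> {s, t}" and X: "X \<in> half.res \<epsilon> {i} y"
  shows "psp \<epsilon> {s, t} z' c X = psp \<epsilon> {s, t} z'' c X"
proof -
  note K = subs(1) fin(1)
  note P' = pos(2,1) neg(1) opp_par(1,3)[of "{s, t}"] and P'' = pos(2,1) neg(6) opp_par(2,4)[of "{s, t}"]
  let ?a = "psp \<epsilon> {s, t} z' c X" and ?b = "psp \<epsilon> {s, t} z'' c X"
  have iS: "i \<in> S" "{i} \<subseteq> S" "finite (par {i})" "{i, u} \<subseteq> S" using i s t u par_singleton[of i] by auto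
  have Xh: "X \<in> \<Delta> \<epsilon>" "\<delta> y X \<in> par {i}" using X by (auto simp: half.res_def)
  have XK: "X \<in> half.res \<epsilon> {s, t} y" using Xh par_mono[of "{i}" "{s, t}"] i by (auto simp: half.res_def)
  have yK: "y \<in> half.res \<epsilon> {s, t} y" using half.res_self pos by blast
  note a = psp(1)[OF K P' XK] and b = psp(1)[OF K P'' XK]
  have ah: "?a \<in> \<Delta> \<epsilon>" "?b \<in> \<Delta> \<epsilon>" using a b by (auto simp: half.res_def)
  have ca: "\<delta> c ?a \<in> par {i}" "\<delta> c ?b \<in> par {i}"
    using psp_isometry[OF K P' yK XK] psp_isometry[OF K P'' yK XK] psp_y Xh by auto
  have cX: "\<delta> c X \<in> par {i, u}"
  proof (rule half.par_trans[OF iS(4) pos(1,2) Xh(1)])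
    show "\<delta> c y \<in> par {i, u}" using cy par_incl by simp
    show "\<delta> y X \<in> par {i, u}" by (rule par_mono[OF _ Xh(2)]) simp
  qed
  have ca': "\<delta> c ?a \<in> par {i, u}" by (rule par_mono[OF _ ca(1)]) simp
  have eq: "\<delta>s ?a Z = \<delta>s ?b Z" if Z: "Z \<in> \<Delta> (\<not> \<epsilon>)" "\<delta> z'' Z \<in> par {i}" for Z
  proof -
    obtain Z' where Z': "Z' \<in> \<Delta> (\<not> \<epsilon>)" "\<delta> z' Z' \<in> par {i}" "\<forall>e\<in>\<Delta> \<epsilon>. \<delta> c e \<in> par {i, u} \<longrightarrow> \<delta>s e Z' = \<delta>s e Z"
      using panel_transfer[OF i Z] .
    have "Z' \<in> half.res (\<not> \<epsilon>) {s, t} z'" "Z \<in> half.res (\<not> \<epsilon>) {s, t} z''"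
      using Z Z' par_mono[of "{i}" "{s, t}"] i by (auto simp: half.res_def)
    then have "\<delta>s ?a Z' = \<delta>s X Z'" "\<delta>s ?b Z = \<delta>s X Z"
      using psp(2)[OF K P' XK] psp(2)[OF K P'' XK] by auto
    moreover have "\<delta>s ?a Z' = \<delta>s ?a Z" "\<delta>s X Z' = \<delta>s X Z" using Z'(3) ah ca' Xh cX by auto
    ultimately show ?thesis by simp
  qed
  have "\<delta>s ?a z'' \<in> par {i}" using cod_par_iff_left[OF iS(2) pos(1) ah(1) neg(6) ca(1)] c_z by simp
  then obtain Z where Z: "Z \<in> \<Delta> (\<not> \<epsilon>)" "\<delta> z'' Z \<in> par {i}" "\<delta>s ?a Z = longest {i}"
    using proj_exists[OF iS(2,3) ah(1) neg(6)] by blast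
  have Z2: "\<delta>s Z ?a = longest {i}" "\<delta>s Z ?b = longest {i}"
    using eq[OF Z(1,2)] Z(3) proj_sym[OF iS(2,3) ah(1) Z(1)] proj_sym[OF iS(2,3) ah(2) Z(1)] by auto
  have "\<delta> ?a ?b \<in> par {i}"
    by (rule half.par_trans[OF iS(2) ah(1) pos(1) ah(2) half.par_sym[OF iS(2) pos(1) ah(1) ca(1)] ca(2)])
  then show ?thesis using proj_unique[OF iS(2,3) Z(1), of ?a ?b] ah Z2 by simp
qed

lemma st_eq: "e \<in> half.res \<epsilon> {s, t} c \<Longrightarrow> \<delta>s e z' = \<delta>s e z''"
proof -
  assume "e \<in> half.res \<epsilon> {s, t} c"
  then have e: "e \<in> \<Delta> \<epsilon>" "\<delta> c e \<in> par {s, t}" by (auto simp: half.res_def)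
  note K = subs(1) fin(1)
  have nn: "c \<in> \<Delta> (\<not> \<not> \<epsilon>)" using pos by simp
  obtain \<tau> where \<tau>0: "\<tau> \<in> \<Delta> (\<not> \<not> \<epsilon>)" "\<delta> c \<tau> \<in> par {s, t}" "\<delta>s z' \<tau> = longest {s, t}"
    using proj_exists[OF K neg(1) nn] Tw1[OF pos(1) neg(1)] c_z(1) by auto
  have \<tau>: "\<tau> \<in> \<Delta> \<epsilon>" "\<delta>s \<tau> z' = longest {s, t}" using \<tau>0 proj_sym[OF K neg(1), of \<tau>] by auto
  show ?thesis
    by (rule cod_same_proj[OF K \<tau>(1) e(1) neg(1,6) \<tau>(2) proj_st[OF \<tau>(1) \<tau>0(2) \<tau>(2)]])
      (rule half.par_trans[OF K(1) \<tau>(1) pos(1) e(1) half.par_sym[OF K(1) pos(1) \<tau>(1) \<tau>0(2)] e(2)])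
qed

text \<open>Both images are \<open>t\<close>-adjacent to the common image of \<open>x\<close>. The
  \<open>t\<close> occurring at \<open>z2\<close> and \<open>w2\<close> keeps their codistances to
  \<open>z''\<close> out of \<open>par {s, u}\<close>, so both equal \<open>?v \<otimes> t\<close>,
  the longer value on this panel, which only one chamber attains.\<close>

lemma psp_x: "psp \<epsilon> {s, t} z' c x' = psp \<epsilon> {s, t} z'' c x''"
proof -
  note K = subs(1) fin(1) and I = subs(3)
  note P' = pos(2,1) neg(1) opp_par(1,3)[of "{s, t}"] and P'' = pos(2,1) neg(6) opp_par(2,4)[of "{s, t}"]
  let ?a = "psp \<epsilon> {s, t} z' c x'" and ?b = "psp \<epsilon> {s, t} z'' c x''" and ?x = "psp \<epsilon> {s, t} z'' c x"
  have yxs: "\<delta> y x \<in> par {s}" using yx par_incl by simp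
  then have xs: "x \<in> half.res \<epsilon> {s} y" using pos by (simp add: half.res_def)
  have stp: "s \<in> par {s, t}" "t \<in> par {s, t}" by (rule par_incl; simp)+
  have xK: "x \<in> half.res \<epsilon> {s, t} y" using pos yx stp by (simp add: half.res_def)
  have yx': "\<delta> y x' \<in> par {s, t}" "\<delta> y x'' \<in> par {s, t}"
    using half.par_trans[OF K(1) pos(2,3,4)] half.par_trans[OF K(1) pos(2,3,5)] yx xx stp by simp_all
  then have x'K: "x' \<in> half.res \<epsilon> {s, t} y" "x'' \<in> half.res \<epsilon> {s, t} y" using pos by (simp_all add: half.res_def)
  have xe: "psp \<epsilon> {s, t} z' c x = ?x" using psp_panel[OF _ xs] by simp
  note r = psp(1)[OF K P' x'K(1)] psp(1)[OF K P'' x'K(2)] psp(1)[OF K P'' xK]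
  have h: "?a \<in> \<Delta> \<epsilon>" "?b \<in> \<Delta> \<epsilon>" "?x \<in> \<Delta> \<epsilon>" using r by (auto simp: half.res_def)
  have d: "\<delta> ?x ?a = t" "\<delta> ?x ?b = t"
    using psp_isometry[OF K P' xK x'K(1)] psp_isometry[OF K P'' xK x'K(2)] xe xx by auto
  have sp: "s \<in> par {s, u}" "u \<in> par {s, u}" by (rule par_incl; simp)+
  have cx: "\<delta> c x \<in> par {s, u}" by (rule half.par_trans[OF I pos(1,2,3)]) (simp_all add: cy yx sp)
  have zz: "\<delta> z2 z' \<in> par {s, u}"
    by (rule half.par_sym[OF I neg(1,3)], rule half.par_trans[OF I neg(1,2,3)]) (simp_all add: path sp)
  have ww: "\<delta> w2 z'' \<in> par {s, u}" by (rule half.par_trans[OF I neg(4,5,6)]) (simp_all add: path sp)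
  let ?v = "\<delta>s ?x z''"
  have "?v = \<delta>s x z''" using psp(2)[OF K P'' xK] half.res_self[OF neg(6)] by blast
  also have "\<dots> = \<delta>s x z'" using I_eq pos(3) cx by simp
  finally have v: "?v \<in> par {s, u}" using cod_par_iff[OF I pos(3) neg(3,1) zz] x_z by simp
  have vc: "?v \<in> carrier W" using h neg by simp
  have out: "g \<otimes> t \<notin> par {s, u}" if "g \<in> par {s, u}" for g
    using par_mult_left[OF I that, of t] t letter_out(3) by simp
  obtain g where g: "g \<in> par {s, u}" "\<delta>s x' z' = g \<otimes> \<delta>s x' z2" using cod_coset[OF I pos(4) neg(3,1) zz] .
  have "\<delta>s ?a z'' = \<delta>s x' z'" using st_eq[OF r(1)] psp(2)[OF K P' x'K(1)] half.res_self[OF neg(1)] by simp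
  then have "\<delta>s ?a z'' \<noteq> ?v" using g x_z out[OF g(1)] v by auto
  then have a: "\<delta>s ?a z'' = ?v \<otimes> t" using cod_step_left[OF h(3,1) neg(6) t d(1)] by blast
  obtain g' where g': "g' \<in> par {s, u}" "\<delta>s x'' z'' = g' \<otimes> \<delta>s x'' w2" using cod_coset[OF I pos(5) neg(4,6) ww] .
  have "\<delta>s ?b z'' = \<delta>s x'' z''" using psp(2)[OF K P'' x'K(2)] half.res_self[OF neg(6)] by simp
  then have "\<delta>s ?b z'' \<noteq> ?v" using g' x_z out[OF g'(1)] v by auto
  then have b: "\<delta>s ?b z'' = ?v \<otimes> t" using cod_step_left[OF h(3,2) neg(6) t d(2)] by blast
  have l: "len (?v \<otimes> t) = len ?v + 1" by (rule par_len_up_right[OF I t _ v]) (use ut ne in auto)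
  show ?thesis
  proof (rule ccontr)
    assume "?a \<noteq> ?b"
    then have "\<delta> ?a ?b = t" using half.adj_trans[OF t h(1,3,2) half.adj_sym[OF h(3,1) d(1) t] d(2)] by simp
    then have "\<delta>s ?b z'' = ?v \<otimes> t \<otimes> t" using cod_down_left[OF h(1,2) neg(6) t] a l t vc by simp
    then show False using b l t vc by simp
  qed
qed

text \<open>The map goes to the residue of \<open>c\<close> by \<open>z'\<close> and returns by
  \<open>z''\<close>, so the agreements in \<open>psp_panel\<close> and \<open>psp_x\<close> become
  fixed chambers and the value at \<open>x'\<close>.\<close>

lemma local_automorphism:
  obtains \<phi> where "bij_betw \<phi> (half.res \<epsilon> {s, t} y) (half.res \<epsilon> {s, t} y)"
    "\<forall>A\<in>half.res \<epsilon> {s, t} y. \<forall>B\<in>half.res \<epsilon> {s, t} y. \<delta> (\<phi> A) (\<phi> B) = \<delta> A B"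
    "\<forall>X\<in>half.res \<epsilon> {s} y \<union> half.res \<epsilon> {t} y. \<phi> X = X" "\<phi> x' = x''"
proof -
  note K = subs(1) fin(1)
  note P' = pos(2,1) neg(1) opp_par(1,3)[of "{s, t}"] and P'' = pos(2,1) neg(6) opp_par(2,4)[of "{s, t}"]
  note Q' = pos(1,2) neg(1) opp_par(3,1)[of "{s, t}"] and Q'' = pos(1,2) neg(6) opp_par(4,2)[of "{s, t}"]
  let ?R = "half.res \<epsilon> {s, t} y"
  define \<phi> where "\<phi> X = psp \<epsilon> {s, t} z'' y (psp \<epsilon> {s, t} z' c X)" for X
  define \<psi> where "\<psi> X = psp \<epsilon> {s, t} z' y (psp \<epsilon> {s, t} z'' c X)" for X
  have bij: "bij_betw \<phi> ?R ?R"
  proof (rule bij_betw_byWitness[where f' = \<psi>])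
    show "\<forall>a\<in>?R. \<psi> (\<phi> a) = a" unfolding \<phi>_def \<psi>_def
      using psp_inverse[OF K Q'' psp(1)[OF K P']] psp_inverse[OF K P'] by simp
    show "\<forall>a\<in>?R. \<phi> (\<psi> a) = a" unfolding \<phi>_def \<psi>_def
      using psp_inverse[OF K Q' psp(1)[OF K P'']] psp_inverse[OF K P''] by simp
    show "\<phi> ` ?R \<subseteq> ?R" "\<psi> ` ?R \<subseteq> ?R" unfolding \<phi>_def \<psi>_def
      using psp(1)[OF K Q'' psp(1)[OF K P']] psp(1)[OF K Q' psp(1)[OF K P'']] by auto
  qed
  have stp: "s \<in> par {s, t}" "t \<in> par {s, t}" by (rule par_incl; simp)+
  have x'': "x'' \<in> ?R"
    using half.par_trans[OF K(1) pos(2,3,5)] yx xx stp pos by (simp add: half.res_def)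
  have pfix: "\<phi> X = X" if i: "i \<in> {s, t}" and X: "X \<in> half.res \<epsilon> {i} y" for i X
  proof -
    have "X \<in> ?R" using X par_mono[of "{i}" "{s, t}"] i by (auto simp: half.res_def)
    then show ?thesis unfolding \<phi>_def psp_panel[OF i X] by (rule psp_inverse[OF K P''])
  qed
  show thesis
  proof (rule that[of \<phi>])
    show "bij_betw \<phi> ?R ?R" by (rule bij)
    show "\<forall>A\<in>?R. \<forall>B\<in>?R. \<delta> (\<phi> A) (\<phi> B) = \<delta> A B"
      unfolding \<phi>_def using psp_isometry[OF K Q'' psp(1)[OF K P'] psp(1)[OF K P']] psp_isometry[OF K P'] by simp
    show "\<forall>X\<in>half.res \<epsilon> {s} y \<union> half.res \<epsilon> {t} y. \<phi> X = X" using pfix by blast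
    show "\<phi> x' = x''" unfolding \<phi>_def psp_x by (rule psp_inverse[OF K P'' x''])
  qed
qed

end

context three_letters
begin

text \<open>\<open>z\<close> is moved within its \<open>t\<close>-panel to give \<open>X\<close> the
  codistance \<open>t\<close>. The codistances of \<open>y\<close> and \<open>c\<close> survive
  because the values allowed by the step from \<open>z\<close> and by the preceding chamber have
  only one in common.\<close>

lemma adjust:
  assumes pos: "c \<in> \<Delta> \<epsilon>" "y \<in> \<Delta> \<epsilon>" "x \<in> \<Delta> \<epsilon>" "X \<in> \<Delta> \<epsilon>"
    and d: "\<delta> c y = u" "\<delta> y x = s" "\<delta> x X = t" and z: "z \<in> \<Delta> (\<not> \<epsilon>)"
    and cz: "\<delta>s c z = s \<otimes> u" "\<delta>s y z = s" "\<delta>s x z = \<one>"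
  obtains z0 where "z0 \<in> \<Delta> (\<not> \<epsilon>)" "z = z0 \<or> \<delta> z z0 = t" "\<delta>s c z0 = s \<otimes> u" "\<delta>s y z0 = s" "\<delta>s x z0 = \<one>" "\<delta>s X z0 = t"
proof (cases "\<delta>s X z = t")
  case True then show thesis using that[of z] z cz by simp
next
  case False
  then have X: "\<delta>s X z = \<one>" using cod_step_left[OF pos(3,4) z t d(3)] cz t by simp
  obtain E where E: "E \<in> \<Delta> (\<not> \<epsilon>)" "\<delta> z E = t" "\<delta>s X E = t" using Tw3[OF pos(4) z t] X t by auto
  have Ex: "\<delta>s x E = \<one>"
    using cod_down_left[OF pos(4,3) E(1) t half.adj_sym[OF pos(3,4) d(3) t]] E(3) t by simp
  have "\<delta>s y E = \<one> \<or> \<delta>s y E = s"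
    using cod_step_left[OF pos(3,2) E(1) s half.adj_sym[OF pos(2,3) d(2) s]] Ex s by simp
  moreover have "\<delta>s y E = s \<or> \<delta>s y E = t \<otimes> s" using cod_step[OF pos(2) z E(1) t E(2)] cz by simp
  moreover have "t \<otimes> s \<noteq> \<one>" "\<one> \<noteq> s" using ne inv_equality[of t s] s t S_not_one by auto
  ultimately have Ey: "\<delta>s y E = s" by auto
  have "\<delta>s c E = s \<or> \<delta>s c E = s \<otimes> u"
    using cod_step_left[OF pos(2,1) E(1) u half.adj_sym[OF pos(1,2) d(1) u]] Ey by simp
  moreover have "\<delta>s c E = s \<otimes> u \<or> \<delta>s c E = t \<otimes> (s \<otimes> u)" using cod_step[OF pos(1) z E(1) t E(2)] cz by simp
  moreover have "t \<otimes> (s \<otimes> u) \<noteq> s"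
  proof
    assume "t \<otimes> (s \<otimes> u) = s"
    moreover have "s \<otimes> u \<in> par {s, u}" by (intro par_mult par_incl) auto
    then have "len (t \<otimes> (s \<otimes> u)) = len (s \<otimes> u) + 1" using par_len_up[OF subs(3) t] ut ne by auto
    moreover have "len (s \<otimes> u) = 2" using par_len_up[of "{u}" s u] s u us par_incl by simp
    ultimately show False using s by simp
  qed
  ultimately have "\<delta>s c E = s \<otimes> u" by auto
  then show thesis using that[of E] E Ex Ey by simp
qed

text \<open>The configuration of \<open>self_projectivity\<close> is built from the middle outwards:
  \<open>z2\<close> and \<open>w2\<close> are tuned to \<open>x'\<close> and \<open>x''\<close>, the
  chambers \<open>z1\<close> and \<open>z'\<close> continue from \<open>z2\<close>, and their images
  under the perspectivity from the \<open>{s, u}\<close>-residue of \<open>z2\<close> to that of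
  \<open>w2\<close> serve as \<open>w1\<close> and \<open>z''\<close>.\<close>

lemma transitive:
  assumes thick: "\<And>\<epsilon> a C D. a \<in> S \<Longrightarrow> C \<in> \<Delta> \<epsilon> \<Longrightarrow> \<exists>F\<in>\<Delta> \<epsilon>. \<delta> C F = a \<and> F \<noteq> D"
    and pos: "y \<in> \<Delta> \<epsilon>" "x \<in> \<Delta> \<epsilon>" "x' \<in> \<Delta> \<epsilon>" "x'' \<in> \<Delta> \<epsilon>"
    and d: "\<delta> y x = s" "\<delta> x x' = t" "\<delta> x x'' = t"
  obtains \<phi> where "bij_betw \<phi> (half.res \<epsilon> {s, t} y) (half.res \<epsilon> {s, t} y)"
    "\<forall>A\<in>half.res \<epsilon> {s, t} y. \<forall>B\<in>half.res \<epsilon> {s, t} y. \<delta> (\<phi> A) (\<phi> B) = \<delta> A B"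
    "\<forall>X\<in>half.res \<epsilon> {s} y \<union> half.res \<epsilon> {t} y. \<phi> X = X" "\<phi> x' = x''"
proof -
  note I = subs(3) fin(3)
  have sp: "s \<in> par {s, u}" "u \<in> par {s, u}" by (rule par_incl; simp)+
  have su2: "len (s \<otimes> u) = 2" using par_len_up[of "{u}" s u] s u us par_incl by simp
  have sup: "s \<otimes> u \<in> par {s, u}" by (rule par_mult[OF sp])
  obtain c where c0: "c \<in> \<Delta> \<epsilon>" "\<delta> y c = u" using half.adj_exists[OF u pos(1)] .
  have c: "c \<in> \<Delta> \<epsilon>" "\<delta> c y = u" using c0 half.adj_sym[OF pos(1) c0 u] by auto
  have cxy: "\<delta> c y \<in> par {s, u}" using c sp by simp
  \<comment> \<open>The codistance \<open>s \<otimes> u\<close> from \<open>c\<close> drops to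
    \<open>s\<close> at \<open>y\<close> and to \<open>\<one>\<close> at \<open>x\<close>.\<close>
  obtain z0 where z0: "z0 \<in> \<Delta> (\<not> \<epsilon>)" "\<delta>s c z0 = s \<otimes> u"
  proof -
    obtain D where D: "D \<in> \<Delta> (\<not> \<epsilon>)" using half.nonempty by blast
    have "s \<otimes> u \<otimes> inv (\<delta>s c D) \<in> carrier W" using s u c D by simp
    then obtain f where f: "f \<in> lists S" "ev f = s \<otimes> u \<otimes> inv (\<delta>s c D)" using carrier_word by blast
    have "ev f \<otimes> \<delta>s c D = s \<otimes> u" unfolding f(2) using s u c D by (simp add: m_assoc)
    then show thesis using cod_word[OF subset_refl c(1) D f(1)] that by auto
  qed
  have y0: "\<delta>s y z0 = s" using cod_down_left[OF c(1) pos(1) z0(1) u c(2)] z0(2) s u su2 by simp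
  have x0: "\<delta>s x z0 = \<one>" using cod_down_left[OF pos(1,2) z0(1) s d(1)] y0 s by simp
  obtain z2 where z2: "z2 \<in> \<Delta> (\<not> \<epsilon>)" "z0 = z2 \<or> \<delta> z0 z2 = t" "\<delta>s c z2 = s \<otimes> u" "\<delta>s y z2 = s" "\<delta>s x z2 = \<one>" "\<delta>s x' z2 = t"
    using adjust[OF c(1) pos(1,2,3) c(2) d(1,2) z0(1,2) y0 x0] .
  obtain w2 where w2: "w2 \<in> \<Delta> (\<not> \<epsilon>)" "z2 = w2 \<or> \<delta> z2 w2 = t" "\<delta>s c w2 = s \<otimes> u" "\<delta>s y w2 = s" "\<delta>s x w2 = \<one>" "\<delta>s x'' w2 = t"
    using adjust[OF c(1) pos(1,2,4) c(2) d(1,3) z2(1,3,4,5)] .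
  obtain z1 where z1: "z1 \<in> \<Delta> (\<not> \<epsilon>)" "\<delta> z2 z1 = s" using half.adj_exists[OF s z2(1)] .
  have c1: "\<delta>s c z1 = u" using cod_down[OF c(1) z2(1) z1(1) s z1(2)] z2(3) s u su2 by simp
  have y1: "\<delta>s y z1 = \<one>" using cod_down[OF pos(1) z2(1) z1(1) s z1(2)] z2(4) s by simp
  \<comment> \<open>At most one chamber of this \<open>u\<close>-panel has codistance
    \<open>u\<close> from \<open>y\<close>, and thickness leaves another neighbour of
    \<open>z1\<close>.\<close>
  obtain z' where z': "z' \<in> \<Delta> (\<not> \<epsilon>)" "\<delta> z1 z' = u" "\<delta>s y z' = \<one>"
  proof -
    obtain F where F: "F \<in> \<Delta> (\<not> \<epsilon>)" "\<delta> z1 F = u" using half.adj_exists[OF u z1(1)] .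
    show thesis
    proof (cases "\<delta>s y F = \<one>")
      case True then show thesis using that F by blast
    next
      case False
      then have yF: "\<delta>s y F = u" using cod_step[OF pos(1) z1(1) F(1) u F(2)] y1 u by simp
      obtain G where G: "G \<in> \<Delta> (\<not> \<epsilon>)" "\<delta> z1 G = u" "G \<noteq> F" using thick[OF u z1(1), of F] by blast
      have "\<delta> F G = u" using half.adj_trans[OF u F(1) z1(1) G(1) half.adj_sym[OF z1(1) F u] G(2)] G(3) by simp
      then have "\<delta>s y G = \<one>" using cod_down[OF pos(1) F(1) G(1) u] yF u by simp
      then show thesis using that G by blast
    qed
  qed
  have c': "\<delta>s c z' = \<one>" using cod_down[OF c(1) z1(1) z'(1) u z'(2)] c1 u by simp
  have N: "half.res (\<not> \<not> \<epsilon>) {s, u} c = half.res \<epsilon> {s, u} c" by simp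
  have nc: "c \<in> \<Delta> (\<not> \<not> \<epsilon>)" using c by simp
  have op: "\<delta>s z2 c \<in> par {s, u}" "\<delta>s w2 c \<in> par {s, u}"
    using cod_par_sym[OF I(1) c(1) z2(1)] cod_par_sym[OF I(1) c(1) w2(1)] z2(3) w2(3) sup by auto
  define \<psi> where "\<psi> = psp (\<not> \<epsilon>) {s, u} c w2"
  note P = z2(1) w2(1) nc op
  have zr: "z2 \<in> half.res (\<not> \<epsilon>) {s, u} z2" "z1 \<in> half.res (\<not> \<epsilon>) {s, u} z2" "z' \<in> half.res (\<not> \<epsilon>) {s, u} z2"
    using z1 z' z2(1) sp half.par_trans[OF I(1) z2(1) z1(1) z'(1)] by (simp_all add: half.res_def)
  have \<psi>h: "\<psi> Z \<in> \<Delta> (\<not> \<epsilon>)" if "Z \<in> half.res (\<not> \<epsilon>) {s, u} z2" for Z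
    using psp(1)[OF I P that] by (simp add: \<psi>_def half.res_def)
  have \<psi>c: "\<delta>s e (\<psi> Z) = \<delta>s e Z" if Z: "Z \<in> half.res (\<not> \<epsilon>) {s, u} z2" and e: "e \<in> \<Delta> \<epsilon>" "\<delta> c e \<in> par {s, u}" for e Z
  proof -
    have "e \<in> half.res (\<not> \<not> \<epsilon>) {s, u} c" using e by (simp add: half.res_def)
    then have "\<delta>s (\<psi> Z) e = \<delta>s Z e" using psp(2)[OF I P Z] unfolding \<psi>_def by blast
    moreover have "Z \<in> \<Delta> (\<not> \<epsilon>)" using Z by (simp add: half.res_def)
    ultimately show ?thesis using cod_inv[OF e(1) \<psi>h[OF Z]] cod_inv[OF e(1), of Z] by simp
  qed
  \<comment> \<open>\<open>t\<close> is outside \<open>par {s, u}\<close>, so chambers of the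
    \<open>{s, u}\<close>-residue of \<open>c\<close> have the same codistance to \<open>z2\<close>
    and \<open>w2\<close>.\<close>
  have \<psi>2: "\<psi> z2 = w2" unfolding \<psi>_def
  proof (rule psp(3)[OF I P zr(1) half.res_self[OF w2(1)]], rule ballI)
    fix e assume e0: "e \<in> half.res (\<not> \<not> \<epsilon>) {s, u} c"
    then have e: "e \<in> \<Delta> \<epsilon>" "\<delta> c e \<in> par {s, u}" "e \<in> half.res \<epsilon> {s, u} c" by (auto simp: half.res_def)
    have "\<delta>s c z2 \<in> par {s, u}" "\<delta>s c w2 \<in> par {s, u}" using z2(3) w2(3) sup by auto
    then have p: "\<delta>s e z2 \<in> par {s, u}" "\<delta>s e w2 \<in> par {s, u}"
      using cod_par_iff_left[OF I(1) c(1) e(1) z2(1) e(2)] cod_par_iff_left[OF I(1) c(1) e(1) w2(1) e(2)] by auto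
    have "\<delta>s e w2 = \<delta>s e z2"
    proof (cases "z2 = w2")
      case False
      then have "\<delta>s e w2 = \<delta>s e z2 \<or> \<delta>s e w2 = t \<otimes> \<delta>s e z2" using cod_step[OF e(1) z2(1) w2(1) t] w2(2) by simp
      moreover have "t \<otimes> \<delta>s e z2 \<notin> par {s, u}" using par_mult_right[OF I(1) p(1), of t] t letter_out(3) by simp
      ultimately show ?thesis using p by auto
    qed simp
    then show "\<delta>s w2 e = \<delta>s z2 e" using Tw1[OF e(1) w2(1)] Tw1[OF e(1) z2(1)] by simp
  qed
  have \<psi>d: "\<delta> (\<psi> A) (\<psi> B) = \<delta> A B" if "A \<in> half.res (\<not> \<epsilon>) {s, u} z2" "B \<in> half.res (\<not> \<epsilon>) {s, u} z2" for A B
    unfolding \<psi>_def using psp_isometry[OF I P that] .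
  have cc: "\<delta> c c \<in> par {s, u}" using c by simp
  interpret p: self_projectivity W S \<Delta> \<delta> \<delta>s \<epsilon> s t u c y x x' x'' z' z1 z2 w2 "\<psi> z1" "\<psi> z'"
  proof unfold_locales
    show "\<delta> z' z1 = u" "\<delta> z1 z2 = s" using half.adj_sym[OF z1(1) z'(1,2) u] half.adj_sym[OF z2(1) z1 s] .
    show "\<delta> w2 (\<psi> z1) = s" using \<psi>d[OF zr(1,2)] \<psi>2 z1 by simp
    show "\<delta> (\<psi> z1) (\<psi> z') = u" using \<psi>d[OF zr(2,3)] z' by simp
    show "\<delta>s c (\<psi> z1) = u" "\<delta>s c (\<psi> z') = \<one>" using \<psi>c[OF zr(2) c(1) cc] \<psi>c[OF zr(3) c(1) cc] c1 c' by auto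
    show "\<delta>s y (\<psi> z') = \<one>" using \<psi>c[OF zr(3) pos(1) cxy] z' by simp
    show "\<forall>e\<in>\<Delta> \<epsilon>. \<delta> c e \<in> par {s, u} \<longrightarrow> \<delta>s e z' = \<delta>s e (\<psi> z')" using \<psi>c[OF zr(3)] by simp
  qed (use c pos d z1 z2 w2 z' c1 c' \<psi>h[OF zr(2)] \<psi>h[OF zr(3)] in simp_all)
  show thesis using p.local_automorphism that by blast
qed

end

section \<open>Panel sizes and coprime parameters\<close>

locale locally_finite_opposing = residue_opposing +
  assumes sph: "two_spherical W S" and lf: "locally_finite W S \<Delta> \<delta>" and th: "thick W S \<Delta> \<delta>"
begin

lemma finite_par: "s \<in> S \<Longrightarrow> t \<in> S \<Longrightarrow> finite (par {s, t})"
  using sph by (simp add: two_spherical_def)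

lemma panel_residue: "C \<in> \<Delta> \<epsilon> \<Longrightarrow> residue_in W (\<Delta> \<epsilon>) \<delta> {s} (half.res \<epsilon> {s} C)"
  unfolding residue_in_def half.res_def by blast

lemma panel_finite: "s \<in> S \<Longrightarrow> C \<in> \<Delta> \<epsilon> \<Longrightarrow> finite (half.res \<epsilon> {s} C)"
  using lf panel_residue unfolding locally_finite_def by blast

lemma panel_thick: "s \<in> S \<Longrightarrow> C \<in> \<Delta> \<epsilon> \<Longrightarrow> 3 \<le> card (half.res \<epsilon> {s} C)"
  using th panel_residue panel_finite unfolding thick_def by blast

lemma third_chamber:
  assumes "a \<in> S" "C \<in> \<Delta> \<epsilon>"
  shows "\<exists>F\<in>\<Delta> \<epsilon>. \<delta> C F = a \<and> F \<noteq> D"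
proof -
  have "\<not> half.res \<epsilon> {a} C \<subseteq> {C, D}"
  proof
    assume "half.res \<epsilon> {a} C \<subseteq> {C, D}"
    then have "card (half.res \<epsilon> {a} C) \<le> card {C, D}" by (rule card_mono[rotated]) simp
    also have "\<dots> \<le> 2" by (simp add: card_insert_if)
    finally show False using panel_thick[OF assms] by simp
  qed
  then show ?thesis using half.panel_iff[OF assms] by blast
qed

lemma card_opposite_panel:
  assumes s: "s \<in> S" and C: "C \<in> \<Delta> \<epsilon>" and z: "z \<in> \<Delta> (\<not> \<epsilon>)" and o: "\<delta>s C z = \<one>"
  shows "card (half.res \<epsilon> {s} C) \<le> card (half.res (\<not> \<epsilon>) {s} z)"
proof (rule card_inj_on_le)
  have J: "{s} \<subseteq> S" "finite (par {s})" using s par_singleton[OF s] by auto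
  let ?f = "prj {s} (half.res (\<not> \<epsilon>) {s} z)"
  have h: "X \<in> \<Delta> \<epsilon>" "\<delta>s X z \<in> par {s}" if "X \<in> half.res \<epsilon> {s} C" for X
    using cod_opp_res[OF J C z _ that half.res_self[OF z]] o that by (auto simp: half.res_def)
  note p = prj[OF J h(1) z HOL.refl h(2)]
  show "?f ` half.res \<epsilon> {s} C \<subseteq> half.res (\<not> \<epsilon>) {s} z" using p(1) by blast
  show "inj_on ?f (half.res \<epsilon> {s} C)"
  proof (rule inj_onI)
    fix X Y assume X: "X \<in> half.res \<epsilon> {s} C" and Y: "Y \<in> half.res \<epsilon> {s} C" and e: "?f X = ?f Y"
    have fh: "?f X \<in> \<Delta> (\<not> \<epsilon>)" using p(1)[OF X X] by (simp add: half.res_def)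
    have "\<delta>s (?f X) X = longest {s}" "\<delta>s (?f X) Y = longest {s}"
      using p(2)[OF X X] p(2)[OF Y Y] proj_sym[OF J h(1)[OF X] fh] proj_sym[OF J h(1)[OF Y] fh] e by auto
    moreover have "\<delta> X Y \<in> par {s}" using half.res_eq[OF J(1) C X] Y by (auto simp: half.res_def)
    ultimately show "X = Y" using proj_unique[OF J fh, of X Y] h(1)[OF X] h(1)[OF Y] by simp
  qed
  show "finite (half.res (\<not> \<epsilon>) {s} z)" using panel_finite[OF s z] .
qed

lemma card_opposite_panel_eq:
  assumes s: "s \<in> S" and C: "C \<in> \<Delta> \<epsilon>" and z: "z \<in> \<Delta> (\<not> \<epsilon>)" and o: "\<delta>s C z = \<one>"
  shows "card (half.res \<epsilon> {s} C) = card (half.res (\<not> \<epsilon>) {s} z)"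
  using card_opposite_panel[OF assms] card_opposite_panel[OF s z, of C] C Tw1[OF C z] o by simp

text \<open>Opposite panels of one type have equal size, so it suffices that adjacent chambers
  \<open>C\<close> and \<open>D\<close> have a common opposite. If \<open>\<theta> C\<close> does
  not serve, thickness provides one in its panel of the same type as the one joining
  \<open>C\<close> and \<open>D\<close>.\<close>

lemma card_panel:
  assumes s: "s \<in> S" and C: "C \<in> \<Delta> \<epsilon>" and D: "D \<in> \<Delta> \<epsilon>"
  shows "card (half.res \<epsilon> {s} C) = card (half.res \<epsilon> {s} D)"
proof -
  have step: "card (half.res \<epsilon> {s} C) = card (half.res \<epsilon> {s} D)"
    if C: "C \<in> \<Delta> \<epsilon>" and D: "D \<in> \<Delta> \<epsilon>" and a: "a \<in> S" "\<delta> C D = a" for C D a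
  proof -
    let ?z = "\<theta> C"
    have z: "?z \<in> \<Delta> (\<not> \<epsilon>)" "\<delta>s C ?z = \<one>" using theta_half[OF C] cod_theta[OF C] by auto
    have "\<exists>z\<in>\<Delta> (\<not> \<epsilon>). \<delta>s C z = \<one> \<and> \<delta>s D z = \<one>"
    proof (cases "\<delta>s D ?z = \<one>")
      case True then show ?thesis using z by blast
    next
      case False
      then have Dz: "\<delta>s D ?z = a" using cod_step_left[OF C D z(1) a] z a by simp
      obtain F where F: "F \<in> \<Delta> (\<not> \<epsilon>)" "\<delta> ?z F = a" using half.adj_exists[OF a(1) z(1)] .
      have DF: "\<delta>s D F = \<one>" using cod_down[OF D z(1) F(1) a(1) F(2)] Dz a by simp
      show ?thesis
      proof (cases "\<delta>s C F = \<one>")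
        case True then show ?thesis using F DF by blast
      next
        case False
        then have CF: "\<delta>s C F = a" using cod_step[OF C z(1) F(1) a(1) F(2)] z a by simp
        obtain G where G: "G \<in> \<Delta> (\<not> \<epsilon>)" "\<delta> ?z G = a" "G \<noteq> F" using third_chamber[OF a(1) z(1)] by blast
        have FG: "\<delta> F G = a" using half.adj_trans[OF a(1) F(1) z(1) G(1) half.adj_sym[OF z(1) F a(1)] G(2)] G(3) by simp
        have "\<delta>s C G = \<one>" using cod_down[OF C F(1) G(1) a(1) FG] CF a by simp
        moreover have "\<delta>s D G = \<one>" using cod_down[OF D z(1) G(1) a(1) G(2)] Dz a by simp
        ultimately show ?thesis using G by blast
      qed
    qed
    then obtain z' where z': "z' \<in> \<Delta> (\<not> \<epsilon>)" "\<delta>s C z' = \<one>" "\<delta>s D z' = \<one>" by blast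
    then show ?thesis using card_opposite_panel_eq[OF s C z'(1)] card_opposite_panel_eq[OF s D z'(1)] by simp
  qed
  obtain f where f: "f \<in> lists S" "ev f = \<delta> C D" "length f = len (\<delta> C D)" using reduced_word[of "\<delta> C D"] C D by auto
  have "half.gallery \<epsilon> C f D" using half.gallery_exists[OF C D f(1)] f(2) by simp
  then show ?thesis
  proof (induction f arbitrary: C)
    case (Cons a f)
    then obtain E where E: "C \<in> \<Delta> \<epsilon>" "a \<in> S" "E \<in> \<Delta> \<epsilon>" "\<delta> C E = a" "half.gallery \<epsilon> E f D" by auto
    then show ?case using step[OF E(1,3,2,4)] Cons.IH[OF E(5)] by simp
  qed simp
qed

text \<open>A common prime divisor gives all panels of the residue size one modulo \<open>p\<close>.
  The opposing map is \<open>\<theta>\<close> followed by projection back: since \<open>A\<close> is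
  opposite \<open>\<theta> A\<close>, it is at maximal distance from the projection of
  \<open>\<theta> A\<close>.\<close>

lemma coprime_panels:
  assumes i: "i \<in> S" and j: "j \<in> S" and nc: "i \<otimes> j \<noteq> j \<otimes> i" and c0: "c0 \<in> \<Delta> True"
  shows "coprime (card (half.res True {i} c0) - 1) (card (half.res True {j} c0) - 1)"
proof (rule ccontr)
  let ?K = "{i, j}" and ?R = "half.res True {i, j} c0"
  assume "\<not> coprime (card (half.res True {i} c0) - 1) (card (half.res True {j} c0) - 1)"
  then obtain p where p: "prime p" "p dvd card (half.res True {i} c0) - 1" "p dvd card (half.res True {j} c0) - 1"
    using prime_factor_nat[of "gcd (card (half.res True {i} c0) - 1) (card (half.res True {j} c0) - 1)"]
    by (auto simp: coprime_iff_gcd_eq_1)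
  have K: "?K \<subseteq> S" "finite (par ?K)" using i j finite_par by auto
  interpret d: dihedral W S i j by unfold_locales (use i j nc K in auto)
  have panel: "finite (half.res True {k} C) \<and> [card (half.res True {k} C) = 1] (mod p)" if k: "k \<in> ?K" and C: "C \<in> \<Delta> True" for k C
  proof -
    have kS: "k \<in> S" using k i j by auto
    have e: "card (half.res True {k} C) = card (half.res True {k} c0)" using card_panel[OF kS C c0] .
    have "p dvd card (half.res True {k} C) - 1" using k p e by auto
    then obtain n where "card (half.res True {k} C) - 1 = p * n" by (rule dvdE)
    then have "card (half.res True {k} C) = 1 + p * n" using panel_thick[OF kS C] by simp
    then have "[card (half.res True {k} C) = 1] (mod p)" by (simp only: cong_def mod_mult_self2)
    then show ?thesis using panel_finite[OF kS C] by simp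
  qed
  interpret mp: mod_p_residue W S "\<Delta> True" \<delta> i j p c0
    by unfold_locales (use p c0 panel in auto)
  define \<pi> where "\<pi> A = prj ?K ?R (\<theta> A)" for A
  have h: "A \<in> \<Delta> True" "\<theta> A \<in> \<Delta> False" "\<delta>s (\<theta> A) A = \<one>" if "A \<in> ?R" for A
  proof -
    show A: "A \<in> \<Delta> True" using that by (simp add: half.res_def)
    show tA: "\<theta> A \<in> \<Delta> False" using theta_half[OF A] by simp
    show "\<delta>s (\<theta> A) A = \<one>" using cod_inv[of "\<theta> A" False A] cod_theta[OF A] A tA by simp
  qed
  have o: "\<delta>s (\<theta> A) c0 \<in> par ?K" if A: "A \<in> ?R" for A
  proof -
    have "\<delta> A c0 \<in> par ?K" using half.par_sym[OF K(1) c0 h(1)[OF A]] A by (simp add: half.res_def)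
    then show ?thesis using cod_par_iff[OF K(1), of "\<theta> A" False A c0] h[OF A] c0 by simp
  qed
  have tf: "True = (\<not> False)" by simp
  note pr = prj[OF K h(2) c0 tf o, folded \<pi>_def]
  have pR: "\<pi> A \<in> ?R" and pw: "\<delta>s (\<theta> A) (\<pi> A) = longest ?K" if "A \<in> ?R" for A using pr(1,2)[OF that that] by auto
  have rr: "\<delta> A B \<in> par ?K" if "A \<in> ?R" "B \<in> ?R" for A B
    using half.res_eq[OF K(1) c0 that(1)] that(2) by (auto simp: half.res_def)
  have iso: "\<delta> (\<pi> A) (\<pi> B) = longest ?K \<otimes> \<delta> A B \<otimes> longest ?K" if A: "A \<in> ?R" and B: "B \<in> ?R" for A B
  proof -
    have td: "\<delta> (\<theta> A) (\<theta> B) = \<delta> A B" using theta_dist[OF h(1)[OF A] h(1)[OF B]] .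
    have "\<delta> (\<theta> A) (\<theta> B) \<in> par ?K" using td rr[OF A B] by simp
    then show ?thesis
      using proj_isometry[OF K h(2)[OF A] h(2)[OF B], of "\<pi> A" "\<pi> B"] td h(1)[OF pR[OF A]] h(1)[OF pR[OF B]]
        rr[OF pR[OF A] pR[OF B]] pw[OF A] pw[OF B] by simp
  qed
  have opp: "\<delta> A (\<pi> A) = longest ?K" if A: "A \<in> ?R" for A
  proof -
    have "\<one> = \<delta> A (\<pi> A) \<otimes> longest ?K"
      using cod_proj[OF K h(2)[OF A], of "\<pi> A" A] h[OF A] h(1)[OF pR[OF A]] pw[OF A] rr[OF pR[OF A] A] by simp
    then have "inv (longest ?K) = \<delta> A (\<pi> A)"
      using inv_equality[of "\<delta> A (\<pi> A)" "longest ?K"] longest_carrier[OF K] h(1)[OF A] h(1)[OF pR[OF A]] by simp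
    then show ?thesis using longest_inv[OF K] by simp
  qed
  have inj: "inj_on \<pi> ?R"
  proof (rule inj_onI)
    fix A B assume A: "A \<in> ?R" and B: "B \<in> ?R" and e: "\<pi> A = \<pi> B"
    have "longest ?K \<otimes> \<delta> A B \<otimes> longest ?K = longest ?K \<otimes> \<one> \<otimes> longest ?K"
    proof -
      have "longest ?K \<otimes> \<one> \<otimes> longest ?K = \<one>" using longest_carrier[OF K] longest_sq[OF K] by simp
      moreover have "\<delta> (\<pi> A) (\<pi> B) = \<one>" unfolding e by (rule half.dist_self[OF h(1)[OF pR[OF B]]])
      ultimately show ?thesis by (simp only: iso[OF A B])
    qed
    then have "\<delta> A B = \<one>" using longest_carrier[OF K] h(1)[OF A] h(1)[OF B] by auto
    then show "A = B" using half.WD1 h(1)[OF A] h(1)[OF B] by blast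
  qed
  have "\<pi> ` ?R \<subseteq> ?R" using pR by blast
  then have "bij_betw \<pi> ?R ?R" using endo_inj_surj[OF mp.R_finite _ inj] inj by (simp add: bij_betw_def)
  then interpret op: opposing_residue W S "\<Delta> True" \<delta> i j p c0 \<pi>
    by unfold_locales (use iso opp in auto)
  show False by (rule op.contradiction)
qed

end

lemma card_uniform_fibres:
  assumes "finite A" "\<And>a. a \<in> A \<Longrightarrow> card {x \<in> A. f x = f a} = n"
  shows "card A = n * card (f ` A)"
proof -
  have "card A = (\<Sum>y\<in>f ` A. card {x \<in> A. f x = y})" using sum.image_gen[OF assms(1), of "\<lambda>_. 1::nat" f] by simp
  also have "\<dots> = (\<Sum>y\<in>f ` A. n)" by (rule sum.cong) (use assms(2) in auto)
  finally show ?thesis by simp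
qed

subsection \<open>Subnormal subgroups of finite groups\<close>

locale fin_group = group G for G (structure) + assumes fin: "finite (carrier G)"
begin

lemma inv_cancel [simp]:
  "x \<in> carrier G \<Longrightarrow> y \<in> carrier G \<Longrightarrow> x \<otimes> (inv x \<otimes> y) = y"
  "x \<in> carrier G \<Longrightarrow> y \<in> carrier G \<Longrightarrow> inv x \<otimes> (x \<otimes> y) = y"
  by (simp_all add: m_assoc[symmetric])

text \<open>All subgroups are kept as subsets of the one group \<open>G\<close>, so chains and
  orders can be compared without changing the group structure.\<close>

definition normal_in where
  "normal_in N H \<longleftrightarrow> subgroup N G \<and> subgroup H G \<and> N \<subseteq> H \<and> (\<forall>h\<in>H. \<forall>n\<in>N. h \<otimes> n \<otimes> inv h \<in> N)"

lemma sub_carrier: "subgroup H G \<Longrightarrow> h \<in> H \<Longrightarrow> h \<in> carrier G"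
  by (rule subgroup.mem_carrier)

lemma sub_finite: "subgroup H G \<Longrightarrow> finite H"
  using fin finite_subset subgroup.subset by blast

lemma normal_in_inv: "normal_in N H \<Longrightarrow> h \<in> H \<Longrightarrow> n \<in> N \<Longrightarrow> inv h \<otimes> n \<otimes> h \<in> N"
proof -
  assume a: "normal_in N H" "h \<in> H" "n \<in> N"
  then have H: "subgroup H G" by (simp add: normal_in_def)
  have "inv h \<in> H" using subgroup.m_inv_closed[OF H a(2)] .
  then have "inv h \<otimes> n \<otimes> inv (inv h) \<in> N" using a by (simp add: normal_in_def)
  then show ?thesis using sub_carrier[OF H a(2)] by simp
qed

lemma card_dvd:
  assumes "subgroup N G" "subgroup H G" "N \<subseteq> H" shows "card N dvd card H"
proof -
  interpret H: group "G\<lparr>carrier := H\<rparr>" using subgroup_imp_group[OF assms(2)] .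
  have "card (rcosets\<^bsub>G\<lparr>carrier := H\<rparr>\<^esub> N) * card N = order (G\<lparr>carrier := H\<rparr>)"
    by (rule H.lagrange) (rule subgroup_incl[OF assms])
  then have "card H = card (rcosets\<^bsub>G\<lparr>carrier := H\<rparr>\<^esub> N) * card N" by (simp add: order_def)
  then show ?thesis by (rule dvdI[OF HOL.trans[OF _ mult.commute]])
qed

lemma normal_in_triv: "subgroup H G \<Longrightarrow> normal_in {\<one>} H"
  unfolding normal_in_def using triv_subgroup subgroup.one_closed[of H G] sub_carrier[of H] by auto

lemma normal_in_prod:
  assumes N: "normal_in N H" and M: "normal_in M H"
  shows "normal_in (N <#> M) H" "N \<subseteq> N <#> M" "M \<subseteq> N <#> M" "card (N <#> M) dvd card N * card M"
proof -
  have sub: "subgroup N G" "subgroup M G" "subgroup H G" "N \<subseteq> H" "M \<subseteq> H" using N M by (auto simp: normal_in_def)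
  note c = sub_carrier[OF sub(1)] sub_carrier[OF sub(2)] sub_carrier[OF sub(3)]
  have memI: "n \<otimes> m \<in> N <#> M" if "n \<in> N" "m \<in> M" for n m using that by (auto simp: set_mult_def)
  have memE: "\<exists>n\<in>N. \<exists>m\<in>M. x = n \<otimes> m" if "x \<in> N <#> M" for x using that by (auto simp: set_mult_def)
  have subg: "subgroup (N <#> M) G"
  proof (rule subgroupI)
    show "N <#> M \<subseteq> carrier G" using memE c by blast
    show "N <#> M \<noteq> {}" using memI subgroup.one_closed[OF sub(1)] subgroup.one_closed[OF sub(2)] by blast
    fix x assume "x \<in> N <#> M"
    then obtain n m where nm: "n \<in> N" "m \<in> M" "x = n \<otimes> m" using memE by blast
    have "inv m \<otimes> inv n \<otimes> m \<in> N"
      using normal_in_inv[OF N, of m "inv n"] nm sub subgroup.m_inv_closed[OF sub(1)] by auto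
    moreover have "inv x = (inv m \<otimes> inv n \<otimes> m) \<otimes> inv m" using nm c by (simp add: inv_mult_group m_assoc)
    ultimately show "inv x \<in> N <#> M" using memI subgroup.m_inv_closed[OF sub(2) nm(2)] by simp
    fix y assume "y \<in> N <#> M"
    then obtain n' m' where nm': "n' \<in> N" "m' \<in> M" "y = n' \<otimes> m'" using memE by blast
    have "m \<otimes> n' \<otimes> inv m \<in> N" using N nm nm' sub by (auto simp: normal_in_def)
    then have "n \<otimes> (m \<otimes> n' \<otimes> inv m) \<in> N" using subgroup.m_closed[OF sub(1) nm(1)] by blast
    moreover have "m \<otimes> m' \<in> M" using subgroup.m_closed[OF sub(2) nm(2) nm'(2)] .
    ultimately have "n \<otimes> (m \<otimes> n' \<otimes> inv m) \<otimes> (m \<otimes> m') \<in> N <#> M" by (rule memI)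
    then show "x \<otimes> y \<in> N <#> M" using nm nm' c by (simp add: m_assoc)
  qed
  have nor: "h \<otimes> x \<otimes> inv h \<in> N <#> M" if h: "h \<in> H" and x: "x \<in> N <#> M" for h x
  proof -
    obtain n m where nm: "n \<in> N" "m \<in> M" "x = n \<otimes> m" using memE[OF x] by blast
    have "h \<otimes> n \<otimes> inv h \<in> N" "h \<otimes> m \<otimes> inv h \<in> M" using N M nm h by (auto simp: normal_in_def)
    then have "(h \<otimes> n \<otimes> inv h) \<otimes> (h \<otimes> m \<otimes> inv h) \<in> N <#> M" by (rule memI)
    then show ?thesis using nm c h by (simp add: m_assoc)
  qed
  have "N <#> M \<subseteq> H" using memE sub subgroup.m_closed[OF sub(3)] by blast
  then show "normal_in (N <#> M) H" using subg nor sub by (simp add: normal_in_def)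
  show "N \<subseteq> N <#> M" using memI[OF _ subgroup.one_closed[OF sub(2)]] c by fastforce
  show "M \<subseteq> N <#> M" using memI[OF subgroup.one_closed[OF sub(1)]] c by fastforce
  have "card (N \<times> M) = card (N \<inter> M) * card ((\<lambda>(n, m). n \<otimes> m) ` (N \<times> M))"
  proof (rule card_uniform_fibres)
    show "finite (N \<times> M)" using sub_finite sub by blast
    fix p assume "p \<in> N \<times> M"
    then obtain n m where p: "p = (n, m)" "n \<in> N" "m \<in> M" by blast
    \<comment> \<open>The fibre of multiplication through \<open>(n, m)\<close> is obtained by
      shifting an element of \<open>N \<inter> M\<close> from one factor to the other.\<close>
    have "bij_betw (\<lambda>d. (n \<otimes> d, inv d \<otimes> m)) (N \<inter> M) {x \<in> N \<times> M. (\<lambda>(n, m). n \<otimes> m) x = (\<lambda>(n, m). n \<otimes> m) p}"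
    proof (rule bij_betwI')
      fix d d' assume "d \<in> N \<inter> M" "d' \<in> N \<inter> M"
      then show "((n \<otimes> d, inv d \<otimes> m) = (n \<otimes> d', inv d' \<otimes> m)) = (d = d')" using p c by auto
    next
      fix d assume d: "d \<in> N \<inter> M"
      then have "n \<otimes> d \<in> N" "inv d \<otimes> m \<in> M"
        using p subgroup.m_closed[OF sub(1)] subgroup.m_closed[OF sub(2)] subgroup.m_inv_closed[OF sub(2)] by auto
      then show "(n \<otimes> d, inv d \<otimes> m) \<in> {x \<in> N \<times> M. (\<lambda>(n, m). n \<otimes> m) x = (\<lambda>(n, m). n \<otimes> m) p}"
        using p d c by (simp add: m_assoc)
    next
      fix x assume "x \<in> {x \<in> N \<times> M. (\<lambda>(n, m). n \<otimes> m) x = (\<lambda>(n, m). n \<otimes> m) p}"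
      then obtain n' m' where x: "x = (n', m')" "n' \<in> N" "m' \<in> M" "n' \<otimes> m' = n \<otimes> m" using p by auto
      have cc: "n \<in> carrier G" "m \<in> carrier G" "n' \<in> carrier G" "m' \<in> carrier G" using p x c by auto
      let ?d = "inv n \<otimes> n'"
      have d1: "?d \<in> N" using p x subgroup.m_closed[OF sub(1) subgroup.m_inv_closed[OF sub(1)]] by blast
      have "n' = n \<otimes> m \<otimes> inv m'" using x(4)[symmetric] cc by (simp add: m_assoc)
      then have e: "?d = m \<otimes> inv m'" using cc by (simp add: m_assoc)
      then have "?d \<in> M" using p x subgroup.m_closed[OF sub(2) _ subgroup.m_inv_closed[OF sub(2)]] by simp
      moreover have "inv ?d \<otimes> m = m'" unfolding e using cc by (simp add: inv_mult_group m_assoc)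
      moreover have "n \<otimes> ?d = n'" using cc by simp
      ultimately show "\<exists>d\<in>N \<inter> M. x = (n \<otimes> d, inv d \<otimes> m)" using d1 x(1) by (intro bexI[of _ ?d]) auto
    qed
    from bij_betw_same_card[OF this]
    show "card {x \<in> N \<times> M. (\<lambda>(n, m). n \<otimes> m) x = (\<lambda>(n, m). n \<otimes> m) p} = card (N \<inter> M)" by simp
  qed
  moreover have "(\<lambda>(n, m). n \<otimes> m) ` (N \<times> M) = N <#> M" by (auto simp: set_mult_def)
  ultimately show "card (N <#> M) dvd card N * card M" by (simp add: card_cartesian_product)
qed

text \<open>This is \<open>O_{\<pi>'}(H)\<close>, where \<open>\<pi>\<close> is the set of prime
  divisors of \<open>k\<close>.\<close>

definition core where
  "core k H = (SOME N. normal_in N H \<and> coprime (card N) k \<and> (\<forall>M. normal_in M H \<longrightarrow> coprime (card M) k \<longrightarrow> M \<subseteq> N))"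

text \<open>The order of a product of two normal subgroups divides the product of their orders, so a
  maximal normal subgroup of order coprime to \<open>k\<close> absorbs every other.\<close>

lemma core:
  assumes H: "subgroup H G"
  shows "normal_in (core k H) H" "coprime (card (core k H)) k" "normal_in M H \<Longrightarrow> coprime (card M) k \<Longrightarrow> M \<subseteq> core k H"
proof -
  let ?A = "{N. normal_in N H \<and> coprime (card N) k}"
  have "?A \<subseteq> Pow (carrier G)" by (auto simp: normal_in_def dest: subgroup.subset)
  then have f: "finite ?A" by (rule finite_subset) (simp add: fin)
  have "{\<one>} \<in> ?A" using normal_in_triv[OF H] by simp
  then have "?A \<noteq> {}" by blast
  from finite_has_maximal[OF f this] obtain N where N: "N \<in> ?A" "\<forall>M\<in>?A. N \<subseteq> M \<longrightarrow> N = M" by blast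
  have "M \<subseteq> N" if M: "normal_in M H" "coprime (card M) k" for M
  proof -
    have Nn: "normal_in N H" "coprime (card N) k" using N by auto
    note P = normal_in_prod[OF Nn(1) M(1)]
    have "coprime (card N * card M) k" using Nn M by simp
    then have "coprime (card (N <#> M)) k" by (rule coprime_divisors[OF P(4) dvd_refl])
    then have "N = N <#> M" using N(2) P(1,2) by blast
    then show ?thesis using P(3) by simp
  qed
  then have "\<exists>N. normal_in N H \<and> coprime (card N) k \<and> (\<forall>M. normal_in M H \<longrightarrow> coprime (card M) k \<longrightarrow> M \<subseteq> N)" using N by blast
  from someI_ex[OF this, folded core_def]
  show "normal_in (core k H) H" "coprime (card (core k H)) k" "normal_in M H \<Longrightarrow> coprime (card M) k \<Longrightarrow> M \<subseteq> core k H" by auto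
qed

text \<open>By finiteness, conjugation by \<open>g\<close> maps \<open>H\<close> onto itself, so it
  carries the core to a normal subgroup of \<open>H\<close> of the same order.\<close>

lemma core_invariant:
  assumes H: "subgroup H G" and g: "g \<in> carrier G" "\<And>h. h \<in> H \<Longrightarrow> g \<otimes> h \<otimes> inv g \<in> H" and n: "n \<in> core k H"
  shows "g \<otimes> n \<otimes> inv g \<in> core k H"
proof -
  let ?N = "core k H" and ?f = "\<lambda>x. g \<otimes> x \<otimes> inv g"
  note C = core[OF H]
  have sub: "subgroup ?N G" "?N \<subseteq> H" using C(1) by (auto simp: normal_in_def)
  note c = sub_carrier[OF H]
  have inj: "inj_on ?f H" using c g by (auto intro!: inj_onI)
  have "?f ` H = H" using endo_inj_surj[OF sub_finite[OF H] _ inj] g by blast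
  have Ninj: "inj_on ?f ?N" using inj inj_on_subset sub by blast
  have "subgroup (?f ` ?N) G"
  proof (rule subgroupI)
    show "?f ` ?N \<subseteq> carrier G" using sub c g by auto
    show "?f ` ?N \<noteq> {}" using subgroup.one_closed[OF sub(1)] by blast
    fix x assume "x \<in> ?f ` ?N"
    then obtain a where a: "a \<in> ?N" "x = ?f a" by blast
    have "inv x = ?f (inv a)" using a c sub g by (auto simp: inv_mult_group m_assoc)
    then show "inv x \<in> ?f ` ?N" using subgroup.m_inv_closed[OF sub(1) a(1)] by blast
    fix y assume "y \<in> ?f ` ?N"
    then obtain b where b: "b \<in> ?N" "y = ?f b" by blast
    have "a \<in> carrier G" "b \<in> carrier G" using a b c sub by auto
    then have "x \<otimes> y = ?f (a \<otimes> b)" using a b g by (simp add: m_assoc)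
    then show "x \<otimes> y \<in> ?f ` ?N" using subgroup.m_closed[OF sub(1) a(1) b(1)] by blast
  qed
  moreover have "h \<otimes> x \<otimes> inv h \<in> ?f ` ?N" if h: "h \<in> H" and x: "x \<in> ?f ` ?N" for h x
  proof -
    obtain a where a: "a \<in> ?N" "x = ?f a" using x by blast
    obtain k where k: "k \<in> H" "h = ?f k" using h \<open>?f ` H = H\<close> by blast
    have "a \<in> carrier G" "k \<in> carrier G" using a k sub c by auto
    then have "h \<otimes> x \<otimes> inv h = ?f (k \<otimes> a \<otimes> inv k)" using a k g by (simp add: m_assoc inv_mult_group)
    moreover have "k \<otimes> a \<otimes> inv k \<in> ?N" using C(1) k a by (simp add: normal_in_def)
    ultimately show ?thesis by blast
  qed
  moreover have "?f ` ?N \<subseteq> H" using sub g(2) by blast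
  ultimately have "normal_in (?f ` ?N) H" using H by (simp add: normal_in_def)
  moreover have "coprime (card (?f ` ?N)) k" using C(2) card_image[OF Ninj] by simp
  ultimately show ?thesis using C(3) n by blast
qed

inductive subnormal where
  subnormal_self: "subgroup H G \<Longrightarrow> subnormal H H"
| subnormal_step: "subnormal L M \<Longrightarrow> normal_in M H \<Longrightarrow> subnormal L H"

lemma subnormal_sub: "subnormal L H \<Longrightarrow> subgroup L G \<and> subgroup H G \<and> L \<subseteq> H"
  by (induction rule: subnormal.induct) (auto simp: normal_in_def)

lemma subnormal_trans: "subnormal M H \<Longrightarrow> subnormal L M \<Longrightarrow> subnormal L H"
  by (induction rule: subnormal.induct) (auto intro: subnormal_step)

lemma normal_in_sn: "normal_in N H \<Longrightarrow> subnormal N H"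
  using subnormal_step[OF subnormal_self] by (auto simp: normal_in_def)

lemma normal_in_inter: "normal_in N H \<Longrightarrow> subgroup M G \<Longrightarrow> M \<subseteq> H \<Longrightarrow> normal_in (N \<inter> M) M"
proof -
  assume a: "normal_in N H" "subgroup M G" "M \<subseteq> H"
  then have "subgroup (N \<inter> M) G" using subgroups_Inter_pair by (auto simp: normal_in_def)
  moreover have "h \<otimes> n \<otimes> inv h \<in> N \<inter> M" if "h \<in> M" "n \<in> N \<inter> M" for h n
    using a that subgroup.m_closed[OF a(2)] subgroup.m_inv_closed[OF a(2)] by (auto simp: normal_in_def)
  ultimately show ?thesis using a by (auto simp: normal_in_def)
qed

lemma subnormal_inter: "subnormal L H \<Longrightarrow> subgroup M G \<Longrightarrow> M \<subseteq> H \<Longrightarrow> subnormal (L \<inter> M) M"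
proof (induction arbitrary: M rule: subnormal.induct)
  case (subnormal_self H)
  then have "H \<inter> M = M" by blast
  then show ?case using subnormal_self subnormal.subnormal_self by simp
next
  case (subnormal_step L K H)
  have sub: "subgroup K G" "L \<subseteq> K" using subnormal_sub[OF subnormal_step.hyps(1)] by auto
  have "subnormal (L \<inter> (K \<inter> M)) (K \<inter> M)" using subnormal_step.IH[of "K \<inter> M"] subgroups_Inter_pair[OF sub(1) subnormal_step.prems(1)] by blast
  moreover have "L \<inter> (K \<inter> M) = L \<inter> M" using sub by blast
  ultimately show ?case using subnormal.subnormal_step normal_in_inter[OF subnormal_step.hyps(2) subnormal_step.prems] by metis
qed

text \<open>Each term of a subnormal chain has a characteristic core, which is therefore normal in
  the next term and contained in its core.\<close>

lemma subnormal_core: "subnormal L H \<Longrightarrow> coprime (card L) k \<Longrightarrow> L \<subseteq> core k H"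
proof (induction rule: subnormal.induct)
  case (subnormal_self H)
  have "normal_in H H" using subnormal_self subgroup.m_closed[OF subnormal_self(1)] subgroup.m_inv_closed[OF subnormal_self(1)] by (simp add: normal_in_def)
  then show ?case using core(3)[OF subnormal_self(1)] subnormal_self by blast
next
  case (subnormal_step L M H)
  have sub: "subgroup M G" "subgroup H G" using subnormal_step.hyps(2) by (auto simp: normal_in_def)
  note C = core[OF sub(1), where k = k]
  have "h \<otimes> n \<otimes> inv h \<in> core k M" if "h \<in> H" "n \<in> core k M" for h n
    by (rule core_invariant[OF sub(1) sub_carrier[OF sub(2) that(1)] _ that(2)])
      (use subnormal_step.hyps(2) that in \<open>auto simp: normal_in_def\<close>)
  then have "normal_in (core k M) H" using C(1) subnormal_step.hyps(2) by (auto simp: normal_in_def)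
  then have "core k M \<subseteq> core k H" using core(3)[OF sub(2)] C(2) by blast
  then show ?case using subnormal_step by blast
qed

definition simple_subgroup where
  "simple_subgroup L \<longleftrightarrow> subgroup L G \<and> L \<noteq> {\<one>} \<and> (\<forall>N. normal_in N L \<longrightarrow> N = {\<one>} \<or> N = L)"

lemma simple_subnormal_exists:
  assumes X: "subgroup X G" "X \<noteq> {\<one>}"
  obtains L where "subnormal L X" "simple_subgroup L"
proof -
  let ?A = "{L. subnormal L X \<and> L \<noteq> {\<one>}}"
  have "?A \<subseteq> Pow (carrier G)" by (auto dest!: subnormal_sub subgroup.subset)
  then have f: "finite ?A" by (rule finite_subset) (simp add: fin)
  have "X \<in> ?A" using X(2) subnormal_self[OF X(1)] by simp
  then have "?A \<noteq> {}" by blast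
  from finite_has_minimal[OF f this] obtain L where L: "L \<in> ?A" "\<forall>M\<in>?A. M \<subseteq> L \<longrightarrow> L = M" by blast
  have "N = {\<one>} \<or> N = L" if "normal_in N L" for N
    using L subnormal_trans[of L X N] normal_in_sn[OF that] that by (auto simp: normal_in_def)
  then have "simple_subgroup L" using L subnormal_sub by (auto simp: simple_subgroup_def)
  then show thesis using that L by blast
qed

text \<open>Every nontrivial element generates a normal subgroup, hence all of \<open>L\<close>. For
  a prime divisor \<open>p\<close> of the order, the \<open>p\<close>-th power of a generator has
  too small an order to do so unless it is trivial.\<close>

lemma simple_abelian_prime:
  assumes L: "simple_subgroup L" and ab: "\<And>a b. a \<in> L \<Longrightarrow> b \<in> L \<Longrightarrow> a \<otimes> b = b \<otimes> a"
  shows "prime (card L)"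
proof -
  have sub: "subgroup L G" using L by (simp add: simple_subgroup_def)
  have gen: "generate G {b} = L" if b: "b \<in> L" "b \<noteq> \<one>" for b
  proof -
    have g: "subgroup (generate G {b}) G" using generate_is_subgroup sub_carrier[OF sub b(1)] by simp
    have gl: "generate G {b} \<subseteq> L" using generate_subgroup_incl[OF _ sub] b by simp
    have "h \<otimes> n \<otimes> inv h \<in> generate G {b}" if h: "h \<in> L" and n: "n \<in> generate G {b}" for h n
    proof -
      have "h \<otimes> n = n \<otimes> h" using ab h n gl by blast
      then have "h \<otimes> n \<otimes> inv h = n" using h n gl sub_carrier[OF sub] by (auto simp: m_assoc)
      then show ?thesis using n by simp
    qed
    then have "normal_in (generate G {b}) L" using g sub gl by (simp add: normal_in_def)
    moreover have "generate G {b} \<noteq> {\<one>}" using generate.incl[of b "{b}" G] b by auto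
    ultimately show ?thesis using L by (auto simp: simple_subgroup_def)
  qed
  obtain a where a: "a \<in> L" "a \<noteq> \<one>" using L subgroup.one_closed[OF sub] by (auto simp: simple_subgroup_def)
  have ac: "a \<in> carrier G" using sub_carrier[OF sub a(1)] .
  have o: "card L = ord a" using generate_pow_card[OF ac] gen[OF a] by simp
  have "ord a \<noteq> 1" using ord_eq_1[OF ac] a by simp
  then obtain p where p: "prime p" "p dvd ord a" using prime_factor_nat by blast
  have pos: "ord a > 0" using o sub_finite[OF sub] a by (metis card_gt_0_iff empty_iff)
  have "a [^] k \<in> L" for k :: nat
    by (induction k) (use subgroup.one_closed[OF sub] subgroup.m_closed[OF sub _ a(1)] in simp_all)
  then have pc: "a [^] p \<in> L" .
  have "a [^] p = \<one>"
  proof (rule ccontr)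
    assume ne: "a [^] p \<noteq> \<one>"
    have "ord (a [^] p) = ord a" using gen[OF pc ne] gen[OF a] generate_pow_card ac by simp
    moreover obtain n where n: "ord a = p * n" using p by (auto simp: dvd_def)
    have "(a [^] p) [^] n = \<one>" using n ac by (simp add: nat_pow_pow flip: n)
    then have "ord (a [^] p) dvd n" using pow_eq_id ac by simp
    ultimately have "p * n dvd n" using n by simp
    moreover have "n > 0" using n pos by simp
    ultimately show False using prime_gt_1_nat[OF p(1)] by (simp add: dvd_imp_le nat_dvd_not_less)
  qed
  then have "ord a dvd p" using pow_eq_id[OF ac] by simp
  then have "ord a = p" using p \<open>ord a \<noteq> 1\<close> by (metis prime_nat_iff)
  then show ?thesis using o p by simp
qed

lemma commute_subgroup: "c \<in> carrier G \<Longrightarrow> subgroup {g \<in> carrier G. g \<otimes> c = c \<otimes> g} G"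
proof (rule subgroupI)
  assume c: "c \<in> carrier G"
  show "{g \<in> carrier G. g \<otimes> c = c \<otimes> g} \<noteq> {}" using c by (auto intro: exI[of _ \<one>])
  fix a assume a: "a \<in> {g \<in> carrier G. g \<otimes> c = c \<otimes> g}"
  then have ac: "a \<in> carrier G" "a \<otimes> c = c \<otimes> a" by auto
  have "inv a \<otimes> c = inv a \<otimes> (c \<otimes> a) \<otimes> inv a" using ac c by (simp add: m_assoc)
  also have "\<dots> = inv a \<otimes> (a \<otimes> c) \<otimes> inv a" using ac by simp
  also have "\<dots> = c \<otimes> inv a" using ac(1) c by simp
  finally show "inv a \<in> {g \<in> carrier G. g \<otimes> c = c \<otimes> g}" using ac by simp
  fix b assume "b \<in> {g \<in> carrier G. g \<otimes> c = c \<otimes> g}"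
  then have b: "b \<in> carrier G" "b \<otimes> c = c \<otimes> b" by auto
  have "a \<otimes> b \<otimes> c = a \<otimes> (c \<otimes> b)" using ac b c by (simp add: m_assoc)
  also have "\<dots> = c \<otimes> (a \<otimes> b)" using ac b(1) c by (simp add: m_assoc[symmetric])
  finally show "a \<otimes> b \<in> {g \<in> carrier G. g \<otimes> c = c \<otimes> g}" using ac b by simp
qed auto

text \<open>
  Conjugation by \<open>n\<close> multiplies \<open>a\<close> and \<open>b\<close> by factors that centralise \<open>L\<close> and commute with each
  other, so it fixes the commutator of \<open>a\<close> and \<open>b\<close>.
\<close>
lemma commutator_fixed:
  assumes sub: "subgroup L G" and n: "n \<in> carrier G"
    and k: "\<And>l l'. l \<in> L \<Longrightarrow> l' \<in> L \<Longrightarrow> (n \<otimes> l \<otimes> inv n \<otimes> inv l) \<otimes> l' = l' \<otimes> (n \<otimes> l \<otimes> inv n \<otimes> inv l)"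
    and k': "\<And>l l'. l \<in> L \<Longrightarrow> l' \<in> L \<Longrightarrow> (inv n \<otimes> l \<otimes> n \<otimes> inv l) \<otimes> l' = l' \<otimes> (inv n \<otimes> l \<otimes> n \<otimes> inv l)"
    and ab: "a \<in> L" "b \<in> L"
  shows "n \<otimes> (a \<otimes> b \<otimes> inv a \<otimes> inv b) = (a \<otimes> b \<otimes> inv a \<otimes> inv b) \<otimes> n"
proof -
  note c = sub_carrier[OF sub]
  have ac: "a \<in> carrier G" "b \<in> carrier G" using c ab by auto
  define \<alpha> \<beta> where "\<alpha> = n \<otimes> a \<otimes> inv n \<otimes> inv a" and "\<beta> = n \<otimes> b \<otimes> inv n \<otimes> inv b"
  have cc: "\<alpha> \<in> carrier G" "\<beta> \<in> carrier G" using n ac by (auto simp: \<alpha>_def \<beta>_def)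
  have ea: "n \<otimes> a \<otimes> inv n = \<alpha> \<otimes> a" "n \<otimes> b \<otimes> inv n = \<beta> \<otimes> b" using n ac by (auto simp: \<alpha>_def \<beta>_def m_assoc)
  have com: "\<alpha> \<otimes> a = a \<otimes> \<alpha>" "\<alpha> \<otimes> b = b \<otimes> \<alpha>" "\<beta> \<otimes> a = a \<otimes> \<beta>" "\<beta> \<otimes> b = b \<otimes> \<beta>"
    unfolding \<alpha>_def \<beta>_def using k ab by blast+
  have "\<alpha> \<otimes> \<beta> = \<beta> \<otimes> \<alpha>"
  proof -
    let ?x = "inv n \<otimes> a \<otimes> n \<otimes> inv a"
    have xc: "?x \<in> carrier G" using n ac by simp
    have "n \<otimes> (?x \<otimes> b) \<otimes> inv n = n \<otimes> (b \<otimes> ?x) \<otimes> inv n" using k'[OF ab] by simp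
    then have "(n \<otimes> ?x \<otimes> inv n) \<otimes> (n \<otimes> b \<otimes> inv n) = (n \<otimes> b \<otimes> inv n) \<otimes> (n \<otimes> ?x \<otimes> inv n)"
      using n ac xc by (simp add: m_assoc)
    moreover have "n \<otimes> ?x \<otimes> inv n = inv \<alpha>" using n ac by (simp add: \<alpha>_def m_assoc inv_mult_group)
    ultimately have "inv \<alpha> \<otimes> (\<beta> \<otimes> b) = (\<beta> \<otimes> b) \<otimes> inv \<alpha>" using ea by simp
    then have "inv \<alpha> \<in> {g \<in> carrier G. g \<otimes> (\<beta> \<otimes> b) = (\<beta> \<otimes> b) \<otimes> g}" using cc by simp
    from subgroup.m_inv_closed[OF commute_subgroup this] have 1: "\<alpha> \<otimes> (\<beta> \<otimes> b) = (\<beta> \<otimes> b) \<otimes> \<alpha>" using cc ac by simp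
    have "(\<alpha> \<otimes> \<beta>) \<otimes> b = (\<beta> \<otimes> b) \<otimes> \<alpha>" using 1 cc ac by (simp add: m_assoc)
    also have "\<dots> = \<beta> \<otimes> (\<alpha> \<otimes> b)" using com(2) cc ac by (simp add: m_assoc)
    finally have "(\<alpha> \<otimes> \<beta>) \<otimes> b = (\<beta> \<otimes> \<alpha>) \<otimes> b" using cc ac by (simp add: m_assoc)
    then show ?thesis using cc ac by simp
  qed
  define \<gamma> where "\<gamma> = \<alpha> \<otimes> \<beta>"
  have gc: "\<gamma> \<in> carrier G" using cc by (simp add: \<gamma>_def)
  have "a \<in> {g \<in> carrier G. g \<otimes> \<gamma> = \<gamma> \<otimes> g}" "b \<in> {g \<in> carrier G. g \<otimes> \<gamma> = \<gamma> \<otimes> g}"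
  proof -
    have "a \<otimes> (\<alpha> \<otimes> \<beta>) = (\<alpha> \<otimes> a) \<otimes> \<beta>" using com(1) cc ac by (simp add: m_assoc[symmetric])
    also have "\<dots> = \<alpha> \<otimes> (\<beta> \<otimes> a)" using com(3) cc ac by (simp add: m_assoc)
    finally show "a \<in> {g \<in> carrier G. g \<otimes> \<gamma> = \<gamma> \<otimes> g}" using cc ac by (simp add: \<gamma>_def m_assoc)
    have "b \<otimes> (\<alpha> \<otimes> \<beta>) = (\<alpha> \<otimes> b) \<otimes> \<beta>" using com(2) cc ac by (simp add: m_assoc[symmetric])
    also have "\<dots> = \<alpha> \<otimes> (\<beta> \<otimes> b)" using com(4) cc ac by (simp add: m_assoc)
    finally show "b \<in> {g \<in> carrier G. g \<otimes> \<gamma> = \<gamma> \<otimes> g}" using cc ac by (simp add: \<gamma>_def m_assoc)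
  qed
  then have "a \<otimes> b \<otimes> inv a \<otimes> inv b \<in> {g \<in> carrier G. g \<otimes> \<gamma> = \<gamma> \<otimes> g}"
    using subgroup.m_closed[OF commute_subgroup[OF gc]] subgroup.m_inv_closed[OF commute_subgroup[OF gc]] by blast
  then have cx: "(a \<otimes> b \<otimes> inv a \<otimes> inv b) \<otimes> \<gamma> = \<gamma> \<otimes> (a \<otimes> b \<otimes> inv a \<otimes> inv b)" by simp
  have pq: "(\<alpha> \<otimes> a) \<otimes> (\<beta> \<otimes> b) = \<gamma> \<otimes> (a \<otimes> b)"
  proof -
    have "(\<alpha> \<otimes> a) \<otimes> (\<beta> \<otimes> b) = \<alpha> \<otimes> (a \<otimes> \<beta>) \<otimes> b" using cc ac by (simp add: m_assoc)
    also have "\<dots> = \<alpha> \<otimes> (\<beta> \<otimes> a) \<otimes> b" using com(3) by simp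
    finally show ?thesis using cc ac by (simp add: \<gamma>_def m_assoc)
  qed
  have qp: "(\<beta> \<otimes> b) \<otimes> (\<alpha> \<otimes> a) = \<gamma> \<otimes> (b \<otimes> a)"
  proof -
    have "(\<beta> \<otimes> b) \<otimes> (\<alpha> \<otimes> a) = \<beta> \<otimes> (b \<otimes> \<alpha>) \<otimes> a" using cc ac by (simp add: m_assoc)
    also have "\<dots> = (\<beta> \<otimes> \<alpha>) \<otimes> (b \<otimes> a)" using com(2)[symmetric] cc ac by (simp add: m_assoc)
    finally show ?thesis using \<open>\<alpha> \<otimes> \<beta> = \<beta> \<otimes> \<alpha>\<close> by (simp add: \<gamma>_def)
  qed
  have "n \<otimes> (a \<otimes> b \<otimes> inv a \<otimes> inv b) \<otimes> inv n
      = ((n \<otimes> a \<otimes> inv n) \<otimes> (n \<otimes> b \<otimes> inv n)) \<otimes> inv ((n \<otimes> b \<otimes> inv n) \<otimes> (n \<otimes> a \<otimes> inv n))"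
    using n ac by (simp add: m_assoc inv_mult_group)
  also have "\<dots> = \<gamma> \<otimes> (a \<otimes> b) \<otimes> inv (\<gamma> \<otimes> (b \<otimes> a))" unfolding ea pq qp ..
  also have "\<dots> = \<gamma> \<otimes> (a \<otimes> b \<otimes> inv a \<otimes> inv b) \<otimes> inv \<gamma>" using gc ac by (simp add: m_assoc inv_mult_group)
  also have "\<dots> = (a \<otimes> b \<otimes> inv a \<otimes> inv b) \<otimes> \<gamma> \<otimes> inv \<gamma>" unfolding cx ..
  also have "\<dots> = a \<otimes> b \<otimes> inv a \<otimes> inv b" using gc ac by (simp add: m_assoc)
  finally have e: "n \<otimes> (a \<otimes> b \<otimes> inv a \<otimes> inv b) \<otimes> inv n = a \<otimes> b \<otimes> inv a \<otimes> inv b" .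
  have "n \<otimes> (a \<otimes> b \<otimes> inv a \<otimes> inv b) = n \<otimes> (a \<otimes> b \<otimes> inv a \<otimes> inv b) \<otimes> inv n \<otimes> n"
    using n ac by (simp add: m_assoc)
  then show ?thesis unfolding e .
qed

text \<open>If \<open>L\<close> centralises \<open>N \<inter> M\<close>, the commutators of
  \<open>N\<close> with \<open>L\<close> lie there and so centralise \<open>L\<close>. By
  \<open>commutator_fixed\<close>, each element of \<open>N\<close> then commutes with all
  commutators of \<open>L\<close>, and by simplicity with all of \<open>L\<close>.\<close>

lemma simple_dichotomy:
  assumes "subnormal L H" "simple_subgroup L" "\<exists>a\<in>L. \<exists>b\<in>L. a \<otimes> b \<noteq> b \<otimes> a" "normal_in N H"
  shows "L \<subseteq> N \<or> (\<forall>l\<in>L. \<forall>n\<in>N. l \<otimes> n = n \<otimes> l)"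
  using assms
proof (induction arbitrary: N rule: subnormal.induct)
  case (subnormal_self H)
  then have "N = {\<one>} \<or> N = H" by (simp add: simple_subgroup_def)
  then show ?case using sub_carrier[OF subnormal_self(1)] by auto
next
  case (subnormal_step L M H)
  have sub: "subgroup L G" "subgroup M G" "subgroup H G" "subgroup N G" "L \<subseteq> M" "M \<subseteq> H" "N \<subseteq> H"
    using subnormal_sub[OF subnormal_step.hyps(1)] subnormal_step.hyps(2) subnormal_step.prems(3) by (auto simp: normal_in_def)
  note c = sub_carrier[OF sub(3)]
  have "L \<subseteq> N \<inter> M \<or> (\<forall>l\<in>L. \<forall>n\<in>N \<inter> M. l \<otimes> n = n \<otimes> l)"
    using subnormal_step.IH[OF subnormal_step.prems(1,2) normal_in_inter[OF subnormal_step.prems(3) sub(2,6)]] .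
  then show ?case
  proof
    assume com: "\<forall>l\<in>L. \<forall>n\<in>N \<inter> M. l \<otimes> n = n \<otimes> l"
    have k: "(n \<otimes> l \<otimes> inv n \<otimes> inv l) \<otimes> l' = l' \<otimes> (n \<otimes> l \<otimes> inv n \<otimes> inv l)" if "n \<in> N" "l \<in> L" "l' \<in> L" for n l l'
    proof -
      have cc: "n \<in> carrier G" "l \<in> carrier G" "n \<in> H" "l \<in> H" using that sub c by auto
      have "l \<otimes> inv n \<otimes> inv l \<in> N" using subnormal_step.prems(3) cc subgroup.m_inv_closed[OF sub(4) that(1)] by (simp add: normal_in_def)
      then have "n \<otimes> (l \<otimes> inv n \<otimes> inv l) \<in> N" using subgroup.m_closed[OF sub(4) that(1)] by blast
      moreover have "n \<otimes> l \<otimes> inv n \<in> M" using subnormal_step.hyps(2) cc that sub(5) by (auto simp: normal_in_def)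
      then have "(n \<otimes> l \<otimes> inv n) \<otimes> inv l \<in> M"
        using subgroup.m_closed[OF sub(2)] subgroup.m_inv_closed[OF sub(2)] that sub(5) by blast
      ultimately have "n \<otimes> l \<otimes> inv n \<otimes> inv l \<in> N \<inter> M" using cc by (simp add: m_assoc)
      from bspec[OF bspec[OF com that(3)] this] show ?thesis by (rule HOL.sym)
    qed
    have "l \<otimes> n = n \<otimes> l" if n: "n \<in> N" and l: "l \<in> L" for l n
    proof -
      have nc: "n \<in> carrier G" using n sub c by blast
      have n': "inv n \<in> N" using subgroup.m_inv_closed[OF sub(4) n] .
      let ?C = "{g \<in> carrier G. g \<otimes> n = n \<otimes> g} \<inter> L"
      have comm: "a \<otimes> b \<otimes> inv a \<otimes> inv b \<in> ?C" if "a \<in> L" "b \<in> L" for a b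
      proof -
        have "n \<otimes> (a \<otimes> b \<otimes> inv a \<otimes> inv b) = (a \<otimes> b \<otimes> inv a \<otimes> inv b) \<otimes> n"
          by (rule commutator_fixed[OF sub(1) nc _ _ that]) (use k[OF n] k[OF n'] nc in auto)
        moreover have "a \<otimes> b \<otimes> inv a \<otimes> inv b \<in> L"
          using that subgroup.m_closed[OF sub(1)] subgroup.m_inv_closed[OF sub(1)] by blast
        ultimately show ?thesis using sub_carrier[OF sub(1)] by simp
      qed
      have Csub: "subgroup ?C G" by (rule subgroups_Inter_pair[OF commute_subgroup[OF nc] sub(1)])
      \<comment> \<open>A subgroup containing all commutators is normal.\<close>
      have "h \<otimes> x \<otimes> inv h \<in> ?C" if h: "h \<in> L" and x: "x \<in> ?C" for h x
      proof -
        have xL: "x \<in> L" using x by blast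
        have "(h \<otimes> x \<otimes> inv h \<otimes> inv x) \<otimes> x \<in> ?C" by (rule subgroup.m_closed[OF Csub comm[OF h xL] x])
        then show ?thesis using h xL sub_carrier[OF sub(1)] by (simp add: m_assoc)
      qed
      then have "normal_in ?C L" using Csub sub(1) by (simp add: normal_in_def)
      then have "?C = {\<one>} \<or> ?C = L" using subnormal_step.prems(1) by (simp add: simple_subgroup_def)
      moreover have "?C \<noteq> {\<one>}"
      proof
        assume C1: "?C = {\<one>}"
        have "a \<otimes> b = b \<otimes> a" if "a \<in> L" "b \<in> L" for a b
        proof -
          have cc: "a \<in> carrier G" "b \<in> carrier G" using that sub_carrier[OF sub(1)] by auto
          have "a \<otimes> b \<otimes> inv a \<otimes> inv b = \<one>" using comm[OF that] C1 by blast
          then have "a \<otimes> b \<otimes> inv a \<otimes> inv b \<otimes> (b \<otimes> a) = b \<otimes> a" using cc by simp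
          then show ?thesis using cc by (simp add: m_assoc)
        qed
        then show False using subnormal_step.prems(2) by blast
      qed
      ultimately show ?thesis using l by blast
    qed
    then show ?thesis by blast
  qed blast
qed

end

subsection \<open>Groups of permutations\<close>

locale perm_group = fin_group G for G :: "('x \<Rightarrow> 'x) monoid" (structure) +
  assumes mult: "g \<otimes> h = g \<circ> h" and one: "\<one> = id"
begin

lemma mult_apply [simp]: "(g \<otimes> h) x = g (h x)" by (simp add: mult)

lemma one_apply [simp]: "\<one> x = x" by (simp add: one)

lemma inv_apply [simp]:
  assumes "g \<in> carrier G"
  shows "(inv g) (g x) = x" "g ((inv g) x) = x"
proof -
  have "(inv g \<otimes> g) x = x" "(g \<otimes> inv g) x = x" using assms by (simp_all del: mult_apply)
  then show "(inv g) (g x) = x" "g ((inv g) x) = x" by auto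
qed

lemma apply_eq: "g \<in> carrier G \<Longrightarrow> g x = g y \<longleftrightarrow> x = y"
  using inv_apply(1) by metis

lemma inv_fix: "g \<in> carrier G \<Longrightarrow> g x = y \<Longrightarrow> (inv g) y = x" by auto

lemma stab_subgroup: "subgroup H G \<Longrightarrow> subgroup {g \<in> H. \<forall>x\<in>A. g x = x} G"
proof (rule subgroupI)
  assume H: "subgroup H G"
  note c = sub_carrier[OF H]
  show "{g \<in> H. \<forall>x\<in>A. g x = x} \<subseteq> carrier G" using c by blast
  have "\<one> \<in> {g \<in> H. \<forall>x\<in>A. g x = x}" using subgroup.one_closed[OF H] by simp
  then show "{g \<in> H. \<forall>x\<in>A. g x = x} \<noteq> {}" by blast
  fix a assume a: "a \<in> {g \<in> H. \<forall>x\<in>A. g x = x}"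
  then have "(inv a) x = x" if "x \<in> A" for x using inv_fix[of a x x] that c by simp
  then show "inv a \<in> {g \<in> H. \<forall>x\<in>A. g x = x}" using subgroup.m_inv_closed[OF H] a by simp
  fix b assume "b \<in> {g \<in> H. \<forall>x\<in>A. g x = x}"
  then show "a \<otimes> b \<in> {g \<in> H. \<forall>x\<in>A. g x = x}" using a subgroup.m_closed[OF H] by simp
qed

lemma card_transporter:
  assumes H: "subgroup H G" and g: "g0 \<in> H"
  shows "card {g \<in> H. g x = g0 x} = card {g \<in> H. g x = x}"
proof (rule bij_betw_same_card[where f = "\<lambda>g. inv g0 \<otimes> g"])
  note c = sub_carrier[OF H]
  note H' = subgroup.m_closed[OF H] subgroup.m_inv_closed[OF H]
  show "bij_betw (\<lambda>g. inv g0 \<otimes> g) {g \<in> H. g x = g0 x} {g \<in> H. g x = x}"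
  proof (rule bij_betw_byWitness[where f' = "\<lambda>g. g0 \<otimes> g"])
    show "\<forall>a\<in>{g \<in> H. g x = g0 x}. g0 \<otimes> (inv g0 \<otimes> a) = a" "\<forall>a\<in>{g \<in> H. g x = x}. inv g0 \<otimes> (g0 \<otimes> a) = a"
      using c g by auto
    show "(\<lambda>g. inv g0 \<otimes> g) ` {g \<in> H. g x = g0 x} \<subseteq> {g \<in> H. g x = x}"
      "(\<lambda>g. g0 \<otimes> g) ` {g \<in> H. g x = x} \<subseteq> {g \<in> H. g x = g0 x}"
      using c[OF g] g H' by auto
  qed
qed

lemma orbit_stabilizer:
  assumes H: "subgroup H G"
  shows "card H = card {g \<in> H. g x = x} * card ((\<lambda>g. g x) ` H)"
  by (rule card_uniform_fibres[OF sub_finite[OF H]]) (rule card_transporter[OF H])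

lemma orbit_eq:
  assumes H: "subgroup H G" and y: "y \<in> (\<lambda>g. g x) ` H"
  shows "(\<lambda>g. g y) ` H = (\<lambda>g. g x) ` H"
proof -
  note H' = subgroup.m_closed[OF H] subgroup.m_inv_closed[OF H]
  obtain h where h: "h \<in> H" "y = h x" using y by blast
  have "g y \<in> (\<lambda>g. g x) ` H" if "g \<in> H" for g
    using H'(1)[OF that h(1)] h by (intro image_eqI[of _ _ "g \<otimes> h"]) auto
  moreover have "g x \<in> (\<lambda>g. g y) ` H" if "g \<in> H" for g
    using H'(1)[OF that H'(2)[OF h(1)]] h sub_carrier[OF H h(1)] by (intro image_eqI[of _ _ "g \<otimes> inv h"]) auto
  ultimately show ?thesis by blast
qed

lemma dvd_card_of_orbits:
  assumes H: "subgroup H G" and A: "finite A" "\<forall>h\<in>H. h ` A \<subseteq> A"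
    and k: "\<And>a. a \<in> A \<Longrightarrow> k dvd card ((\<lambda>g. g a) ` H)"
  shows "k dvd card A"
proof -
  let ?C = "(\<lambda>a. (\<lambda>g. g a) ` H) ` A"
  have self: "a \<in> (\<lambda>g. g a) ` H" for a
    using subgroup.one_closed[OF H] by (intro image_eqI[of _ _ \<one>]) auto
  have U: "\<Union> ?C = A" using self A(2) by blast
  have "k dvd card (\<Union> ?C)"
  proof (rule dvd_partition)
    show "finite (\<Union> ?C)" using U A by simp
    show "\<forall>c\<in>?C. k dvd card c" using k by blast
    show "\<forall>c1\<in>?C. \<forall>c2\<in>?C. c1 \<noteq> c2 \<longrightarrow> c1 \<inter> c2 = {}"
    proof (intro ballI impI)
      fix c1 c2 assume c: "c1 \<in> ?C" "c2 \<in> ?C" "c1 \<noteq> c2"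
      show "c1 \<inter> c2 = {}"
      proof (rule ccontr)
        assume "c1 \<inter> c2 \<noteq> {}"
        then obtain y where y: "y \<in> c1" "y \<in> c2" by blast
        have "(\<lambda>g. g y) ` H = c1" "(\<lambda>g. g y) ` H = c2" using c y orbit_eq[OF H] by blast+
        then show False using c by simp
      qed
    qed
  qed
  then show ?thesis unfolding U .
qed

lemma semiregular_dvd:
  assumes L: "subgroup L G" and A: "finite A" "\<forall>h\<in>L. h ` A \<subseteq> A"
    and free: "\<And>l a. l \<in> L \<Longrightarrow> a \<in> A \<Longrightarrow> l a = a \<Longrightarrow> l = \<one>"
  shows "card L dvd card A"
proof (rule dvd_card_of_orbits[OF L A])
  fix a assume a: "a \<in> A"
  have "{g \<in> L. g a = a} = {\<one>}"
  proof (intro equalityI subsetI)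
    fix g assume "g \<in> {g \<in> L. g a = a}"
    then show "g \<in> {\<one>}" using free[OF _ a, of g] by blast
  next
    fix g assume "g \<in> {\<one>}"
    then show "g \<in> {g \<in> L. g a = a}" using subgroup.one_closed[OF L] by simp
  qed
  then show "card L dvd card ((\<lambda>g. g a) ` L)" using orbit_stabilizer[OF L, of a] by simp
qed

text \<open>\<open>T\<close> permutes the orbits of \<open>N\<close> on \<open>A\<close>
  transitively, so they have equal size, which divides both \<open>card A\<close> and
  \<open>card N\<close>.\<close>

lemma coprime_normal_trivial:
  assumes N: "subgroup N G" and A: "finite A" "\<forall>h\<in>N. h ` A \<subseteq> A"
    and T: "T \<subseteq> carrier G" "\<And>g n. g \<in> T \<Longrightarrow> n \<in> N \<Longrightarrow> g \<otimes> n \<otimes> inv g \<in> N"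
    and trans: "\<And>a b. a \<in> A \<Longrightarrow> b \<in> A \<Longrightarrow> \<exists>g\<in>T. g a = b"
    and cop: "coprime (card N) (card A)" and n: "n \<in> N" "a \<in> A"
  shows "n a = a"
proof -
  let ?O = "\<lambda>a. (\<lambda>g. g a) ` N"
  have le: "card (?O a) \<le> card (?O b)" if ab: "a \<in> A" "b \<in> A" for a b
  proof -
    obtain g where g: "g \<in> T" "g a = b" using trans ab by blast
    have gc: "g \<in> carrier G" using g T by blast
    have "g ` ?O a \<subseteq> ?O b"
    proof safe
      fix m assume m: "m \<in> N"
      have "g (m a) = (g \<otimes> m \<otimes> inv g) b" using g gc by (simp add: inv_fix)
      then show "g (m a) \<in> ?O b" using T(2)[OF g(1) m] by blast
    qed
    moreover have "inj_on g (?O a)" using apply_eq[OF gc] by (auto intro: inj_onI)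
    moreover have "finite (?O b)" using sub_finite[OF N] by simp
    ultimately show ?thesis using card_inj_on_le by blast
  qed
  have "card (?O a) = card (?O b)" if "b \<in> A" for b using le[OF n(2) that] le[OF that n(2)] by simp
  then have "card (?O a) dvd card A" using dvd_card_of_orbits[OF N A, of "card (?O a)"] by simp
  moreover have "card (?O a) dvd card N" unfolding orbit_stabilizer[OF N, of a] by simp
  ultimately have "card (?O a) = 1" using cop coprime_common_divisor_nat by blast
  then obtain z where z: "?O a = {z}" by (auto simp: card_1_singleton_iff)
  have "\<one> a \<in> ?O a" using subgroup.one_closed[OF N] by blast
  moreover have "n a \<in> ?O a" using n by blast
  ultimately show ?thesis using z by simp
qed

text \<open>The elements of \<open>N\<close> taking \<open>D\<close> to \<open>d D\<close> form a
  coset of a stabiliser, of size dividing \<open>card N\<close> and hence prime to \<open>r\<close>.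
  Conjugation by the \<open>r\<close>-element \<open>x\<close> preserves this coset and has a fixed
  point on it.\<close>

lemma commuting_transporter:
  assumes r: "prime r" and N: "subgroup N G" "\<not> r dvd card N" and d: "d \<in> N"
    and x: "x \<in> carrier G" "x D = D" "x (d D) = d D" "\<And>n. n \<in> N \<Longrightarrow> x \<otimes> n \<otimes> inv x \<in> N"
    and p: "x [^] (r ^ e) = \<one>"
  obtains c where "c \<in> N" "c D = d D" "x \<otimes> c = c \<otimes> x"
proof -
  let ?A = "{n \<in> N. n D = d D}" and ?f = "\<lambda>n. x \<otimes> n \<otimes> inv x"
  note nc = sub_carrier[OF N(1)]
  have f: "finite ?A" using sub_finite[OF N(1)] by simp
  have im: "?f ` ?A \<subseteq> ?A" using x inv_fix[OF x(1,2)] by auto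
  have pow: "(?f ^^ k) n = x [^] k \<otimes> n \<otimes> inv (x [^] k)" if "n \<in> carrier G" for k n
  proof (induction k)
    case (Suc k)
    have "x [^] Suc k = x \<otimes> x [^] k" using x(1) nat_pow_Suc2 by blast
    then show ?case using Suc x(1) that by (simp add: m_assoc inv_mult_group del: nat_pow_Suc mult_apply one_apply)
  qed (use that in \<open>simp del: mult_apply one_apply\<close>)
  have per: "(?f ^^ (r ^ e)) n = n" if "n \<in> ?A" for n
    using pow[of n "r ^ e"] p that nc by (simp del: mult_apply one_apply)
  have "card ?A dvd card N"
    using card_transporter[OF N(1) d, of D] orbit_stabilizer[OF N(1), of D] by simp
  then have "\<not> r dvd card ?A" using N(2) dvd_trans by blast
  then obtain c where c: "c \<in> ?A" "?f c = c"
    using prime_power_period_fixed_point[OF f r im, of e] per by blast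
  have "c \<in> carrier G" using c nc by blast
  moreover have "x \<otimes> c \<otimes> inv x \<otimes> x = c \<otimes> x" using c(2) by (rule arg_cong)
  ultimately have "x \<otimes> c = c \<otimes> x" using x(1) by (simp add: m_assoc del: mult_apply one_apply)
  then show thesis using that c by blast
qed

text \<open>A Sylow \<open>r\<close>-subgroup of \<open>X\<close> inside the stabiliser of
  \<open>b\<close> would make the orbit length prime to \<open>r\<close>.\<close>

lemma prime_power_element_moves:
  assumes X: "subgroup X G" and r: "prime r" "r dvd card ((\<lambda>g. g b) ` X)"
  obtains x e where "x \<in> X" "x [^] (r ^ e) = \<one>" "x b \<noteq> b"
proof -
  define a where "a = multiplicity r (card X)"
  have pos: "card X \<noteq> 0" using sub_finite[OF X] subgroup.one_closed[OF X] by auto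
  have "r ^ a dvd card X" unfolding a_def by (rule multiplicity_dvd)
  then obtain m where "card X = r ^ a * m" by blast
  then have "order (G\<lparr>carrier := X\<rparr>) = r ^ a * m" by (simp add: order_def)
  then obtain H where H0: "subgroup H (G\<lparr>carrier := X\<rparr>)" "card H = r ^ a"
    using sylow_thm[OF r(1) subgroup_imp_group[OF X]] sub_finite[OF X] by auto
  have H: "subgroup H G" "H \<subseteq> X" using incl_subgroup[OF X H0(1)] subgroup.subset[OF H0(1)] by auto
  have pw: "x [^] (r ^ a) = \<one>" if "x \<in> H" for x
  proof -
    interpret H: group "G\<lparr>carrier := H\<rparr>" using subgroup_imp_group[OF H(1)] .
    have "x [^]\<^bsub>G\<lparr>carrier := H\<rparr>\<^esub> order (G\<lparr>carrier := H\<rparr>) = \<one>\<^bsub>G\<lparr>carrier := H\<rparr>\<^esub>"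
      by (rule H.pow_order_eq_1) (use that in simp)
    then show ?thesis using H0(2) nat_pow_consistent[of x "r ^ a" H] by (simp add: order_def)
  qed
  have "\<exists>x\<in>H. x b \<noteq> b"
  proof (rule ccontr)
    assume "\<not> ?thesis"
    then have sub: "H \<subseteq> {g \<in> X. g b = b}" using H by blast
    have "subgroup {g \<in> X. g b = b} G" using stab_subgroup[OF X, of "{b}"] by simp
    from card_dvd[OF H(1) this sub] have "r ^ a dvd card {g \<in> X. g b = b}" using H0 by simp
    then have "r ^ a * r dvd card X" unfolding orbit_stabilizer[OF X, of b] using r(2) by (rule mult_dvd_mono)
    then have "r ^ Suc a dvd card X" by (simp add: mult.commute)
    then have "Suc a \<le> multiplicity r (card X)" using r(1) pos
      by (subst (asm) power_dvd_iff_le_multiplicity) (auto simp: prime_nat_iff)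
    then show False by (simp add: a_def)
  qed
  then show thesis using that pw H by blast
qed

end

subsection \<open>Finite polygons with coprime parameters\<close>

text \<open>\<open>q k\<close> counts the \<open>k\<close>-neighbours of a chamber. The assumption
  \<open>trans\<close> is the conclusion of \<open>three_letters.transitive\<close>, for either
  order of the two letters.\<close>

locale coprime_polygon = building W S \<C> \<delta> + dihedral W S i j
  for W (structure) and S and \<C> :: "'c set" and \<delta> and i j +
  fixes c0 and q :: "'a \<Rightarrow> nat"
  assumes c0: "c0 \<in> \<C>" and R_fin: "finite (res {i, j} c0)"
    and q: "\<And>k C. k \<in> {i, j} \<Longrightarrow> C \<in> \<C> \<Longrightarrow> card (res {k} C) = Suc (q k)"
    and q_ge: "\<And>k. k \<in> {i, j} \<Longrightarrow> 2 \<le> q k" and q_cop: "coprime (q i) (q j)"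
    and trans: "\<And>a b y x x' x''. {a, b} = {i, j} \<Longrightarrow> {y, x, x', x''} \<subseteq> res {i, j} c0 \<Longrightarrow>
      \<delta> y x = a \<Longrightarrow> \<delta> x x' = b \<Longrightarrow> \<delta> x x'' = b \<Longrightarrow>
      \<exists>\<phi>. bij_betw \<phi> (res {i, j} c0) (res {i, j} c0) \<and>
        (\<forall>A\<in>res {i, j} c0. \<forall>B\<in>res {i, j} c0. \<delta> (\<phi> A) (\<phi> B) = \<delta> A B) \<and>
        (\<forall>X\<in>res {i} y \<union> res {j} y. \<phi> X = X) \<and> \<phi> x' = x''"
begin

abbreviation R where "R \<equiv> res {i, j} c0"

lemma R_sub: "R \<subseteq> \<C>" by (auto simp: res_def)

lemma R_panel: "k \<in> {i, j} \<Longrightarrow> C \<in> R \<Longrightarrow> res {k} C \<subseteq> R"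
  by (rule res_panel[OF ij _ c0])

lemma letter: "{a, b} = {i, j} \<Longrightarrow> a \<in> {i, j} \<and> b \<in> {i, j} \<and> a \<in> S \<and> b \<in> S \<and> a \<noteq> b"
  using i j ne by (auto simp: doubleton_eq_iff)

lemma panel: "k \<in> {i, j} \<Longrightarrow> C \<in> R \<Longrightarrow> D \<in> res {k} C \<longleftrightarrow> D \<in> R \<and> (D = C \<or> \<delta> C D = k)"
  using panel_iff[of k C D] R_panel[of k C] R_sub i j by auto

lemma panel_eq: "k \<in> {i, j} \<Longrightarrow> C \<in> R \<Longrightarrow> D \<in> res {k} C \<Longrightarrow> res {k} D = res {k} C"
  using res_eq[of "{k}" C D] R_sub i j by auto

lemma panel_self: "C \<in> R \<Longrightarrow> C \<in> res {k} C" using res_self R_sub by blast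

lemma panel_dist: "k \<in> {i, j} \<Longrightarrow> C \<in> R \<Longrightarrow> D \<in> res {k} C \<Longrightarrow> E \<in> res {k} C \<Longrightarrow> D \<noteq> E \<Longrightarrow> \<delta> D E = k"
  using panel_eq[of k C D] panel[of k D E] R_panel[of k C] by blast

lemma panel_finite: "k \<in> {i, j} \<Longrightarrow> C \<in> R \<Longrightarrow> finite (res {k} C)"
  using R_panel R_fin finite_subset by blast

lemma card_punctured: "k \<in> {i, j} \<Longrightarrow> C \<in> R \<Longrightarrow> card (res {k} C - {C}) = q k"
  using q[of k C] R_sub panel_self[of C k] panel_finite[of k C] by auto

lemma neighbour:
  assumes "k \<in> {i, j}" "C \<in> R" obtains D where "D \<in> res {k} C" "D \<noteq> C" "D \<noteq> E"
proof -
  have "\<not> res {k} C - {C} \<subseteq> {E}"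
  proof
    assume "res {k} C - {C} \<subseteq> {E}"
    then have "card (res {k} C - {C}) \<le> card {E}" by (rule card_mono[rotated]) simp
    then show False using card_punctured[OF assms] q_ge[OF assms(1)] by simp
  qed
  then show thesis using that by blast
qed

text \<open>The isometries of the residue, continued by the identity outside it so that composition
  of total functions yields a group.\<close>

definition G :: "('c \<Rightarrow> 'c) monoid" where
  "G = \<lparr>carrier = {g. g permutes R \<and> (\<forall>A\<in>R. \<forall>B\<in>R. \<delta> (g A) (g B) = \<delta> A B)}, monoid.mult = (\<circ>), one = id\<rparr>"

lemma G_iff: "g \<in> carrier G \<longleftrightarrow> g permutes R \<and> (\<forall>A\<in>R. \<forall>B\<in>R. \<delta> (g A) (g B) = \<delta> A B)" by (simp add: G_def)

sublocale G: perm_group G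
proof -
  have "group G"
  proof (rule groupI)
    fix g h assume "g \<in> carrier G" "h \<in> carrier G"
    then show "g \<otimes>\<^bsub>G\<^esub> h \<in> carrier G"
      using permutes_compose[of h R g] permutes_in_image[of h R] by (simp add: G_def)
  next
    show "\<one>\<^bsub>G\<^esub> \<in> carrier G" by (simp add: G_def permutes_id)
  next
    fix g assume g: "g \<in> carrier G"
    then have p: "g permutes R" by (simp add: G_def)
    have "inv_into UNIV g permutes R" using permutes_inv[OF p] .
    moreover have "\<delta> (inv_into UNIV g A) (inv_into UNIV g B) = \<delta> A B" if "A \<in> R" "B \<in> R" for A B
    proof -
      have "inv_into UNIV g A \<in> R" "inv_into UNIV g B \<in> R" using permutes_in_image[OF permutes_inv[OF p]] that by auto
      then show ?thesis using g permutes_inverses(1)[OF p] unfolding G_iff by metis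
    qed
    ultimately have "inv_into UNIV g \<in> carrier G" by (simp add: G_iff)
    moreover have "inv_into UNIV g \<otimes>\<^bsub>G\<^esub> g = \<one>\<^bsub>G\<^esub>" using permutes_inv_o(2)[OF p] by (simp add: G_def)
    ultimately show "\<exists>h\<in>carrier G. h \<otimes>\<^bsub>G\<^esub> g = \<one>\<^bsub>G\<^esub>" by blast
  qed (auto simp: G_def comp_assoc)
  moreover have "finite (carrier G)"
    by (rule finite_subset[OF _ finite_permutations[OF R_fin]]) (auto simp: G_iff)
  ultimately show "perm_group G"
    by (intro perm_group.intro fin_group.intro fin_group_axioms.intro perm_group_axioms.intro) (simp_all add: G_def)
qed

lemma G_R: "g \<in> carrier G \<Longrightarrow> A \<in> R \<Longrightarrow> g A \<in> R" using permutes_in_image[of g R] by (simp add: G_iff)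

lemma G_dist: "g \<in> carrier G \<Longrightarrow> A \<in> R \<Longrightarrow> B \<in> R \<Longrightarrow> \<delta> (g A) (g B) = \<delta> A B" by (simp add: G_iff)

lemma G_panel: "g \<in> carrier G \<Longrightarrow> k \<in> {i, j} \<Longrightarrow> C \<in> R \<Longrightarrow> D \<in> res {k} C \<Longrightarrow> g D \<in> res {k} (g C)"
  using panel[of k C D] panel[of k "g C" "g D"] G_R[of g] G_dist[of g C D] by auto

definition Fix where "Fix k C = {g \<in> carrier G. \<forall>x\<in>res {k} C. g x = x}"

text \<open>The kernel of the action of the stabiliser of \<open>C\<close> on its neighbours, the
  object of Thompson-Wielandt arguments.\<close>

definition X where "X C = {g \<in> carrier G. \<forall>x\<in>res {i} C \<union> res {j} C. g x = x}"

lemma X_Fix: "{a, b} = {i, j} \<Longrightarrow> X C = Fix a C \<inter> Fix b C"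
  unfolding X_def Fix_def by (auto simp: doubleton_eq_iff)

lemma Fix_subgroup: "subgroup (Fix k C) G"
  unfolding Fix_def by (rule G.stab_subgroup[OF G.subgroup_self])

lemma X_subgroup: "subgroup (X C) G"
  unfolding X_def by (rule G.stab_subgroup[OF G.subgroup_self])

lemma Fix_eq: "k \<in> {i, j} \<Longrightarrow> C \<in> R \<Longrightarrow> D \<in> res {k} C \<Longrightarrow> Fix k D = Fix k C"
  unfolding Fix_def using panel_eq by simp

lemma Fix_conj:
  assumes g: "g \<in> carrier G" and k: "k \<in> {i, j}" and C: "C \<in> R" and gC: "g C \<in> res {k} C" and h: "h \<in> Fix k C"
  shows "g \<otimes>\<^bsub>G\<^esub> h \<otimes>\<^bsub>G\<^esub> inv\<^bsub>G\<^esub> g \<in> Fix k C"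
proof -
  have hc: "h \<in> carrier G" using h by (simp add: Fix_def)
  have ig: "inv\<^bsub>G\<^esub> g \<in> carrier G" using g by simp
  have "g (h ((inv\<^bsub>G\<^esub> g) x)) = x" if x: "x \<in> res {k} C" for x
  proof -
    have gR: "g C \<in> R" using G_R[OF g C] .
    have "x \<in> res {k} (g C)" using panel_eq[OF k C gC] x by simp
    then have "(inv\<^bsub>G\<^esub> g) x \<in> res {k} ((inv\<^bsub>G\<^esub> g) (g C))" using G_panel[OF ig k gR] by blast
    then have "(inv\<^bsub>G\<^esub> g) x \<in> res {k} C" using g by simp
    then have "h ((inv\<^bsub>G\<^esub> g) x) = (inv\<^bsub>G\<^esub> g) x" using h by (simp add: Fix_def)
    then show ?thesis using g by simp
  qed
  then show ?thesis using g hc ig unfolding Fix_def by simp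
qed

text \<open>An element fixing the \<open>a\<close>-panel pointwise fixes \<open>D\<close>, hence
  preserves both panels of \<open>D\<close>.\<close>

lemma X_normal:
  assumes ab: "{a, b} = {i, j}" and C: "C \<in> R" and D: "D \<in> res {a} C"
  shows "G.normal_in (X D) (Fix a C)"
proof -
  have l: "a \<in> {i, j}" "b \<in> {i, j}" using letter[OF ab] by auto
  have DR: "D \<in> R" using D R_panel[OF l(1) C] by blast
  have e: "Fix a D = Fix a C" using Fix_eq[OF l(1) C D] .
  have "h \<otimes>\<^bsub>G\<^esub> n \<otimes>\<^bsub>G\<^esub> inv\<^bsub>G\<^esub> h \<in> X D" if h: "h \<in> Fix a C" and n: "n \<in> X D" for h n
  proof -
    have hc: "h \<in> carrier G" and hD: "h D = D" using h D by (auto simp: Fix_def)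
    have "h D \<in> res {k} D" for k using hD panel_self[OF DR] by simp
    then show ?thesis using Fix_conj[OF hc l(1) DR] Fix_conj[OF hc l(2) DR] n unfolding X_Fix[OF ab] by blast
  qed
  moreover have "X D \<subseteq> Fix a C" using X_Fix[OF ab] e by blast
  ultimately show ?thesis unfolding G.normal_in_def using X_subgroup Fix_subgroup by blast
qed

lemma X_trans:
  assumes ab: "{a, b} = {i, j}" and y: "y \<in> R" and x: "x \<in> res {a} y" "x \<noteq> y"
    and x': "x' \<in> res {b} x - {x}" and x'': "x'' \<in> res {b} x - {x}"
  obtains g where "g \<in> X y" "g x' = x''"
proof -
  have l: "a \<in> {i, j}" "b \<in> {i, j}" using letter[OF ab] by auto
  have xR: "x \<in> R" "\<delta> y x = a" using panel[OF l(1) y] x by auto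
  have xx: "x' \<in> R" "\<delta> x x' = b" "x'' \<in> R" "\<delta> x x'' = b" using panel[OF l(2) xR(1)] x' x'' by auto
  have "{y, x, x', x''} \<subseteq> R" using y xR xx by simp
  then obtain \<phi> where f: "bij_betw \<phi> R R" "\<forall>A\<in>R. \<forall>B\<in>R. \<delta> (\<phi> A) (\<phi> B) = \<delta> A B"
    "\<forall>X\<in>res {i} y \<union> res {j} y. \<phi> X = X" "\<phi> x' = x''"
    using trans[OF ab _ xR(2) xx(2,4)] by metis
  define g where "g A = (if A \<in> R then \<phi> A else A)" for A
  have e: "g A = \<phi> A" if "A \<in> R" for A using that by (simp add: g_def)
  have "bij_betw g R R" using f(1) bij_betw_cong[of R g \<phi>] e by blast
  then have "g permutes R" by (rule bij_imp_permutes) (simp add: g_def)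
  then have "g \<in> carrier G" unfolding G_iff using f(2) e by simp
  moreover have "g A = A" if "A \<in> res {i} y \<union> res {j} y" for A
  proof -
    have "A \<in> R" using that R_panel[of i y] R_panel[of j y] y by blast
    then show ?thesis using e[of A] f(3) that by simp
  qed
  ultimately have "g \<in> X y" by (simp add: X_def)
  moreover have "g x' = x''" using f(4) e xx by simp
  ultimately show thesis using that by blast
qed

lemma Fix_fixes: "g \<in> Fix k C \<Longrightarrow> x \<in> res {k} C \<Longrightarrow> g x = x" by (simp add: Fix_def)

lemma X_fixes: "g \<in> X C \<Longrightarrow> k \<in> {i, j} \<Longrightarrow> x \<in> res {k} C \<Longrightarrow> g x = x" by (auto simp: X_def)

lemma punctured_invariant:
  assumes g: "g \<in> carrier G" "g C = C" and k: "k \<in> {i, j}" "C \<in> R"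
  shows "g ` (res {k} C - {C}) \<subseteq> res {k} C - {C}"
proof
  fix y assume "y \<in> g ` (res {k} C - {C})"
  then obtain x where x: "x \<in> res {k} C" "x \<noteq> C" "y = g x" by blast
  have "g x \<in> res {k} C" using G_panel[OF g(1) k x(1)] g(2) by simp
  moreover have "g x \<noteq> C" using G.apply_eq[OF g(1), of x C] g(2) x(2) by simp
  ultimately show "y \<in> res {k} C - {C}" using x(3) by simp
qed

text \<open>
  If the core moved \<open>D\<close> to another chamber \<open>E\<close> of a panel of \<open>C\<close>, then every \<open>r\<close>-element of \<open>X D\<close> would
  commute with an element of the core mapping \<open>D\<close> to \<open>E\<close>, and so lie in \<open>X E\<close>; but \<open>X D\<close> is transitive on a
  set of \<open>q a\<close> neighbours of \<open>E\<close>.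
\<close>
lemma core_prime:
  assumes ab: "{a, b} = {i, j}" and r: "prime r" "r dvd q a" and C: "C \<in> R"
  shows "G.core r (Fix a C) \<subseteq> X C"
proof
  let ?N = "G.core r (Fix a C)"
  have l: "a \<in> {i, j}" "b \<in> {i, j}" using letter[OF ab] by auto
  note core = G.core[OF Fix_subgroup]
  have N: "subgroup ?N G" "?N \<subseteq> Fix a C" using core(1)[of r a C] by (auto simp: G.normal_in_def)
  have Nr: "\<not> r dvd card ?N"
  proof
    assume "r dvd card ?N"
    then show False using core(2)[of r a C] r(1) coprime_common_divisor_nat[of "card ?N" r r] prime_gt_1_nat by fastforce
  qed
  fix n assume n: "n \<in> ?N"
  show "n \<in> X C"
  proof (rule ccontr)
    assume "n \<notin> X C"
    moreover have nF: "n \<in> Fix a C" using n N by blast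
    ultimately have "n \<notin> Fix b C" using X_Fix[OF ab] by blast
    moreover have nc: "n \<in> carrier G" using nF by (simp add: Fix_def)
    ultimately obtain D where D: "D \<in> res {b} C" "n D \<noteq> D" by (auto simp: Fix_def)
    have nC: "n C = C" using Fix_fixes[OF nF panel_self[OF C]] .
    let ?E = "n D"
    have DR: "D \<in> R" using D R_panel[OF l(2) C] by blast
    have DE: "res {b} D = res {b} C" using panel_eq[OF l(2) C D(1)] .
    have E: "?E \<in> res {b} D" using G_panel[OF nc l(2) C D(1)] nC DE by simp
    have ER: "?E \<in> R" using E R_panel[OF l(2) DR] by blast
    obtain k where k: "k \<in> res {a} ?E" "k \<noteq> ?E" using neighbour[OF l(1) ER] by blast
    have ba: "{b, a} = {i, j}" using ab by (simp add: insert_commute)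
    have "(\<lambda>g. g k) ` X D = res {a} ?E - {?E}"
    proof (intro equalityI subsetI)
      fix x assume "x \<in> (\<lambda>g. g k) ` X D"
      then obtain g where g: "g \<in> X D" "x = g k" by blast
      have "g \<in> carrier G" "g ?E = ?E" using g X_fixes[OF g(1) l(2) E] by (auto simp: X_def)
      then show "x \<in> res {a} ?E - {?E}" using punctured_invariant[OF _ _ l(1) ER, of g] k g by blast
    next
      fix x assume x: "x \<in> res {a} ?E - {?E}"
      obtain g where "g \<in> X D" "g k = x" using X_trans[OF ba DR E D(2) _ x] k by blast
      then show "x \<in> (\<lambda>g. g k) ` X D" by blast
    qed
    then have "r dvd card ((\<lambda>g. g k) ` X D)" using card_punctured[OF l(1) ER] r by simp
    then obtain x e where x: "x \<in> X D" "x [^]\<^bsub>G\<^esub> (r ^ e) = \<one>\<^bsub>G\<^esub>" "x k \<noteq> k"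
      using G.prime_power_element_moves[OF X_subgroup r(1)] by blast
    have xc: "x \<in> carrier G" using x by (simp add: X_def)
    have xC: "x C = C" using X_fixes[OF x(1) l(2), of C] DE panel_self[OF C, of b] by simp
    have xD: "x D = D" using X_fixes[OF x(1) l(2) panel_self[OF DR]] .
    have xE: "x ?E = ?E" using X_fixes[OF x(1) l(2) E] .
    have "x \<otimes>\<^bsub>G\<^esub> h \<otimes>\<^bsub>G\<^esub> inv\<^bsub>G\<^esub> x \<in> ?N" if "h \<in> ?N" for h
      by (rule G.core_invariant[OF Fix_subgroup xc Fix_conj[OF xc l(1) C] that]) (use xC panel_self[OF C] in auto)
    then obtain c where c: "c \<in> ?N" "c D = ?E" "x \<otimes>\<^bsub>G\<^esub> c = c \<otimes>\<^bsub>G\<^esub> x"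
      using G.commuting_transporter[OF r(1) N(1) Nr n xc xD xE _ x(2)] by blast
    have cc: "c \<in> carrier G" using c(1) N by (auto simp: Fix_def)
    have ic: "inv\<^bsub>G\<^esub> c \<in> carrier G" using cc by simp
    have "(inv\<^bsub>G\<^esub> c) k \<in> res {a} ((inv\<^bsub>G\<^esub> c) ?E)" using G_panel[OF ic l(1) ER k(1)] .
    then have "(inv\<^bsub>G\<^esub> c) k \<in> res {a} D" using G.inv_fix[OF cc c(2)] by simp
    then have fixed: "x ((inv\<^bsub>G\<^esub> c) k) = (inv\<^bsub>G\<^esub> c) k" using X_fixes[OF x(1) l(1)] by blast
    have "x k = (x \<otimes>\<^bsub>G\<^esub> c) ((inv\<^bsub>G\<^esub> c) k)" using cc by simp
    also have "\<dots> = c (x ((inv\<^bsub>G\<^esub> c) k))" unfolding c(3) by simp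
    also have "\<dots> = k" unfolding fixed using cc by simp
    finally show False using x(3) by simp
  qed
qed

text \<open>For another chamber \<open>y\<close> of the \<open>a\<close>-panel of \<open>C\<close>,
  the group \<open>X y\<close> normalises the core and is transitive on the \<open>q b\<close>
  neighbours of type \<open>b\<close> of \<open>C\<close>. Coprime orders make the orbits of the
  core trivial there.\<close>

lemma core_coprime:
  assumes ab: "{a, b} = {i, j}" and C: "C \<in> R"
  shows "G.core (q b) (Fix a C) \<subseteq> X C"
proof
  let ?N = "G.core (q b) (Fix a C)" and ?A = "res {b} C - {C}"
  have l: "a \<in> {i, j}" "b \<in> {i, j}" using letter[OF ab] by auto
  note core = G.core[OF Fix_subgroup]
  have N: "subgroup ?N G" "?N \<subseteq> Fix a C" using core(1)[of "q b" a C] by (auto simp: G.normal_in_def)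
  obtain y where y: "y \<in> res {a} C" "y \<noteq> C" using neighbour[OF l(1) C] by blast
  have yR: "y \<in> R" using y R_panel[OF l(1) C] by blast
  have Cy: "C \<in> res {a} y" using panel_eq[OF l(1) C y(1)] panel_self[OF C] by simp
  have Xy: "X y \<subseteq> Fix a C" using X_Fix[OF ab] Fix_eq[OF l(1) C y(1)] by blast
  have A: "finite ?A" using panel_finite[OF l(2) C] by simp
  have inva: "\<forall>h\<in>?N. h ` ?A \<subseteq> ?A"
  proof
    fix h assume "h \<in> ?N"
    then have "h \<in> Fix a C" using N by blast
    then have "h \<in> carrier G" "h C = C" using panel_self[OF C] by (auto simp: Fix_def)
    then show "h ` ?A \<subseteq> ?A" by (rule punctured_invariant[OF _ _ l(2) C])
  qed
  have T: "X y \<subseteq> carrier G" by (auto simp: X_def)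
  have nor: "g \<otimes>\<^bsub>G\<^esub> n \<otimes>\<^bsub>G\<^esub> inv\<^bsub>G\<^esub> g \<in> ?N" if "g \<in> X y" "n \<in> ?N" for g n
    using core(1)[of "q b" a C] Xy that unfolding G.normal_in_def by blast
  have tr: "\<exists>g\<in>X y. g u = v" if "u \<in> ?A" "v \<in> ?A" for u v
    using X_trans[OF ab yR Cy y(2)[symmetric] that] by blast
  have cop: "coprime (card ?N) (card ?A)" using core(2)[of "q b" a C] card_punctured[OF l(2) C] by simp
  fix n assume n: "n \<in> ?N"
  have "n x = x" if "x \<in> res {b} C" for x
  proof (cases "x = C")
    case True
    have "n \<in> Fix a C" using n N by blast
    then show ?thesis using Fix_fixes[OF _ panel_self[OF C]] True by blast
  next
    case False
    then have "x \<in> ?A" using that by simp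
    then show ?thesis using G.coprime_normal_trivial[OF N(1) A inva T nor tr cop n] by blast
  qed
  moreover have "n \<in> carrier G" "n \<in> Fix a C" using n N by (auto simp: Fix_def)
  ultimately have "n \<in> Fix b C" unfolding Fix_def by simp
  then show "n \<in> X C" using \<open>n \<in> Fix a C\<close> X_Fix[OF ab] by blast
qed

lemma coprime_sym: "{a, b} = {i, j} \<Longrightarrow> coprime (q a) (q b)"
  using q_cop by (auto simp: doubleton_eq_iff coprime_commute)

lemma prime_divisor: "k \<in> {i, j} \<Longrightarrow> \<exists>r. prime r \<and> r dvd q k"
  using prime_factor_nat[of "q k"] q_ge[of k] by auto

text \<open>\<open>X C\<close> is normal in \<open>Fix a C\<close>, which equals
  \<open>Fix a D\<close>, so \<open>L\<close> is subnormal there and lies in a core contained in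
  \<open>X D\<close>. An order coprime to \<open>q a\<close> is in particular prime to some prime
  divisor of \<open>q a\<close>.\<close>

lemma subnormal_spread:
  assumes ab: "{a, b} = {i, j}" and C: "C \<in> R" and L: "G.subnormal L (X C)"
    and cop: "coprime (card L) (q a) \<or> coprime (card L) (q b) \<or> (\<exists>r. prime r \<and> r dvd q a \<and> coprime (card L) r)"
    and D: "D \<in> res {a} C"
  shows "L \<subseteq> X D"
proof -
  have l: "a \<in> {i, j}" "b \<in> {i, j}" using letter[OF ab] by auto
  have DR: "D \<in> R" using D R_panel[OF l(1) C] by blast
  have subnormal: "G.subnormal L (Fix a D)"
    using G.subnormal_step[OF L X_normal[OF ab C panel_self[OF C]]] Fix_eq[OF l(1) C D] by simp
  consider "coprime (card L) (q b)" | r where "prime r" "r dvd q a" "coprime (card L) r"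
    using cop prime_divisor[OF l(1)] coprime_divisors[OF dvd_refl] by meson
  then show ?thesis
  proof cases
    case 1 then show ?thesis using G.subnormal_core[OF subnormal] core_coprime[OF ab DR] by blast
  next
    case 2 then show ?thesis using G.subnormal_core[OF subnormal] core_prime[OF ab _ _ DR] by blast
  qed
qed

end

section \<open>The chambers whose neighbours a simple subgroup fixes\<close>

locale simple_in_polygon = coprime_polygon +
  fixes L assumes simple: "G.simple_subgroup L"
begin

definition B where "B = {C \<in> R. L \<subseteq> X C \<and> G.subnormal L (X C)}"

lemma L_sub: "subgroup L G" using simple by (simp add: G.simple_subgroup_def)

text \<open>\<open>Fix a C\<close> contains \<open>X D\<close> and has \<open>L\<close> as a
  subnormal subgroup. Intersecting the chain with \<open>X D\<close> gives a chain from
  \<open>L\<close> to \<open>X D\<close>.\<close>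

lemma B_intro:
  assumes ab: "{a, b} = {i, j}" and C: "C \<in> B" and D: "D \<in> res {a} C" and LD: "L \<subseteq> X D"
  shows "D \<in> B"
proof -
  have l: "a \<in> {i, j}" using letter[OF ab] by auto
  have CR: "C \<in> R" "G.subnormal L (X C)" using C by (auto simp: B_def)
  have DR: "D \<in> R" using D R_panel[OF l CR(1)] by blast
  have "G.subnormal L (Fix a C)" using G.subnormal_step[OF CR(2) X_normal[OF ab CR(1) panel_self[OF CR(1)]]] .
  moreover have "X D \<subseteq> Fix a C" using X_normal[OF ab CR(1) D] by (simp add: G.normal_in_def)
  ultimately have "G.subnormal (L \<inter> X D) (X D)" using G.subnormal_inter X_subgroup by blast
  moreover have "L \<inter> X D = L" using LD by blast
  ultimately show ?thesis using DR LD by (simp add: B_def)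
qed

text \<open>
  If \<open>L\<close> is not abelian, it centralises \<open>X D\<close>, which is transitive on the other panel of \<open>E\<close>; so if \<open>L\<close> acts
  nontrivially there, it acts semiregularly and its order divides \<open>q b\<close>.
\<close>
lemma at_most_one_outside:
  assumes ab: "{a, b} = {i, j}" and C: "C \<in> B" and D: "D \<in> res {a} C" "\<not> L \<subseteq> X D"
    and E: "E \<in> res {a} C" "E \<noteq> D"
  shows "L \<subseteq> X E"
proof (rule ccontr)
  assume nE: "\<not> L \<subseteq> X E"
  have l: "a \<in> {i, j}" "b \<in> {i, j}" using letter[OF ab] by auto
  have CR: "C \<in> R" "L \<subseteq> X C" "G.subnormal L (X C)" using C by (auto simp: B_def)
  have DR: "D \<in> R" "E \<in> R" using D E R_panel[OF l(1) CR(1)] by auto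
  have spread: "\<not> (coprime (card L) (q a) \<or> coprime (card L) (q b) \<or> (\<exists>r. prime r \<and> r dvd q a \<and> coprime (card L) r))"
    using subnormal_spread[OF ab CR(1,3) _ D(1)] D(2) by blast
  show False
  proof (cases "\<exists>x\<in>L. \<exists>y\<in>L. x \<otimes>\<^bsub>G\<^esub> y \<noteq> y \<otimes>\<^bsub>G\<^esub> x")
    case False
    then have p: "prime (card L)" using G.simple_abelian_prime[OF simple] by blast
    \<comment> \<open>A prime order not dividing a parameter is coprime to it, which
      \<open>spread\<close> forbids.\<close>
    have "card L dvd q a" "card L dvd q b"
      using spread prime_imp_coprime[OF p, of "q a"] prime_imp_coprime[OF p, of "q b"] by blast+
    then have "card L = 1" using coprime_common_divisor_nat[OF coprime_sym[OF ab]] by blast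
    then show False using p by simp
  next
    case True
    note subnormal = G.subnormal_step[OF CR(3) X_normal[OF ab CR(1) panel_self[OF CR(1)]]]
    have com: "\<forall>l\<in>L. \<forall>n\<in>X D. l \<otimes>\<^bsub>G\<^esub> n = n \<otimes>\<^bsub>G\<^esub> l"
      using G.simple_dichotomy[OF subnormal simple True X_normal[OF ab CR(1) D(1)]] D(2) by blast
    have LF: "L \<subseteq> Fix a C" using CR(2) X_Fix[OF ab] by blast
    have "G.normal_in (X E \<inter> L) L" using G.normal_in_inter[OF X_normal[OF ab CR(1) E(1)] L_sub LF] .
    then have triv: "X E \<inter> L = {\<one>\<^bsub>G\<^esub>}" using simple nE unfolding G.simple_subgroup_def by blast
    let ?A = "res {b} E - {E}"
    have Lc: "l \<in> carrier G" "l E = E" if "l \<in> L" for l using LF that E(1) by (auto simp: Fix_def)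
    have ED: "E \<in> res {a} D" using panel_eq[OF l(1) CR(1) D(1)] E by simp
    have "card L dvd card ?A"
    proof (rule G.semiregular_dvd[OF L_sub])
      show "finite ?A" using panel_finite[OF l(2) DR(2)] by simp
      show "\<forall>h\<in>L. h ` ?A \<subseteq> ?A"
      proof
        fix h assume h: "h \<in> L"
        show "h ` ?A \<subseteq> ?A" by (rule punctured_invariant[OF Lc(1)[OF h] Lc(2)[OF h] l(2) DR(2)])
      qed
      fix h x assume h: "h \<in> L" and x: "x \<in> ?A" "h x = x"
      have "h y = y" if y: "y \<in> res {b} E" for y
      proof (cases "y = E")
        case False
        then have "y \<in> ?A" using y by simp
        then obtain g where g: "g \<in> X D" "g x = y" using X_trans[OF ab DR(1) ED E(2) x(1)] by blast
        have "h y = (h \<otimes>\<^bsub>G\<^esub> g) x" using g by simp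
        also have "\<dots> = (g \<otimes>\<^bsub>G\<^esub> h) x" using com h g by simp
        finally show ?thesis using x g by simp
      qed (use Lc(2)[OF h] in simp)
      then have "h \<in> Fix b E" using Lc(1)[OF h] by (simp add: Fix_def)
      moreover have "h \<in> Fix a E" using LF h Fix_eq[OF l(1) CR(1) E(1)] by blast
      ultimately have "h \<in> X E \<inter> L" using X_Fix[OF ab] h by blast
      then show "h = \<one>\<^bsub>G\<^esub>" using triv by blast
    qed
    then have "card L dvd q b" using card_punctured[OF l(2) DR(2)] by simp
    \<comment> \<open>A divisor of \<open>q b\<close> is coprime to \<open>q a\<close>, so
      \<open>L\<close> would spread to \<open>D\<close> after all.\<close>
    then have "coprime (card L) (q a)" using coprime_sym[OF ab] coprime_divisors[of "card L" "q b" "q a" "q a"]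
      by (simp add: coprime_commute)
    then show False using spread by blast
  qed
qed

text \<open>There are at least two further chambers in the panel, and at most one of them is
  outside.\<close>

lemma B_neighbour:
  assumes k: "k \<in> {i, j}" and C: "C \<in> B"
  shows "\<exists>D\<in>B. \<delta> C D = k"
proof -
  obtain k' where kk: "{k, k'} = {i, j}" using k by (metis insert_commute insertE singletonD)
  have CR: "C \<in> R" using C by (simp add: B_def)
  obtain D where D: "D \<in> res {k} C" "D \<noteq> C" using neighbour[OF k CR] by blast
  obtain E where E: "E \<in> res {k} C" "E \<noteq> C" "E \<noteq> D" using neighbour[OF k CR] by blast
  have "L \<subseteq> X D \<or> L \<subseteq> X E" using at_most_one_outside[OF kk C D(1) _ E(1,3)] by blast
  then have "D \<in> B \<or> E \<in> B" using B_intro[OF kk C] D(1) E(1) by blast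
  moreover have "\<delta> C D = k" "\<delta> C E = k" using panel[OF k CR] D E by auto
  ultimately show ?thesis by blast
qed

lemma B_gallery: "f \<in> lists {i, j} \<Longrightarrow> C \<in> B \<Longrightarrow> \<exists>E\<in>B. gallery C f E"
proof (induction f arbitrary: C rule: list.induct)
  case Nil then show ?case using R_sub by (auto simp: B_def)
next
  case (Cons k f)
  have k: "k \<in> {i, j}" "f \<in> lists {i, j}" "k \<in> S" using Cons.prems i j by auto
  obtain D where D: "D \<in> B" "\<delta> C D = k" using B_neighbour[OF k(1) Cons.prems(2)] by blast
  obtain E where "E \<in> B" "gallery D f E" using Cons.IH[OF k(2) D(1)] by blast
  moreover have "C \<in> \<C>" "D \<in> \<C>" using Cons.prems D R_sub by (auto simp: B_def)
  ultimately show ?case using k D by auto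
qed

text \<open>
  A chamber \<open>D\<close> outside \<open>B\<close> next to \<open>C\<close> in \<open>B\<close> is joined through \<open>B\<close> to a panel opposite its other
  panel. As \<open>L\<close> fixes the opposite panel, it fixes that panel too.
\<close>
lemma B_closed:
  assumes ab: "{a, b} = {i, j}" and C: "C \<in> B" and D: "D \<in> res {a} C"
  shows "D \<in> B"
proof (cases "D = C")
  case False
  have l: "a \<in> {i, j}" "b \<in> {i, j}" "a \<in> S" "b \<in> S" using letter[OF ab] by auto
  have CR: "C \<in> R" "L \<subseteq> X C" using C by (auto simp: B_def)
  have DR: "D \<in> R" using D R_panel[OF l(1) CR(1)] by blast
  have CC: "C \<in> \<C>" "D \<in> \<C>" using CR DR R_sub by auto
  have DC: "\<delta> D C = a" using panel_dist[OF l(1) CR(1) D panel_self[OF CR(1)] False] .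
  interpret d: dihedral W S a b
  proof
    show "a \<otimes> b \<noteq> b \<otimes> a" using nc ab by (auto simp: doubleton_eq_iff)
  qed (use l ab fin in auto)
  interpret f: dihedral W S b a by (rule d.flip)
  let ?w = "longest {i, j}"
  have w: "?w \<in> carrier W" "inv ?w = ?w" "?w \<otimes> ?w = \<one>"
    using longest_carrier[OF ij fin] longest_inv[OF ij fin] longest_sq[OF ij fin] by auto
  \<comment> \<open>A gallery of length \<open>m - 2\<close> starting at \<open>C\<close> ends at
    distance \<open>m - 1\<close> from \<open>D\<close>, so that the other chambers of the
    \<open>b\<close>-panel of \<open>D\<close> are at distance \<open>m\<close> from its end
    \<open>E\<close>.\<close>
  define n where "n = d.m - 2"
  have m: "d.m = Suc (Suc n)" using d.m_ge_3 by (simp add: n_def)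
  have al: "alt n b a \<in> lists {i, j}" using set_alt[of n b a] l by auto
  obtain E where E: "E \<in> B" "gallery C (alt n b a) E" using B_gallery[OF al C] by blast
  have gal: "gallery D (alt (Suc n) a b) E" using E(2) CC l DC by auto
  have red: "len (ev (alt (Suc n) a b)) = Suc n" using d.len_alt[of "Suc n"] m by simp
  have DE: "\<delta> D E = ev (alt (Suc n) a b)" using gallery_dist[OF gal] red by simp
  have wb: "?w = b \<otimes> \<delta> D E"
    using f.longest_alt d.flip_m m DE ab by (simp add: insert_commute)
  have lw: "len ?w = Suc (Suc n)" using m ab by (simp add: d.m_def)
  have ER: "E \<in> R" "E \<in> \<C>" "L \<subseteq> X E" using E R_sub by (auto simp: B_def)
  have "L \<subseteq> Fix b D"
  proof
    fix g assume g: "g \<in> L"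
    have gc: "g \<in> carrier G" using g CR by (auto simp: X_def)
    have gD: "g D = D" using X_fixes[OF _ l(1) D] g CR by blast
    have "g F = F" if F: "F \<in> res {b} D" for F
    proof (cases "F = D")
      case False
      have FR: "F \<in> R" "F \<in> \<C>" using F R_panel[OF l(2) DR] R_sub by auto
      have "\<delta> F D = b" using panel_dist[OF l(2) DR F panel_self[OF DR] False] .
      then have FE: "\<delta> F E = ?w" using dist_step_up[OF FR(2) ER(2) CC(2) l(4)] wb lw red DE by simp
      let ?k = "?w \<otimes> b \<otimes> ?w"
      have k: "?k \<in> {i, j}" using longest_conj_S[OF ij fin l(2)] .
      then have kS: "?k \<in> S" using i j by auto
      have EF: "\<delta> E F = ?w" using dist_inv[OF FR(2) ER(2)] FE w by simp
      \<comment> \<open>On the \<open>b\<close>-panel of \<open>D\<close>, \<open>F\<close> is the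
        only chamber at less than maximal distance from \<open>E'\<close>. Therefore
        \<open>g\<close>, which fixes \<open>E'\<close> and preserves the panel, fixes
        \<open>F\<close>.\<close>
      obtain E' where E': "E' \<in> \<C>" "\<delta> E' E = ?k" "\<delta> E' F = ?k \<otimes> ?w" using WD3[OF ER(2) FR(2) kS] EF by auto
      have EE: "E' \<in> res {?k} E" using panel_iff[OF kS ER(2)] E' adj_sym[OF E'(1) ER(2) E'(2) kS] by blast
      have gE': "g E' = E'" using X_fixes[OF _ k EE] g ER by blast
      have E'R: "E' \<in> R" using EE R_panel[OF k ER(1)] by blast
      have "\<delta> E' F = ?w \<otimes> b" using E'(3) w l by (simp add: m_assoc)
      then have FE': "\<delta> F E' = b \<otimes> ?w" using dist_inv[OF E'(1) FR(2)] w l by (simp add: inv_mult_group)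
      show ?thesis
      proof (rule ccontr)
        assume ne: "g F \<noteq> F"
        have gF: "g F \<in> res {b} D" using G_panel[OF gc l(2) DR F] gD by simp
        have gFR: "g F \<in> \<C>" using G_R[OF gc FR(1)] R_sub by blast
        have "\<delta> (g F) F = b" using panel_dist[OF l(2) DR gF F ne] .
        moreover have "len (b \<otimes> (b \<otimes> ?w)) = len (b \<otimes> ?w) + 1"
          using len_longest_mult[OF ij fin par_incl[OF l(2)]] l w by simp
        ultimately have "\<delta> (g F) E' = b \<otimes> (b \<otimes> ?w)"
          using dist_step_up[OF gFR E'(1) FR(2) l(4)] FE' by simp
        moreover have "\<delta> (g F) E' = b \<otimes> ?w" using G_dist[OF gc FR(1) E'R] gE' FE' by simp
        ultimately show False using \<open>len (b \<otimes> (b \<otimes> ?w)) = len (b \<otimes> ?w) + 1\<close> by simp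
      qed
    qed (use gD in simp)
    then show "g \<in> Fix b D" using gc by (simp add: Fix_def)
  qed
  moreover have "L \<subseteq> Fix a D" using CR(2) X_Fix[OF ab] Fix_eq[OF l(1) CR(1) D] by blast
  ultimately have "L \<subseteq> X D" using X_Fix[OF ab] by blast
  then show ?thesis using B_intro[OF ab C D] by blast
qed (use C in simp)

lemma B_gallery_closed: "gallery C f D \<Longrightarrow> f \<in> lists {i, j} \<Longrightarrow> C \<in> B \<Longrightarrow> D \<in> B"
proof (induction f arbitrary: C rule: list.induct)
  case (Cons k f)
  obtain E where E: "E \<in> \<C>" "k \<in> S" "\<delta> C E = k" "gallery E f D" "C \<in> \<C>" using Cons.prems by auto
  have k: "k \<in> {i, j}" "f \<in> lists {i, j}" using Cons.prems by auto
  obtain k' where kk: "{k, k'} = {i, j}" using k(1) by (metis insert_commute insertE singletonD)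
  have "E \<in> res {k} C" using panel_iff[OF E(2,5)] E by blast
  then have "E \<in> B" using B_closed[OF kk Cons.prems(3)] by blast
  then show ?case using Cons.IH[OF E(4) k(2)] by blast
qed simp

text \<open>One chamber in \<open>B\<close> would put the whole residue into \<open>B\<close>, and
  \<open>L\<close> would fix every chamber of it.\<close>

lemma B_empty: "C \<notin> B"
proof
  assume C: "C \<in> B"
  then have CR: "C \<in> R" "C \<in> \<C>" using R_sub by (auto simp: B_def)
  have "D \<in> B" if D: "D \<in> R" for D
  proof -
    have dp: "\<delta> C D \<in> par {i, j}" using res_eq[OF ij c0 CR(1)] D by (auto simp: res_def)
    have Dc: "D \<in> \<C>" using D R_sub by blast
    obtain f where f: "f \<in> lists {i, j}" "f \<in> lists S" "ev f = \<delta> C D" "length f = len (ev f)" "gallery C f D"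
      using par_gallery[OF ij CR(2) Dc dp] .
    show ?thesis by (rule B_gallery_closed[OF f(5,1) C])
  qed
  then have X: "L \<subseteq> X D" if "D \<in> R" for D using that by (auto simp: B_def)
  have "g = \<one>\<^bsub>G\<^esub>" if g: "g \<in> L" for g
  proof
    fix x
    show "g x = \<one>\<^bsub>G\<^esub> x"
    proof (cases "x \<in> R")
      case True
      then have "g \<in> X x" using X g by blast
      then have "g x = x" by (rule X_fixes[of _ _ i]) (use panel_self[OF True] in auto)
      then show ?thesis by simp
    next
      case False
      have "g permutes R" using g X[OF CR(1)] by (auto simp: X_def G_iff)
      then show ?thesis using permutes_not_in[OF _ False] by simp
    qed
  qed
  then have "L = {\<one>\<^bsub>G\<^esub>}" using subgroup.one_closed[OF L_sub] by blast
  then show False using simple by (simp add: G.simple_subgroup_def)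
qed

end

context coprime_polygon
begin

text \<open>Transitivity on at least two chambers makes \<open>X c0\<close> nontrivial. It has a
  simple subnormal subgroup \<open>L\<close>, for which \<open>c0\<close> itself lies in
  \<open>B\<close>.\<close>

lemma contradiction: False
proof -
  have c0R: "c0 \<in> R" using res_self[OF c0] .
  have ij2: "i \<in> {i, j}" "j \<in> {i, j}" by auto
  obtain x where x: "x \<in> res {i} c0" "x \<noteq> c0" using neighbour[OF ij2(1) c0R] by blast
  have xR: "x \<in> R" using x R_panel[OF ij2(1) c0R] by blast
  obtain x1 where x1: "x1 \<in> res {j} x" "x1 \<noteq> x" using neighbour[OF ij2(2) xR] by blast
  obtain x2 where x2: "x2 \<in> res {j} x" "x2 \<noteq> x" "x2 \<noteq> x1" using neighbour[OF ij2(2) xR] by blast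
  obtain g where g: "g \<in> X c0" "g x1 = x2" using X_trans[OF HOL.refl c0R x] x1 x2 by blast
  have "g \<noteq> \<one>\<^bsub>G\<^esub>" using g x2 by auto
  then have ne: "X c0 \<noteq> {\<one>\<^bsub>G\<^esub>}" using g by blast
  obtain L where L: "G.subnormal L (X c0)" "G.simple_subgroup L" using G.simple_subnormal_exists[OF X_subgroup ne] .
  interpret s: simple_in_polygon W S \<C> \<delta> i j c0 q L by unfold_locales (rule L(2))
  have "c0 \<in> s.B" unfolding s.B_def using c0R L(1) G.subnormal_sub[OF L(1)] by blast
  then show False using s.B_empty by blast
qed

end

section \<open>Choice of the three generators and conclusion\<close>

context coxeter_system
begin

text \<open>Irreducibility is used for \<open>{s}\<close> and for \<open>{s, t}\<close>, which are
  proper since \<open>S\<close> has at least three elements: neither commutes with everything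
  outside it.\<close>

lemma irreducible_triple:
  assumes irr: "irreducible_type W S" and S: "finite S" "3 \<le> card S"
  obtains s t u where "s \<in> S" "t \<in> S" "u \<in> S" "s \<otimes> t \<noteq> t \<otimes> s" "u \<noteq> s" "u \<noteq> t"
    "\<not> (u \<otimes> s = s \<otimes> u \<and> u \<otimes> t = t \<otimes> u)"
proof -
  have proper: "{a, b} \<noteq> S" for a b
  proof
    assume "{a, b} = S"
    moreover have "card {a, b} \<le> 2" by (simp add: card_insert_if)
    ultimately show False using S by simp
  qed
  obtain s where s: "s \<in> S" using irr unfolding irreducible_type_def by blast
  have "\<exists>t\<in>S - {s}. t \<otimes> s \<noteq> s \<otimes> t"
    using irreducible_commuting[OF irr, of "{s}"] s proper[of s s] by auto
  then obtain t where t: "t \<in> S" "t \<otimes> s \<noteq> s \<otimes> t" by blast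
  have "\<exists>u\<in>S - {s, t}. \<exists>v\<in>{s, t}. u \<otimes> v \<noteq> v \<otimes> u"
    using irreducible_commuting[OF irr, of "{s, t}"] s t proper[of s t] by blast
  then obtain u where "u \<in> S" "u \<noteq> s" "u \<noteq> t" "\<not> (u \<otimes> s = s \<otimes> u \<and> u \<otimes> t = t \<otimes> u)" by blast
  then show thesis using that[OF s t(1)] t(2) by metis
qed

end

context locally_finite_opposing
begin

lemma no_large_rank: "\<not> 3 \<le> card S"
proof
  assume c3: "3 \<le> card S"
  obtain s t u where stu: "s \<in> S" "t \<in> S" "u \<in> S" "s \<otimes> t \<noteq> t \<otimes> s" "u \<noteq> s" "u \<noteq> t"
    "\<not> (u \<otimes> s = s \<otimes> u \<and> u \<otimes> t = t \<otimes> u)" using irreducible_triple[OF irr finS c3] .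
  obtain c0 where c0: "c0 \<in> \<Delta> True" using half.nonempty by blast
  have K: "{s, t} \<subseteq> S" "finite (par {s, t})" using stu finite_par by auto
  let ?R = "half.res True {s, t} c0"
  define q where "q k = card (half.res True {k} c0) - 1" for k
  interpret d: dihedral W S s t by unfold_locales (use stu K in auto)
  interpret coprime_polygon W S "\<Delta> True" \<delta> s t c0 q
  proof
    show "c0 \<in> \<Delta> True" by (rule c0)
    show "finite ?R"
    proof (rule half.finite_res[OF K c0])
      fix k C assume "k \<in> {s, t}" "C \<in> \<Delta> True"
      then show "finite (half.res True {k} C)" using panel_finite[of k C True] K by blast
    qed
    show "card (half.res True {k} C) = Suc (q k)" if "k \<in> {s, t}" "C \<in> \<Delta> True" for k C
    proof -
      have kS: "k \<in> S" using that K by blast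
      show ?thesis unfolding q_def using card_panel[OF kS that(2) c0] panel_thick[OF kS that(2)] by simp
    qed
    show "2 \<le> q k" if "k \<in> {s, t}" for k
    proof -
      have kS: "k \<in> S" using that K by blast
      show ?thesis unfolding q_def using panel_thick[OF kS c0] by simp
    qed
    show "coprime (q s) (q t)" unfolding q_def using coprime_panels[OF stu(1,2,4) c0] .
    fix a b y x x' x''
    assume ab: "{a, b} = {s, t}" and sub: "{y, x, x', x''} \<subseteq> ?R" and dist: "\<delta> y x = a" "\<delta> x x' = b" "\<delta> x x'' = b"
    have abst: "a = s \<and> b = t \<or> a = t \<and> b = s" using ab by (auto simp: doubleton_eq_iff)
    have pos: "y \<in> \<Delta> True" "x \<in> \<Delta> True" "x' \<in> \<Delta> True" "x'' \<in> \<Delta> True" using sub by (auto simp: half.res_def)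
    interpret tl: three_letters W S \<Delta> \<delta> \<delta>s True a b u
    proof
      show "a \<in> S" "b \<in> S" "u \<in> S" "u \<noteq> a" "u \<noteq> b" using abst stu by auto
      show "a \<otimes> b \<noteq> b \<otimes> a" "\<not> (u \<otimes> a = a \<otimes> u \<and> u \<otimes> b = b \<otimes> u)" using abst stu by auto
      show "finite (par {a, b})" "finite (par {b, u})" "finite (par {a, u})" using abst stu finite_par by auto
    qed
    have Ry: "half.res True {a, b} y = ?R" unfolding ab using half.res_eq[OF K(1) c0] sub by simp
    have un: "half.res True {a} y \<union> half.res True {b} y = half.res True {s} y \<union> half.res True {t} y" using abst by auto
    obtain \<phi> where "bij_betw \<phi> ?R ?R" "\<forall>A\<in>?R. \<forall>B\<in>?R. \<delta> (\<phi> A) (\<phi> B) = \<delta> A B"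
      "\<forall>X\<in>half.res True {s} y \<union> half.res True {t} y. \<phi> X = X" "\<phi> x' = x''"
      using tl.transitive[OF third_chamber pos dist, unfolded Ry un] .
    then show "\<exists>\<phi>. bij_betw \<phi> ?R ?R \<and> (\<forall>A\<in>?R. \<forall>B\<in>?R. \<delta> (\<phi> A) (\<phi> B) = \<delta> A B) \<and>
        (\<forall>X\<in>half.res True {s} y \<union> half.res True {t} y. \<phi> X = X) \<and> \<phi> x' = x''" by blast
  qed
  show False by (rule contradiction)
qed

end

theorem theorem1p2:
  fixes W :: "'w monoid" and S :: "'w set"
    and \<Delta> :: "bool \<Rightarrow> 'c set"
    and \<delta> \<delta>s :: "'c \<Rightarrow> 'c \<Rightarrow> 'w"
    and J :: "'w set"
  assumes "twin_building W S \<Delta> \<delta> \<delta>s"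
    and "finite S"
    and "irreducible_type W S"
    and "two_spherical W S"
    and "locally_finite W S \<Delta> \<delta>"
    and "thick W S \<Delta> \<delta>"
    and "card S \<ge> 3"
    and "J \<subseteq> S"
    and "J \<noteq> {}"
  shows "\<not> (\<exists>\<theta>. twin_automorphism W S \<Delta> \<delta> \<delta>s \<theta> \<and>
    (\<forall>\<epsilon> R. residue_in W (\<Delta> \<epsilon>) \<delta> (S - J) R \<longrightarrow>
      opposite_residues W S \<Delta> \<delta> \<delta>s R (\<theta> ` R)))"
proof
  assume "\<exists>\<theta>. twin_automorphism W S \<Delta> \<delta> \<delta>s \<theta> \<and>
    (\<forall>\<epsilon> R. residue_in W (\<Delta> \<epsilon>) \<delta> (S - J) R \<longrightarrow> opposite_residues W S \<Delta> \<delta> \<delta>s R (\<theta> ` R))"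
  then obtain \<theta> where aut: "twin_automorphism W S \<Delta> \<delta> \<delta>s \<theta>"
    and opp: "\<And>\<epsilon> R. residue_in W (\<Delta> \<epsilon>) \<delta> (S - J) R \<Longrightarrow> opposite_residues W S \<Delta> \<delta> \<delta>s R (\<theta> ` R)" by blast
  interpret twin_building W S \<Delta> \<delta> \<delta>s by (rule assms(1))
  interpret locally_finite_opposing W S \<Delta> \<delta> \<delta>s \<theta> J
    by unfold_locales (use assms aut opp in auto)
  show False using no_large_rank assms(7) by simp
qed

end
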